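(* Let $N$ agents be given by $$\dot x_i=A_ix_i+B_iu_i+E_i\omega_i,\qquad y_i=C_ix_i,\qquad \dot\omega_i=S_i\omega_i,\qquad i=1,\dots,N,$$ with $x_i(t)\in\mathbb{R}^{n_i}$, $u_i(t)\in\mathbb{R}$, $y_i(t)\in\mathbb{R}$, $\omega_i(t)\in\mathbb{R}^{q_i}$ and constant real matrices $A_i,B_i,C_i,E_i,S_i$ of compatible dimensions, where $(C_i,A_i,B_i)$ is minimal (i.e. $(A_i,B_i)$ is controllable and $(C_i,A_i)$ is observable) and $(E_i,S_i)$ is observable. Suppose each agent is minimum-phase with relative degree $r_i>0$. Let $d_i\in\mathbb{R}$ and let $f_i:\mathbb{R}\to\mathbb{R}$ be twice continuously differentiable functions for which there are constants $0<\underline h_i\le\bar h_i<\infty$ with $\underline h_i\le\nabla^2f_i(s)\le\bar h_i$ for all $s\in\mathbb{R}$. Let $\mathcal G$ be a connected undirected weighted graph on $\{1,\dots,N\}$ with adjacency weights $a_{ij}=a_{ji}\ge0$, $a_{ii}=0$. For each $i$ choose $\bar L_i$ such that $S_i-\bar L_iE_i$ is Hurwitz, and constants $c_{i0},\dots,c_{i,r_i-1}$ such that the polynomial $s^{r_i}+\sum_{k=0}^{r_i-1}c_{ik}s^k$ is Hurwitz. For $\varepsilon>0$ let the gain matrices $\hat X_i,\bar K_{i1},\bar K_{i2},\bar K_{i3}$ be as defined in the context, and consider the controller $$\begin{aligned} u_i&=-\frac{C_iA_i^{r_i}}{C_iA_i^{r_i-1}B_i}x_i+\bar K_{i1}\hat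 X_ix_i+\bar K_{i2}\eta_i+\bar K_{i3}z_i,\qquad \eta_i=\bar\eta_i+\bar L_ix_i,\\ \dot{\bar\eta}_i&=(S_i-\bar L_iE_i)\bar\eta_i+(S_i\bar L_i-\bar L_iE_i\bar L_i-\bar L_iA_i)x_i-\bar L_iB_iu_i,\\ \dot z_i&=-\nabla f_i(y_i)+\lambda_i,\\ \dot\lambda_i&=-\lambda_i^0-v_i^0+d_i-z_i,\\ \dot v_i&=\lambda_i^0, \end{aligned}$$ where $\lambda_i^0=\sum_{j=1}^Na_{ij}(\lambda_i-\lambda_j)$ and $v_i^0=\sum_{j=1}^Na_{ij}(v_i-v_j)$. Then there exists a constant $\varepsilon^*>0$ such that for every $\varepsilon\in(0,\varepsilon^* )$ this controller exponentially solves the distributed optimal steady-state regulation problem: for every initial condition of the closed-loop system and of the disturbances $\omega_i$, and for each $i=1,\dots,N$, the output $y_i(t)$ converges exponentially fast to $y_i^*$ as $t\to\infty$, where $y^*=(y_1^*,\dots,y_N^* )$ is the optimal solution of $$\text{minimize }\ \sum_{i=1}^Nf_i(y_i)\quad\text{subject to}\quad \sum_{i=1}^Ny_i=\sum_{i=1}^Nd_i .$$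
   Context: A square real matrix is Hurwitz if all its eigenvalues have negative real part; a polynomial is Hurwitz if all its roots have negative real part. The pair $(E_i,S_i)$ is observable if the linear system $\dot\omega=S_i\omega$ with output $E_i\omega$ is observable. Agent $i$ has relative degree $r_i$ if $C_iA_i^{k}B_i=0$ for $0\le k<r_i-1$ and $C_iA_i^{r_i-1}B_i\ne0$; it is minimum-phase if all zeros of its transfer function $C_i(sI-A_i)^{-1}B_i$ have negative real part (equivalently, its zero dynamics matrix is Hurwitz). Here $\mathrm{col}(\cdot)$ denotes vertical stacking. Gain definitions, for each $i$ and $\varepsilon>0$: $\bar X_{i1,1}=0\in\mathbb{R}^{1\times q_i}$ and $\bar X_{i1,k+1}=\bar X_{i1,k}S_i-C_iA_i^{k-1}E_i$ for $k=1,\dots,r_i-1$; $\bar X_{i1}=\mathrm{col}(\bar X_{i1,1},\dots,\bar X_{i1,r_i})$; $$\bar U_{i1}=\frac{\bar X_{i1,r_i}S_i-C_iA_i^{r_i-1}E_i}{C_iA_i^{r_i-1}B_i},\qquad \bar X_{i2}=\mathrm{col}(1,0,\dots,0)\in\mathbb{R}^{r_i},\qquad \bar U_{i2}=0,$$ $$\bar K_{i1}=-\frac{1}{C_iA_i^{r_i-1}B_i\,\varepsilon^{r_i}}\begin{bmatrix}c_{i0}&\varepsilon c_{i1}&\cdots&\varepsilon^{r_i-1}c_{i,r_i-1}\end{bmatrix},\qquad \bar K_{i2}=\bar U_{i1}-\bar K_{i1}\bar X_{i1},\qquad \bar K_{i3}=\bar U_{i2}-\bar K_{i1}\bar X_{i2},$$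 $$\hat X_i=\mathrm{col}(C_i,\,C_iA_i,\,\dots,\,C_iA_i^{r_i-1}).$$ Under the stated assumptions on $f_i$, the constrained optimization problem has a unique optimal solution $y^*$. In $\mathcal G$, $a_{ij}>0$ if and only if there is an edge between nodes $i$ and $j$. Convergence of $y_i(t)$ to $y_i^*$ exponentially fast means that there are constants $\mu_1,\mu_2>0$ (where $\mu_1$ may depend on the initial conditions) with $|y_i(t)-y_i^*|\le\mu_1e^{-\mu_2t}$ for all $t\ge0$. For the scalar function $f_i$, $\nabla f_i$ and $\nabla^2f_i$ are its first and second derivatives. *)

theory Defs
  imports
    Complex_Main
    "Jordan_Normal_Form.Matrix"
    "Jordan_Normal_Form.Gauss_Jordan_Elimination"
    "Jordan_Normal_Form.Char_Poly"
begin

text \<open>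
  The dimensions of the agents differ, so vectors and matrices are those with explicit
  carriers. Inputs and outputs are vectors of dimension 1, and input and output matrices have
  one column and one row, respectively.
\<close>

abbreviation cmat :: "real mat \<Rightarrow> complex mat" where
  "cmat M \<equiv> map_mat complex_of_real M"

definition hurwitz_mat :: "real mat \<Rightarrow> bool" where
  "hurwitz_mat M \<longleftrightarrow> (\<forall>l. eigenvalue (cmat M) l \<longrightarrow> Re l < 0)"

definition hurwitz_poly :: "real poly \<Rightarrow> bool" where
  "hurwitz_poly p \<longleftrightarrow> (\<forall>s. poly (map_poly complex_of_real p) s = 0 \<longrightarrow> Re s < 0)"

text \<open>Trajectories live on the time interval from 0 to infinity and are differentiated
  componentwise, with a one-sided derivative at time 0.\<close>

definition vec_ode :: "nat \<Rightarrow> (real \<Rightarrow> real vec) \<Rightarrow> (real \<Rightarrow> real vec) \<Rightarrow> bool" where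
  "vec_ode n x dx \<longleftrightarrow>
     (\<forall>t\<ge>0. x t \<in> carrier_vec n \<and> dx t \<in> carrier_vec n \<and>
        (\<forall>j<n. ((\<lambda>\<tau>. x \<tau> $ j) has_real_derivative dx t $ j) (at t within {0..})))"

definition scalar_ode :: "(real \<Rightarrow> real) \<Rightarrow> (real \<Rightarrow> real) \<Rightarrow> bool" where
  "scalar_ode z dz \<longleftrightarrow> (\<forall>t\<ge>0. (z has_real_derivative dz t) (at t within {0..}))"

definition controllable :: "real mat \<Rightarrow> real mat \<Rightarrow> bool" where
  "controllable A B \<longleftrightarrow>
     (\<forall>x0\<in>carrier_vec (dim_row A). \<forall>x1\<in>carrier_vec (dim_row A). \<exists>T>0. \<exists>u x.
        (\<forall>t. u t \<in> carrier_vec (dim_col B)) \<and>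
        (\<forall>j<dim_col B. continuous_on {0..} (\<lambda>t. u t $ j)) \<and>
        vec_ode (dim_row A) x (\<lambda>t. A *\<^sub>v x t + B *\<^sub>v u t) \<and> x 0 = x0 \<and> x T = x1)"

text \<open>Outputs are indistinguishable only for equal initial states. The output matrix comes
  first, as in the pairs \<open>(C, A)\<close> and \<open>(E, S)\<close>.\<close>

definition observable :: "real mat \<Rightarrow> real mat \<Rightarrow> bool" where
  "observable C A \<longleftrightarrow>
     (\<forall>x x'. vec_ode (dim_row A) x (\<lambda>t. A *\<^sub>v x t) \<and> vec_ode (dim_row A) x' (\<lambda>t. A *\<^sub>v x' t) \<and>
        (\<forall>t\<ge>0. C *\<^sub>v x t = C *\<^sub>v x' t) \<longrightarrow> x 0 = x' 0)"

definition minimal :: "real mat \<Rightarrow> real mat \<Rightarrow> real mat \<Rightarrow> bool" where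
  "minimal C A B \<longleftrightarrow> controllable A B \<and> observable C A"

definition relative_degree :: "real mat \<Rightarrow> real mat \<Rightarrow> real mat \<Rightarrow> nat \<Rightarrow> bool" where
  "relative_degree A B C r \<longleftrightarrow>
     (\<forall>k<r - 1. C * A ^\<^sub>m k * B = 0\<^sub>m 1 1) \<and> C * A ^\<^sub>m (r - 1) * B \<noteq> 0\<^sub>m 1 1"

definition transfer_function :: "real mat \<Rightarrow> real mat \<Rightarrow> real mat \<Rightarrow> complex \<Rightarrow> complex" where
  "transfer_function A B C s =
     (cmat C * the (mat_inverse (s \<cdot>\<^sub>m 1\<^sub>m (dim_row A) - cmat A)) * cmat B) $$ (0, 0)"

text \<open>The transfer function is rational and the defining formula makes sense off the
  spectrum of \<open>A\<close>. The (finite) zeros of the rational function are the points where it tends to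
  0; the limit takes care of removable singularities in the spectrum.\<close>

definition transfer_zero :: "real mat \<Rightarrow> real mat \<Rightarrow> real mat \<Rightarrow> complex \<Rightarrow> bool" where
  "transfer_zero A B C s \<longleftrightarrow> (transfer_function A B C \<longlongrightarrow> 0) (at s)"

definition minimum_phase :: "real mat \<Rightarrow> real mat \<Rightarrow> real mat \<Rightarrow> bool" where
  "minimum_phase A B C \<longleftrightarrow> (\<forall>s. transfer_zero A B C s \<longrightarrow> Re s < 0)"

definition connected_graph :: "nat \<Rightarrow> (nat \<Rightarrow> nat \<Rightarrow> real) \<Rightarrow> bool" where
  "connected_graph N a \<longleftrightarrow>
     (\<forall>i\<in>{1..N}. \<forall>j\<in>{1..N}. (i, j) \<in> {(k, l). k \<in> {1..N} \<and> l \<in> {1..N} \<and> a k l > 0}\<^sup>*)"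

definition hf_gain :: "real mat \<Rightarrow> real mat \<Rightarrow> real mat \<Rightarrow> nat \<Rightarrow> real" where
  "hf_gain A B C r = (C * A ^\<^sub>m (r - 1) * B) $$ (0, 0)"

text \<open>Rows are counted from 0: \<open>X1_row A C E S k\<close> is the row with index \<open>k + 1\<close> of the
  stacked matrix \<open>X1\<close>.\<close>

primrec X1_row :: "real mat \<Rightarrow> real mat \<Rightarrow> real mat \<Rightarrow> real mat \<Rightarrow> nat \<Rightarrow> real mat" where
  "X1_row A C E S 0 = 0\<^sub>m 1 (dim_row S)"
| "X1_row A C E S (Suc k) = X1_row A C E S k * S - C * A ^\<^sub>m k * E"

definition X1 :: "real mat \<Rightarrow> real mat \<Rightarrow> real mat \<Rightarrow> real mat \<Rightarrow> nat \<Rightarrow> real mat" where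
  "X1 A C E S r = mat r (dim_row S) (\<lambda>(k, j). X1_row A C E S k $$ (0, j))"

definition U1 :: "real mat \<Rightarrow> real mat \<Rightarrow> real mat \<Rightarrow> real mat \<Rightarrow> real mat \<Rightarrow> nat \<Rightarrow> real mat" where
  "U1 A B C E S r =
     (1 / hf_gain A B C r) \<cdot>\<^sub>m (X1_row A C E S (r - 1) * S - C * A ^\<^sub>m (r - 1) * E)"

definition X2 :: "nat \<Rightarrow> real mat" where
  "X2 r = mat r 1 (\<lambda>(k, j). if k = 0 then 1 else 0)"

definition U2 :: "real mat" where
  "U2 = 0\<^sub>m 1 1"

definition K1 :: "real mat \<Rightarrow> real mat \<Rightarrow> real mat \<Rightarrow> nat \<Rightarrow> (nat \<Rightarrow> real) \<Rightarrow> real \<Rightarrow> real mat" where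
  "K1 A B C r c \<epsilon> =
     (- (1 / (hf_gain A B C r * \<epsilon> ^ r))) \<cdot>\<^sub>m mat 1 r (\<lambda>(j, k). \<epsilon> ^ k * c k)"

definition K2 :: "real mat \<Rightarrow> real mat \<Rightarrow> real mat \<Rightarrow> real mat \<Rightarrow> real mat \<Rightarrow> nat \<Rightarrow>
    (nat \<Rightarrow> real) \<Rightarrow> real \<Rightarrow> real mat" where
  "K2 A B C E S r c \<epsilon> = U1 A B C E S r - K1 A B C r c \<epsilon> * X1 A C E S r"

definition K3 :: "real mat \<Rightarrow> real mat \<Rightarrow> real mat \<Rightarrow> nat \<Rightarrow> (nat \<Rightarrow> real) \<Rightarrow> real \<Rightarrow> real mat" where
  "K3 A B C r c \<epsilon> = U2 - K1 A B C r c \<epsilon> * X2 r"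

definition Xhat :: "real mat \<Rightarrow> real mat \<Rightarrow> nat \<Rightarrow> real mat" where
  "Xhat A C r = mat r (dim_row A) (\<lambda>(k, j). (C * A ^\<^sub>m k) $$ (0, j))"

definition control_input :: "real mat \<Rightarrow> real mat \<Rightarrow> real mat \<Rightarrow> real mat \<Rightarrow> real mat \<Rightarrow> nat \<Rightarrow>
    (nat \<Rightarrow> real) \<Rightarrow> real \<Rightarrow> real vec \<Rightarrow> real vec \<Rightarrow> real \<Rightarrow> real vec" where
  "control_input A B C E S r c \<epsilon> x \<eta> z =
     (- (1 / hf_gain A B C r)) \<cdot>\<^sub>v (C * A ^\<^sub>m r *\<^sub>v x)
     + K1 A B C r c \<epsilon> * Xhat A C r *\<^sub>v x
     + K2 A B C E S r c \<epsilon> *\<^sub>v \<eta>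
     + K3 A B C r c \<epsilon> *\<^sub>v vec 1 (\<lambda>_. z)"

definition agent_output :: "real mat \<Rightarrow> real vec \<Rightarrow> real" where
  "agent_output C x = (C *\<^sub>v x) $ 0"

definition neighbor_diff :: "nat \<Rightarrow> (nat \<Rightarrow> nat \<Rightarrow> real) \<Rightarrow> (nat \<Rightarrow> real) \<Rightarrow> nat \<Rightarrow> real" where
  "neighbor_diff N a p i = (\<Sum>j=1..N. a i j * (p i - p j))"

text \<open>In \<open>closed_loop\<close>, \<open>\<eta>b\<close> is the state of the disturbance observer, \<open>\<eta>\<close> is the resulting
  estimate of the disturbance \<open>\<omega>\<close>, and \<open>f'\<close> is the family of gradients of the cost functions.\<close>

definition closed_loop where
  "closed_loop N n q r A B C E S L c a d (f' :: nat \<Rightarrow> real \<Rightarrow> real) (\<epsilon> :: real)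
      (x :: nat \<Rightarrow> real \<Rightarrow> real vec) (\<omega> :: nat \<Rightarrow> real \<Rightarrow> real vec)
      (\<eta>b :: nat \<Rightarrow> real \<Rightarrow> real vec) (z :: nat \<Rightarrow> real \<Rightarrow> real)
      (lam :: nat \<Rightarrow> real \<Rightarrow> real) (v :: nat \<Rightarrow> real \<Rightarrow> real) \<longleftrightarrow>
   (\<forall>i\<in>{1..N}.
      let \<eta> = (\<lambda>t. \<eta>b i t + L i *\<^sub>v x i t);
          u = (\<lambda>t. control_input (A i) (B i) (C i) (E i) (S i) (r i) (c i) \<epsilon> (x i t) (\<eta> t) (z i t));
          lam0 = (\<lambda>t. neighbor_diff N a (\<lambda>j. lam j t) i);
          v0 = (\<lambda>t. neighbor_diff N a (\<lambda>j. v j t) i)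
      in
        vec_ode (n i) (x i) (\<lambda>t. A i *\<^sub>v x i t + B i *\<^sub>v u t + E i *\<^sub>v \<omega> i t) \<and>
        vec_ode (q i) (\<omega> i) (\<lambda>t. S i *\<^sub>v \<omega> i t) \<and>
        vec_ode (q i) (\<eta>b i) (\<lambda>t. (S i - L i * E i) *\<^sub>v \<eta>b i t
            + (S i * L i - L i * E i * L i - L i * A i) *\<^sub>v x i t
            - L i * B i *\<^sub>v u t) \<and>
        scalar_ode (z i) (\<lambda>t. - f' i (agent_output (C i) (x i t)) + lam i t) \<and>
        scalar_ode (lam i) (\<lambda>t. - lam0 t - v0 t + d i - z i t) \<and>
        scalar_ode (v i) lam0)"

definition feasible :: "nat \<Rightarrow> (nat \<Rightarrow> real) \<Rightarrow> (nat \<Rightarrow> real) \<Rightarrow> bool" where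
  "feasible N d y \<longleftrightarrow> (\<Sum>i=1..N. y i) = (\<Sum>i=1..N. d i)"

definition optimal_solution ::
    "nat \<Rightarrow> (nat \<Rightarrow> real \<Rightarrow> real) \<Rightarrow> (nat \<Rightarrow> real) \<Rightarrow> (nat \<Rightarrow> real) \<Rightarrow> bool" where
  "optimal_solution N f d y \<longleftrightarrow> feasible N d y \<and>
     (\<forall>y'. feasible N d y' \<longrightarrow> (\<Sum>i=1..N. f i (y i)) \<le> (\<Sum>i=1..N. f i (y' i)))"

end

theory Submission
  imports "Jordan_Normal_Form.Schur_Decomposition" "HOL-Analysis.L2_Norm" Defs
begin

text \<open>
  In terms of the output derivatives \<open>C A\<^sup>k x\<close>, the controller cancels the term \<open>C A\<^sup>r x\<close>, so the
  outputs do not see the zero dynamics. After subtracting the steady state and scaling the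
  \<open>k\<close>-th component by \<open>\<epsilon>\<^sup>k\<close>, one obtains \<open>\<epsilon> \<zeta>' = M \<zeta> + O(\<epsilon>)\<close> with the companion matrix \<open>M\<close> of
  the chosen Hurwitz polynomial; the \<open>O(\<epsilon>)\<close> term contains \<open>z'\<close> and the observer error \<open>e\<close>, and
  \<open>e' = (S - L E) e\<close>. Since \<open>y = z + \<zeta>\<^sub>0\<close>, the remaining states follow a perturbed primal-dual
  gradient flow whose equilibrium is the optimum. By singular perturbation, the sum of quadratic
  Lyapunov functions of the three subsystems, with a large weight on that of \<open>e\<close>, decays
  exponentially for small \<open>\<epsilon>\<close>.
\<close>

subsection \<open>Quadratic Lyapunov functions of Hurwitz matrices\<close>

text \<open>The steady state depends on the trajectory only through a conserved quantity. The graph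
  Laplacian has zero column sums, so the sum of the \<open>v i\<close> is constant in time; it
  selects one equilibrium of \<open>v\<close> among those that differ by a constant. Deviations from
  this one have zero sum, where connectedness gives a Poincare inequality. The steady value of all
  \<open>\<lambda> i\<close> is the Lagrange multiplier of the optimization problem.

  The flow is nonlinear only in the gradients. Their deviations are written as secant slopes times
  \<open>y - y*\<close>, which leaves a linear system with unknown coefficients between two positive
  bounds; one quadratic function has to decay for all such coefficients.

  The coupling of the slow and the fast subsystem goes both ways: \<open>y - z\<close> disturbs the
  slow one, and \<open>z'\<close> the fast one. Neither gain depends on \<open>\<epsilon>\<close>,
  so the decay rate of order \<open>1 / \<epsilon>\<close> wins. The observer error acts on the
  others without feedback from them, so its weight can be fixed after \<open>\<epsilon>\<close>,
  however large its gain is.\<close>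

definition sqn :: "nat \<Rightarrow> (nat \<Rightarrow> real) \<Rightarrow> real" where
  "sqn n x = (\<Sum>k<n. (x k)\<^sup>2)"

definition qform :: "nat \<Rightarrow> (nat \<Rightarrow> nat \<Rightarrow> real) \<Rightarrow> (nat \<Rightarrow> real) \<Rightarrow> (nat \<Rightarrow> real) \<Rightarrow> real" where
  "qform n P x y = (\<Sum>j<n. \<Sum>k<n. P j k * x j * y k)"

lemma sqn_nonneg [simp]: "0 \<le> sqn n x"
  by (simp add: sqn_def sum_nonneg)

lemma finite_uniform_upper:
  fixes g :: "'a \<Rightarrow> real"
  assumes "finite I"
  shows "\<exists>K>0. \<forall>i\<in>I. g i \<le> K"
proof -
  have "\<forall>i\<in>I. g i \<le> 1 + (\<Sum>j\<in>I. \<bar>g j\<bar>)"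
  proof
    fix i assume "i \<in> I"
    then have "\<bar>g i\<bar> \<le> (\<Sum>j\<in>I. \<bar>g j\<bar>)"
      using assms by (intro member_le_sum) auto
    then show "g i \<le> 1 + (\<Sum>j\<in>I. \<bar>g j\<bar>)" by linarith
  qed
  moreover have "0 < 1 + (\<Sum>j\<in>I. \<bar>g j\<bar>)"
    by (simp add: sum_nonneg add_pos_nonneg)
  ultimately show ?thesis by blast
qed

lemma finite_uniform_lower:
  fixes g :: "'a \<Rightarrow> real"
  assumes "finite I" "\<And>i. i \<in> I \<Longrightarrow> 0 < g i"
  shows "\<exists>m>0. \<forall>i\<in>I. m \<le> g i"
proof -
  obtain K where K: "K > 0" "\<forall>i\<in>I. inverse (g i) \<le> K"
    using finite_uniform_upper[OF assms(1), of "\<lambda>i. inverse (g i)"] by blast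
  have "inverse K \<le> g i" if "i \<in> I" for i
    using K assms(2)[OF that] that by (metis inverse_inverse_eq inverse_positive_iff_positive le_imp_inverse_le)
  with K(1) show ?thesis by (intro exI[of _ "inverse K"]) auto
qed

text \<open>Geometrically growing weights make the off-diagonal part of a triangular matrix small
  against its diagonal.\<close>

lemma upper_triangular_weights:
  fixes T :: "complex mat"
  assumes T: "T \<in> carrier_mat n n" "upper_triangular T"
    and neg: "\<And>i. i < n \<Longrightarrow> Re (T $$ (i, i)) < 0"
  shows "\<exists>b \<sigma>. \<sigma> > 0 \<and> (\<forall>i. b i \<ge> (1::real)) \<and>
    (\<forall>w. 2 * (\<Sum>i<n. b i * Re (cnj (w i) * (\<Sum>j<n. T $$ (i, j) * w j)))
        \<le> - \<sigma> * (\<Sum>i<n. b i * (cmod (w i))\<^sup>2))"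
proof -
  obtain \<sigma> where \<sigma>: "\<sigma> > 0" "\<And>i. i < n \<Longrightarrow> \<sigma> \<le> - Re (T $$ (i, i))"
    using finite_uniform_lower[of "{..<n}" "\<lambda>i. - Re (T $$ (i, i))"] neg by auto
  obtain \<tau> where \<tau>: "\<tau> > 0" "\<And>i j. i < n \<Longrightarrow> j < n \<Longrightarrow> cmod (T $$ (i, j)) \<le> \<tau>"
    using finite_uniform_upper[of "{..<n} \<times> {..<n}" "\<lambda>(i, j). cmod (T $$ (i, j))"] by auto
  \<comment> \<open>\<open>\<theta>\<close> is the ratio of consecutive weights before squaring. It
    is so small that all off-diagonal terms together, of total size
    \<open>2 * \<theta> * \<tau> * n\<close>, use up at most half of the diagonal decay
    \<open>2 * \<sigma>\<close>. The summand 1 keeps the denominator positive for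
    \<open>n = 0\<close>.\<close>
  define \<theta> where "\<theta> = min 1 (\<sigma> / (2 * \<tau> * (real n + 1)))"
  have \<theta>: "\<theta> > 0" "\<theta> \<le> 1" using \<sigma> \<tau> by (auto simp: \<theta>_def)
  have "\<theta> * (2 * \<tau> * (real n + 1)) \<le> \<sigma> / (2 * \<tau> * (real n + 1)) * (2 * \<tau> * (real n + 1))"
    using \<tau> by (intro mult_right_mono) (auto simp: \<theta>_def)
  also have "\<dots> = \<sigma>" using \<tau> by (simp add: add_nonneg_eq_0_iff)
  finally have "\<theta> * (2 * \<tau> * (real n + 1)) \<le> \<sigma>" .
  moreover have "2 * \<theta> * \<tau> * n \<le> \<theta> * (2 * \<tau> * (real n + 1))"
    using \<theta> \<tau> by (simp add: algebra_simps)
  ultimately have small: "2 * \<theta> * \<tau> * n \<le> \<sigma>" by linarith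
  define g where "g i = inverse \<theta> ^ i" for i :: nat
  have g: "g i \<ge> 1" for i
    using \<theta> by (simp add: g_def one_le_power one_le_inverse)
  have g_step: "g i \<le> \<theta> * g j" if "i < j" for i j
  proof -
    have "g (Suc i) \<le> g j"
      unfolding g_def using \<theta> that by (intro power_increasing) (auto simp: one_le_inverse)
    then have "\<theta> * g (Suc i) \<le> \<theta> * g j" using \<theta> by (intro mult_left_mono) auto
    then show ?thesis using \<theta> by (simp add: g_def mult.assoc[symmetric])
  qed
  have main: "2 * (\<Sum>i<n. (g i)\<^sup>2 * Re (cnj (w i) * (\<Sum>j<n. T $$ (i, j) * w j)))
        \<le> - \<sigma> * (\<Sum>i<n. (g i)\<^sup>2 * (cmod (w i))\<^sup>2)" for w
  proof -
    define W where "W i = (g i)\<^sup>2 * (cmod (w i))\<^sup>2" for i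
    have W0: "W i \<ge> 0" for i by (simp add: W_def)
    have pt: "(g i)\<^sup>2 * Re (cnj (w i) * (T $$ (i, j) * w j))
        \<le> (if i = j then - \<sigma> * W i else 0) + \<theta> * \<tau> / 2 * (W i + W j)"
      if ij: "i < n" "j < n" for i j
    proof -
      consider "i = j" | "j < i" | "i < j" by linarith
      then show ?thesis
      proof cases
        case 1
        have "Re (cnj (w i) * (T $$ (i, i) * w i)) = Re (T $$ (i, i)) * (cmod (w i))\<^sup>2"
          unfolding cmod_power2 by (simp add: power2_eq_square algebra_simps)
        then have "(g i)\<^sup>2 * Re (cnj (w i) * (T $$ (i, i) * w i)) = Re (T $$ (i, i)) * W i"
          by (simp add: W_def)
        also have "\<dots> \<le> - \<sigma> * W i"
          using \<sigma>(2)[OF ij(1)] W0[of i] by (intro mult_right_mono) auto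
        finally have "(g i)\<^sup>2 * Re (cnj (w i) * (T $$ (i, i) * w i)) \<le> - \<sigma> * W i" .
        moreover have "0 \<le> \<theta> * \<tau> / 2 * (W i + W i)" using W0[of i] \<theta> \<tau> by simp
        ultimately show ?thesis unfolding 1[symmetric] by simp
      next
        case 2
        then have "T $$ (i, j) = 0" using T ij by (auto simp: upper_triangular_def)
        then show ?thesis using W0[of i] W0[of j] \<theta> \<tau> 2 by simp
      next
        case 3
        have "Re (cnj (w i) * (T $$ (i, j) * w j)) \<le> cmod (w i) * (cmod (T $$ (i, j)) * cmod (w j))"
          by (metis complex_Re_le_cmod complex_mod_cnj norm_mult)
        also have "\<dots> \<le> cmod (w i) * (\<tau> * cmod (w j))"
          using \<tau>(2)[OF ij] by (intro mult_left_mono mult_right_mono) auto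
        finally have "(g i)\<^sup>2 * Re (cnj (w i) * (T $$ (i, j) * w j))
            \<le> (g i)\<^sup>2 * (cmod (w i) * (\<tau> * cmod (w j)))"
          by (intro mult_left_mono) auto
        also have "\<dots> = \<tau> * (g i * cmod (w i)) * (g i * cmod (w j))"
          by (simp add: power2_eq_square)
        also have "\<dots> \<le> \<tau> * (g i * cmod (w i)) * (\<theta> * g j * cmod (w j))"
          using g_step[OF 3] g[of i] \<tau> by (intro mult_left_mono mult_right_mono) auto
        also have "\<dots> = \<theta> * \<tau> * ((g i * cmod (w i)) * (g j * cmod (w j)))" by simp
        also have "\<dots> \<le> \<theta> * \<tau> * ((W i + W j) / 2)"
          using sum_squares_bound[of "g i * cmod (w i)" "g j * cmod (w j)"] \<theta> \<tau>
          by (intro mult_left_mono) (auto simp: W_def power_mult_distrib)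
        finally show ?thesis using 3 by simp
      qed
    qed
    have "(\<Sum>i<n. (g i)\<^sup>2 * Re (cnj (w i) * (\<Sum>j<n. T $$ (i, j) * w j)))
      = (\<Sum>i<n. \<Sum>j<n. (g i)\<^sup>2 * Re (cnj (w i) * (T $$ (i, j) * w j)))"
      by (simp only: sum_distrib_left Re_sum)
    also have "\<dots> \<le> (\<Sum>i<n. \<Sum>j<n. (if i = j then - \<sigma> * W i else 0) + \<theta> * \<tau> / 2 * (W i + W j))"
      using pt by (intro sum_mono) auto
    also have "\<dots> = - \<sigma> * sum W {..<n} + \<theta> * \<tau> * n * sum W {..<n}"
    proof -
      have "(\<Sum>i<n. \<Sum>j<n. W i + W j) = 2 * n * sum W {..<n}"
        by (simp add: sum.distrib sum_distrib_left[symmetric])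
      then have "(\<Sum>i<n. \<Sum>j<n. \<theta> * \<tau> / 2 * (W i + W j)) = \<theta> * \<tau> / 2 * (2 * n * sum W {..<n})"
        by (simp only: sum_distrib_left[symmetric])
      moreover have "(\<Sum>i<n. \<Sum>j<n. if i = j then - \<sigma> * W i else 0) = - \<sigma> * sum W {..<n}"
        by (simp add: sum_distrib_left sum_negf)
      ultimately show ?thesis by (simp only: sum.distrib) simp
    qed
    finally have "2 * (\<Sum>i<n. (g i)\<^sup>2 * Re (cnj (w i) * (\<Sum>j<n. T $$ (i, j) * w j)))
       \<le> (2 * \<theta> * \<tau> * n - 2 * \<sigma>) * sum W {..<n}"
      by (simp add: algebra_simps)
    also have "\<dots> \<le> - \<sigma> * sum W {..<n}"
      using small W0 by (intro mult_right_mono sum_nonneg) auto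
    finally show ?thesis by (simp add: W_def)
  qed
  show ?thesis
    using main \<sigma>(1) g by (intro exI[of _ "\<lambda>i. (g i)\<^sup>2"] exI[of _ \<sigma>]) (auto simp: one_le_power)
qed

text \<open>Over the complex numbers the characteristic polynomial splits, so a Schur form exists,
  and its diagonal is the list of roots.\<close>

lemma similar_upper_triangular:
  fixes M :: "complex mat"
  assumes M: "M \<in> carrier_mat n n"
  shows "\<exists>T P Q. similar_mat_wit M T P Q \<and> upper_triangular T \<and> (\<forall>i<n. eigenvalue M (T $$ (i, i)))"
proof -
  obtain es where es: "char_poly M = (\<Prod>a\<leftarrow>es. [:- a, 1:])" "length es = n"
    using char_poly_factorized[OF M] by blast
  obtain T P Q where "schur_decomposition M es = (T, P, Q)"
    by (cases "schur_decomposition M es") auto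
  from schur_decomposition[OF M es(1) this]
  have sim: "similar_mat_wit M T P Q" and tri: "upper_triangular T" and diag: "diag_mat T = es"
    by auto
  have "eigenvalue M (T $$ (i, i))" if "i < n" for i
  proof -
    have "T \<in> carrier_mat n n" using similar_mat_witD2[OF M sim] by auto
    then have "es ! i = T $$ (i, i)" using diag that by (auto simp: diag_mat_def)
    moreover have "poly (char_poly M) (es ! i) = 0"
      using es that by (auto simp: poly_prod_list prod_list_zero_iff image_iff)
    ultimately show ?thesis using eigenvalue_root_char_poly[OF M] by simp
  qed
  with sim tri show ?thesis by blast
qed

lemma mult_mat_entry:
  assumes "A \<in> carrier_mat m n" "B \<in> carrier_mat n p" "i < m" "k < p"
  shows "(A * B) $$ (i, k) = (\<Sum>j<n. A $$ (i, j) * B $$ (j, k))"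
  using assms by (auto simp: scalar_prod_def atLeast0LessThan intro!: sum.cong)

lemma qform_scale: "qform n (\<lambda>j k. a * P j k) x y = a * qform n P x y"
  by (simp add: qform_def sum_distrib_left mult.assoc)

text \<open>Lyapunov's theorem by way of the Schur form: in coordinates in which \<open>M\<close> is
  triangular, a weighted sum of squared moduli decays. Pulled back to real vectors it is a real
  quadratic form. Scaling it makes it at least the squared norm and its decay at least the squared
  norm, so that no further constants occur later.\<close>

lemma hurwitz_lyapunov:
  assumes M: "M \<in> carrier_mat n n" and hur: "hurwitz_mat M"
  shows "\<exists>P. (\<forall>j k. P j k = P k j) \<and> (\<forall>x. sqn n x \<le> qform n P x x) \<and>
    (\<forall>x. 2 * qform n P x (\<lambda>j. \<Sum>k<n. M $$ (j, k) * x k) \<le> - sqn n x)"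
proof -
  have cM: "cmat M \<in> carrier_mat n n" using M by auto
  obtain T P Q where sim: "similar_mat_wit (cmat M) T P Q" and tri: "upper_triangular T"
    and ev: "\<And>i. i < n \<Longrightarrow> eigenvalue (cmat M) (T $$ (i, i))"
    using similar_upper_triangular[OF cM] by blast
  note w = similar_mat_witD2[OF cM sim]
  have neg: "Re (T $$ (i, i)) < 0" if "i < n" for i
    using ev[OF that] hur by (simp add: hurwitz_mat_def)
  obtain b \<sigma> where \<sigma>: "\<sigma> > 0" and b: "\<And>i. b i \<ge> (1::real)"
    and tr: "\<And>w. 2 * (\<Sum>i<n. b i * Re (cnj (w i) * (\<Sum>j<n. T $$ (i, j) * w j)))
        \<le> - \<sigma> * (\<Sum>i<n. b i * (cmod (w i))\<^sup>2)"
    using upper_triangular_weights[OF w(5) tri neg] by blast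
  have QM: "Q * cMM = T * Q" if "cMM = cmat M" for cMM
  proof -
    have "Q * cMM = Q * (P * T * Q)" unfolding that by (subst w(3)) (rule refl)
    also have "\<dots> = Q * P * (T * Q)"
      using w assoc_mult_mat[of Q n n P n "T * Q" n] by (simp add: assoc_mult_mat[of P n n T n Q n])
    also have "\<dots> = T * Q" using w by simp
    finally show ?thesis .
  qed
  define q where "q x i = (\<Sum>j<n. Q $$ (i, j) * complex_of_real (x j))" for x i
  \<comment> \<open>The Hermitian matrix \<open>Q* diag(b) Q\<close>. On real vectors only its real
    part matters, and that part is symmetric.\<close>
  define R where "R j k = (\<Sum>i<n. b i * Re (cnj (Q $$ (i, j)) * Q $$ (i, k)))" for j k
  have R_sym: "R j k = R k j" for j k
    unfolding R_def by (intro sum.cong) (auto simp: algebra_simps)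
  have Re_real: "Re (u * complex_of_real s) = Re u * s" for u s by simp
  have R_q: "qform n R x y = (\<Sum>i<n. b i * Re (cnj (q x i) * q y i))" for x y
  proof -
    have "(\<Sum>i<n. b i * Re (cnj (q x i) * q y i))
      = (\<Sum>i<n. \<Sum>j<n. \<Sum>k<n. b i * Re (cnj (Q $$ (i, j)) * Q $$ (i, k)) * x j * y k)"
    proof (rule sum.cong[OF refl])
      fix i
      have "cnj (q x i) * q y i = (\<Sum>j<n. \<Sum>k<n. cnj (Q $$ (i, j)) * Q $$ (i, k) * complex_of_real (x j * y k))"
        unfolding q_def cnj_sum sum_product by (intro sum.cong) auto
      then have "Re (cnj (q x i) * q y i) = (\<Sum>j<n. \<Sum>k<n. Re (cnj (Q $$ (i, j)) * Q $$ (i, k)) * (x j * y k))"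
        by (simp only: Re_sum Re_real)
      then show "b i * Re (cnj (q x i) * q y i) = (\<Sum>j<n. \<Sum>k<n. b i * Re (cnj (Q $$ (i, j)) * Q $$ (i, k)) * x j * y k)"
        by (simp only: sum_distrib_left mult.assoc)
    qed
    also have "\<dots> = (\<Sum>j<n. \<Sum>i<n. \<Sum>k<n. b i * Re (cnj (Q $$ (i, j)) * Q $$ (i, k)) * x j * y k)"
      by (rule sum.swap)
    also have "\<dots> = (\<Sum>j<n. \<Sum>k<n. \<Sum>i<n. b i * Re (cnj (Q $$ (i, j)) * Q $$ (i, k)) * x j * y k)"
      by (intro sum.cong refl sum.swap)
    also have "\<dots> = qform n R x y"
      by (simp only: qform_def R_def sum_distrib_right)
    finally show ?thesis ..
  qed
  have R_self: "qform n R x x = (\<Sum>i<n. b i * (cmod (q x i))\<^sup>2)" for x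
    unfolding R_q cmod_power2 by (intro sum.cong) (auto simp: power2_eq_square)
  have dec: "2 * qform n R x (\<lambda>j. \<Sum>k<n. M $$ (j, k) * x k) \<le> - \<sigma> * qform n R x x" for x
  proof -
    have "q (\<lambda>j. \<Sum>k<n. M $$ (j, k) * x k) i = (\<Sum>j<n. T $$ (i, j) * q x j)" if "i < n" for i
    proof -
      have "q (\<lambda>j. \<Sum>k<n. M $$ (j, k) * x k) i
          = (\<Sum>j<n. \<Sum>k<n. Q $$ (i, j) * cmat M $$ (j, k) * complex_of_real (x k))"
        using M unfolding q_def by (intro sum.cong) (auto simp: sum_distrib_left mult.assoc)
      also have "\<dots> = (\<Sum>k<n. \<Sum>j<n. Q $$ (i, j) * cmat M $$ (j, k) * complex_of_real (x k))"
        by (rule sum.swap)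
      also have "\<dots> = (\<Sum>k<n. (Q * cmat M) $$ (i, k) * complex_of_real (x k))"
        using mult_mat_entry[OF w(7) cM that] by (intro sum.cong) (auto simp: sum_distrib_right)
      also have "\<dots> = (\<Sum>k<n. (T * Q) $$ (i, k) * complex_of_real (x k))"
        using QM by simp
      also have "\<dots> = (\<Sum>k<n. \<Sum>j<n. T $$ (i, j) * Q $$ (j, k) * complex_of_real (x k))"
        using mult_mat_entry[OF w(5) w(7) that] by (intro sum.cong) (auto simp: sum_distrib_right)
      also have "\<dots> = (\<Sum>j<n. \<Sum>k<n. T $$ (i, j) * Q $$ (j, k) * complex_of_real (x k))"
        by (rule sum.swap)
      finally show ?thesis by (simp add: q_def sum_distrib_left mult.assoc)
    qed
    then show ?thesis
      unfolding R_self unfolding R_q using tr[of "q x"] by simp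
  qed
  \<comment> \<open>Definiteness: \<open>x = P (q x)\<close>, so by Cauchy-Schwarz the squared norm
    of \<open>x\<close> is at most the squared Frobenius norm of \<open>P\<close> times that of
    \<open>q x\<close>; the weights \<open>b i\<close> are at least 1.\<close>
  obtain K where K: "K > 0" "\<And>x. sqn n x \<le> K * qform n R x x"
  proof -
    define K where "K = (\<Sum>j<n. \<Sum>i<n. (cmod (P $$ (j, i)))\<^sup>2) + 1"
    have "K > 0" unfolding K_def by (intro add_nonneg_pos sum_nonneg) auto
    moreover have "sqn n x \<le> K * qform n R x x" for x
    proof -
      have "complex_of_real (x j) = (\<Sum>i<n. P $$ (j, i) * q x i)" if "j < n" for j
      proof -
        have "(\<Sum>i<n. P $$ (j, i) * q x i) = (\<Sum>i<n. \<Sum>k<n. P $$ (j, i) * Q $$ (i, k) * complex_of_real (x k))"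
          by (simp add: q_def sum_distrib_left mult.assoc)
        also have "\<dots> = (\<Sum>k<n. \<Sum>i<n. P $$ (j, i) * Q $$ (i, k) * complex_of_real (x k))"
          by (rule sum.swap)
        also have "\<dots> = (\<Sum>k<n. (P * Q) $$ (j, k) * complex_of_real (x k))"
          using mult_mat_entry[OF w(6) w(7) that] by (intro sum.cong) (auto simp: sum_distrib_right)
        also have "\<dots> = (\<Sum>k<n. if k = j then complex_of_real (x k) else 0)"
          unfolding w(1) using that by (intro sum.cong) auto
        finally show ?thesis using that by simp
      qed
      then have "(x j)\<^sup>2 \<le> (\<Sum>i<n. (cmod (P $$ (j, i)))\<^sup>2) * (\<Sum>i<n. (cmod (q x i))\<^sup>2)" if "j < n" for j
      proof -
        have "\<bar>x j\<bar> = cmod (\<Sum>i<n. P $$ (j, i) * q x i)"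
          using \<open>j < n \<Longrightarrow> complex_of_real (x j) = (\<Sum>i<n. P $$ (j, i) * q x i)\<close> that
          by (metis norm_of_real)
        also have "\<dots> \<le> (\<Sum>i<n. cmod (P $$ (j, i)) * cmod (q x i))"
          using norm_sum[of "\<lambda>i. P $$ (j, i) * q x i" "{..<n}"] by (simp add: norm_mult)
        finally have "(x j)\<^sup>2 \<le> (\<Sum>i<n. cmod (P $$ (j, i)) * cmod (q x i))\<^sup>2"
          by (metis abs_ge_zero power2_abs power_mono)
        also have "\<dots> \<le> (\<Sum>i<n. (cmod (P $$ (j, i)))\<^sup>2) * (\<Sum>i<n. (cmod (q x i))\<^sup>2)"
        proof -
          have "(\<Sum>i<n. cmod (P $$ (j, i)) * cmod (q x i))
              \<le> L2_set (\<lambda>i. cmod (P $$ (j, i))) {..<n} * L2_set (\<lambda>i. cmod (q x i)) {..<n}"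
            using L2_set_mult_ineq[of "\<lambda>i. cmod (P $$ (j, i))" "\<lambda>i. cmod (q x i)" "{..<n}"] by simp
          then have "(\<Sum>i<n. cmod (P $$ (j, i)) * cmod (q x i))\<^sup>2
              \<le> (L2_set (\<lambda>i. cmod (P $$ (j, i))) {..<n} * L2_set (\<lambda>i. cmod (q x i)) {..<n})\<^sup>2"
            by (intro power_mono sum_nonneg) auto
          then show ?thesis by (simp add: power_mult_distrib L2_set_def sum_nonneg)
        qed
        finally show ?thesis .
      qed
      then have "sqn n x \<le> (\<Sum>j<n. (\<Sum>i<n. (cmod (P $$ (j, i)))\<^sup>2) * (\<Sum>i<n. (cmod (q x i))\<^sup>2))"
        unfolding sqn_def by (intro sum_mono) auto
      also have "\<dots> \<le> K * (\<Sum>i<n. (cmod (q x i))\<^sup>2)"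
        unfolding K_def sum_distrib_right[symmetric] by (intro mult_right_mono sum_nonneg) auto
      also have "\<dots> \<le> K * qform n R x x"
        unfolding R_self using \<open>K > 0\<close> b
        by (intro mult_left_mono sum_mono) (auto simp: mult_le_cancel_right1)
      finally show ?thesis .
    qed
    ultimately show ?thesis using that by blast
  qed
  \<comment> \<open>\<open>s \<ge> K\<close> serves the lower bound, and
    \<open>s * \<sigma> \<ge> K\<close> the decay.\<close>
  define s where "s = max K (K / \<sigma>)"
  have s: "s \<ge> K" "s * \<sigma> \<ge> K" "s > 0"
    using K(1) \<sigma> unfolding s_def
    by (auto simp: less_max_iff_disj pos_divide_le_eq[symmetric])
  have R0: "qform n R x x \<ge> 0" for x
    unfolding R_self using b by (intro sum_nonneg mult_nonneg_nonneg) (auto intro: order_trans[OF zero_le_one])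
  have "sqn n x \<le> s * qform n R x x" for x
    using K(2)[of x] mult_right_mono[OF s(1) R0[of x]] by linarith
  moreover have "2 * (s * qform n R x (\<lambda>j. \<Sum>k<n. M $$ (j, k) * x k)) \<le> - sqn n x" for x
  proof -
    have "s * (2 * qform n R x (\<lambda>j. \<Sum>k<n. M $$ (j, k) * x k)) \<le> s * (- \<sigma> * qform n R x x)"
      using dec[of x] s(3) by (intro mult_left_mono) auto
    moreover have "K * qform n R x x \<le> s * \<sigma> * qform n R x x"
      using s(2) R0 by (intro mult_right_mono)
    ultimately show ?thesis using K(2)[of x] by (simp add: algebra_simps)
  qed
  ultimately show ?thesis
    using R_sym by (intro exI[of _ "\<lambda>j k. s * R j k"]) (auto simp: qform_scale)
qed

definition companion :: "nat \<Rightarrow> (nat \<Rightarrow> real) \<Rightarrow> (nat \<Rightarrow> real) \<Rightarrow> nat \<Rightarrow> real" where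
  "companion r c x k = (if Suc k = r then - (\<Sum>l<r. c l * x l) else x (Suc k))"

text \<open>The shift rows force an eigenvector for \<open>s\<close> to be a multiple of
  \<open>(1, s, ..., s^(r-1))\<close> with nonzero first entry. The last row then says that
  \<open>s\<close> is a root of the polynomial, so the companion matrix is Hurwitz.\<close>

lemma hurwitz_companion_lyapunov:
  assumes r: "r > 0" and hur: "hurwitz_poly (monom 1 r + (\<Sum>k<r. monom (c k) k))"
  shows "\<exists>P. (\<forall>j k. P j k = P k j) \<and> (\<forall>x. sqn r x \<le> qform r P x x) \<and>
    (\<forall>x. 2 * qform r P x (companion r c x) \<le> - sqn r x)"
proof -
  define M :: "real mat" where
    "M = mat r r (\<lambda>(k, l). if Suc k = r then - c l else if l = Suc k then 1 else 0)"
  have M: "M \<in> carrier_mat r r" by (simp add: M_def)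
  have "hurwitz_mat M"
    unfolding hurwitz_mat_def
  proof (intro allI impI)
    fix s assume "eigenvalue (cmat M) s"
    then obtain u where u: "u \<in> carrier_vec r" "u \<noteq> 0\<^sub>v r" "cmat M *\<^sub>v u = s \<cdot>\<^sub>v u"
      using M by (auto simp: eigenvalue_def eigenvector_def)
    have row: "(\<Sum>l<r. complex_of_real (M $$ (k, l)) * u $ l) = s * u $ k" if "k < r" for k
    proof -
      have "(cmat M *\<^sub>v u) $ k = (\<Sum>l<r. complex_of_real (M $$ (k, l)) * u $ l)"
        using M u(1) that by (auto simp: scalar_prod_def atLeast0LessThan intro!: sum.cong)
      then show ?thesis using u that by simp
    qed
    have shift: "u $ Suc k = s * u $ k" if "Suc k < r" for k
    proof -
      have "(\<Sum>l<r. complex_of_real (M $$ (k, l)) * u $ l) = (\<Sum>l<r. if l = Suc k then u $ l else 0)"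
        using that by (intro sum.cong) (auto simp: M_def)
      then show ?thesis using row[of k] that by simp
    qed
    have pow: "u $ k = s ^ k * u $ 0" if "k < r" for k
      using that
    proof (induction k)
      case (Suc k)
      then show ?case using shift[of k] by simp
    qed simp
    have u0: "u $ 0 \<noteq> 0"
    proof
      assume "u $ 0 = 0"
      then have "u = 0\<^sub>v r" using u(1) pow by (intro eq_vecI) auto
      with u(2) show False by simp
    qed
    interpret mp: map_poly_comm_ring_hom complex_of_real ..
    define p where "p = monom 1 r + (\<Sum>k<r. monom (c k) k)"
    have "poly (map_poly complex_of_real p) s = s ^ r + (\<Sum>k<r. complex_of_real (c k) * s ^ k)"
      unfolding p_def mp.hom_add mp.hom_sum by (simp add: map_poly_monom poly_sum poly_monom)
    also have "\<dots> = 0"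
    proof -
      have "(\<Sum>l<r. complex_of_real (M $$ (r - 1, l)) * u $ l) = - (\<Sum>l<r. complex_of_real (c l) * (s ^ l * u $ 0))"
        unfolding sum_negf[symmetric]
      proof (rule sum.cong[OF refl])
        fix l assume "l \<in> {..<r}"
        then show "complex_of_real (M $$ (r - 1, l)) * u $ l = - (complex_of_real (c l) * (s ^ l * u $ 0))"
          using r pow[of l] by (simp add: M_def)
      qed
      then have "- (\<Sum>l<r. complex_of_real (c l) * s ^ l) * u $ 0 = s ^ r * u $ 0"
        using row[of "r - 1"] pow[of "r - 1"] r power_minus_mult[OF r, of s]
        by (simp add: sum_distrib_right mult.assoc mult.left_commute[of s] flip: mult.assoc[of s])
      then have "(s ^ r + (\<Sum>k<r. complex_of_real (c k) * s ^ k)) * u $ 0 = 0"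
        by (simp add: distrib_right add_eq_0_iff2)
      then show ?thesis using u0 by simp
    qed
    finally show "Re s < 0" using hur by (simp add: hurwitz_poly_def p_def)
  qed
  then obtain P where P: "\<And>j k. P j k = P k j" "\<And>x. sqn r x \<le> qform r P x x"
    "\<And>x. 2 * qform r P x (\<lambda>j. \<Sum>k<r. M $$ (j, k) * x k) \<le> - sqn r x"
    using hurwitz_lyapunov[OF M] by blast
  have row: "(\<Sum>k<r. M $$ (j, k) * x k) = companion r c x j" if "j < r" for x j
  proof (cases "Suc j = r")
    case True
    then show ?thesis using that by (simp add: companion_def M_def sum_negf)
  next
    case False
    then have "(\<Sum>k<r. M $$ (j, k) * x k) = (\<Sum>k<r. if k = Suc j then x k else 0)"
      using that by (intro sum.cong) (auto simp: M_def)
    then show ?thesis using False that by (simp add: companion_def)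
  qed
  have "qform r P x (\<lambda>j. \<Sum>k<r. M $$ (j, k) * x k) = qform r P x (companion r c x)" for x
    unfolding qform_def by (intro sum.cong refl arg_cong2[where f="(*)"] row) simp
  with P show ?thesis by (intro exI[of _ P]) (simp only:, blast)
qed

section \<open>Estimates for quadratic forms and exponential decay\<close>

lemma qform_young:
  "\<exists>K>0. \<forall>\<theta>>0. \<forall>x y. 2 * qform n P x y \<le> \<theta> * sqn n x + K / \<theta> * sqn n y"
proof -
  define m where "m = (\<Sum>j<n. \<Sum>k<n. \<bar>P j k\<bar>)"
  have m: "m \<ge> 0" by (simp add: m_def sum_nonneg)
  have "2 * qform n P x y \<le> \<theta> * sqn n x + (m + 1)\<^sup>2 / \<theta> * sqn n y" if "\<theta> > 0" for \<theta> x y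
  proof -
    \<comment> \<open>The Young parameter for each entry, so that the coefficient of
      \<open>sqn n x\<close> becomes exactly \<open>\<theta>\<close>. The resulting
      \<open>K = (m + 1)^2\<close> does not depend on \<open>\<theta>\<close>, which allows
      \<open>\<theta>\<close> to be chosen later in terms of \<open>K\<close>.\<close>
    define \<beta> where "\<beta> = (m + 1) / \<theta>"
    have \<beta>: "\<beta> > 0" using m that by (simp add: \<beta>_def)
    have mem: "(u k)\<^sup>2 \<le> sqn n u" if "k < n" for u k
      unfolding sqn_def using that by (intro member_le_sum) auto
    have "2 * (P j k * x j * y k) \<le> \<bar>P j k\<bar> * (sqn n x / \<beta> + \<beta> * sqn n y)" if "j < n" "k < n" for j k
    proof -
      have "2 * (\<bar>x j\<bar> * \<bar>y k\<bar>) \<le> (x j)\<^sup>2 / \<beta> + \<beta> * (y k)\<^sup>2"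
      proof -
        have "0 \<le> (\<bar>x j\<bar> - \<beta> * \<bar>y k\<bar>)\<^sup>2 / \<beta>" using \<beta> by simp
        also have "\<dots> = (\<bar>x j\<bar>\<^sup>2 + \<beta> * \<beta> * \<bar>y k\<bar>\<^sup>2 - 2 * \<beta> * (\<bar>x j\<bar> * \<bar>y k\<bar>)) / \<beta>"
          by (simp only: power2_diff power_mult_distrib) (simp add: power2_eq_square)
        also have "\<dots> = (x j)\<^sup>2 / \<beta> + \<beta> * (y k)\<^sup>2 - 2 * (\<bar>x j\<bar> * \<bar>y k\<bar>)"
          using \<beta> by (simp add: diff_divide_distrib add_divide_distrib)
        finally show ?thesis by simp
      qed
      also have "\<dots> \<le> sqn n x / \<beta> + \<beta> * sqn n y"
        using mem[OF that(1), of x] mem[OF that(2), of y] \<beta>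
        by (intro add_mono divide_right_mono mult_left_mono) auto
      finally have "\<bar>P j k\<bar> * (2 * (\<bar>x j\<bar> * \<bar>y k\<bar>)) \<le> \<bar>P j k\<bar> * (sqn n x / \<beta> + \<beta> * sqn n y)"
        by (intro mult_left_mono) auto
      moreover have "P j k * x j * y k \<le> \<bar>P j k\<bar> * (\<bar>x j\<bar> * \<bar>y k\<bar>)"
        using abs_ge_self[of "P j k * x j * y k"] by (simp only: abs_mult mult.assoc)
      ultimately show ?thesis by linarith
    qed
    then have "2 * qform n P x y \<le> (\<Sum>j<n. \<Sum>k<n. \<bar>P j k\<bar> * (sqn n x / \<beta> + \<beta> * sqn n y))"
      unfolding qform_def sum_distrib_left by (intro sum_mono) auto
    also have "\<dots> = m * (sqn n x / \<beta> + \<beta> * sqn n y)"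
      by (simp only: m_def sum_distrib_right)
    also have "\<dots> \<le> (m + 1) * (sqn n x / \<beta> + \<beta> * sqn n y)"
      using \<beta> by (intro mult_right_mono add_nonneg_nonneg) auto
    also have "\<dots> = \<theta> * sqn n x + (m + 1)\<^sup>2 / \<theta> * sqn n y"
      using m that by (simp add: \<beta>_def distrib_left power2_eq_square)
    finally show ?thesis .
  qed
  moreover have "(m + 1)\<^sup>2 > 0" using m by simp
  ultimately show ?thesis by blast
qed

lemma qform_upper: "\<exists>K>0. \<forall>x. qform n P x x \<le> K * sqn n x"
proof -
  obtain K where K: "K > 0" "\<forall>\<theta>>0. \<forall>x y. 2 * qform n P x y \<le> \<theta> * sqn n x + K / \<theta> * sqn n y"
    using qform_young by blast
  have "qform n P x x \<le> (1 + K) * sqn n x" for x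
  proof -
    have "2 * qform n P x x \<le> (1 + K) * sqn n x"
      using K(2)[rule_format, of 1 x x] by (simp add: algebra_simps)
    moreover have "0 \<le> (1 + K) * sqn n x" using K(1) by simp
    ultimately show ?thesis by linarith
  qed
  with K(1) show ?thesis by (intro exI[of _ "1 + K"]) auto
qed

lemma qform_self_deriv:
  assumes sym: "\<And>j k. P j k = P k j"
    and der: "\<And>j. j < n \<Longrightarrow> ((\<lambda>t. x t j) has_real_derivative dx j) (at t within T)"
  shows "((\<lambda>t. qform n P (x t) (x t)) has_real_derivative 2 * qform n P (x t) dx) (at t within T)"
proof -
  have "((\<lambda>t. qform n P (x t) (x t)) has_real_derivative
     (\<Sum>j<n. \<Sum>k<n. P j k * (x t j * dx k + dx j * x t k))) (at t within T)"
    unfolding qform_def mult.assoc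
    by (intro DERIV_sum DERIV_cmult DERIV_mult' der) auto
  moreover have "(\<Sum>j<n. \<Sum>k<n. P j k * (x t j * dx k + dx j * x t k)) = 2 * qform n P (x t) dx"
  proof -
    have "(\<Sum>j<n. \<Sum>k<n. P j k * (dx j * x t k)) = (\<Sum>j<n. \<Sum>k<n. P k j * (dx k * x t j))"
      by (rule sum.swap)
    also have "\<dots> = qform n P (x t) dx"
    proof -
      have "P k j * (dx k * x t j) = P j k * x t j * dx k" for j k
        using sym[of j k] by simp
      then show ?thesis by (simp only: qform_def)
    qed
    finally show ?thesis
      by (simp add: distrib_left sum.distrib qform_def mult.assoc)
  qed
  ultimately show ?thesis by simp
qed

text \<open>Gronwall's inequality: the integrating factor \<open>exp (\<mu> * t)\<close> turns the
  hypothesis into monotonicity.\<close>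

lemma exp_decay:
  fixes U :: "real \<Rightarrow> real"
  assumes der: "\<And>t. t \<ge> 0 \<Longrightarrow> (U has_real_derivative dU t) (at t within {0..})"
    and le: "\<And>t. t \<ge> 0 \<Longrightarrow> dU t \<le> - \<mu> * U t" and t: "t \<ge> 0"
  shows "U t \<le> U 0 * exp (- \<mu> * t)"
proof -
  define g where "g s = U s * exp (\<mu> * s)" for s
  have g: "(g has_real_derivative (dU s + \<mu> * U s) * exp (\<mu> * s)) (at s within {0..})" if "s \<ge> 0" for s
  proof -
    have "((\<lambda>s. exp (\<mu> * s)) has_real_derivative \<mu> * exp (\<mu> * s)) (at s within {0..})"
      by (auto intro!: derivative_eq_intros)
    from DERIV_mult[OF der[OF that] this] show ?thesis
      unfolding g_def by (simp add: algebra_simps)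
  qed
  have "g t \<le> g 0"
  proof (cases "t = 0")
    case False
    then have "0 < t" using t by simp
    show ?thesis
    \<comment> \<open>At 0 the derivative is one-sided. In the open interval it is two-sided, and
      continuity covers the end points.\<close>
    proof (rule DERIV_nonpos_imp_decreasing_open[OF less_imp_le[OF \<open>0 < t\<close>]])
      fix s assume s: "0 < s" "s < t"
      have "(g has_real_derivative (dU s + \<mu> * U s) * exp (\<mu> * s)) (at s)"
        using DERIV_subset[OF g[of s], of "{0<..}"] s by (simp add: at_within_open[of s "{0<..}"] subset_iff)
      moreover have "(dU s + \<mu> * U s) * exp (\<mu> * s) \<le> 0"
        using le[of s] s by (simp add: mult_le_0_iff)
      ultimately show "\<exists>y. (g has_real_derivative y) (at s) \<and> y \<le> 0" by blast
    next
      show "continuous_on {0..t} g"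
        using DERIV_continuous_on[OF g] by (rule continuous_on_subset) auto
    qed
  qed simp
  then have "U t * exp (\<mu> * t) \<le> U 0" by (simp add: g_def)
  then have "U t * exp (\<mu> * t) * exp (- \<mu> * t) \<le> U 0 * exp (- \<mu> * t)"
    by (intro mult_right_mono) auto
  then show ?thesis by (simp add: mult.assoc exp_add[symmetric])
qed

subsection \<open>Graph Laplacian and the slow subsystem\<close>

lemma neighbor_diff_diff: "neighbor_diff N a (\<lambda>j. p j - q j) i = neighbor_diff N a p i - neighbor_diff N a q i"
  by (simp add: neighbor_diff_def sum_subtractf[symmetric] algebra_simps)

lemma neighbor_diff_const: "neighbor_diff N a (\<lambda>_. s) i = 0"
  by (simp add: neighbor_diff_def)

lemma sum_square_le_card:
  fixes g :: "'a \<Rightarrow> real"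
  shows "(\<Sum>i\<in>I. g i)\<^sup>2 \<le> real (card I) * (\<Sum>i\<in>I. (g i)\<^sup>2)"
proof -
  have "\<bar>\<Sum>i\<in>I. g i\<bar> \<le> (\<Sum>i\<in>I. \<bar>g i\<bar> * \<bar>1\<bar>)" by simp
  also have "\<dots> \<le> L2_set g I * L2_set (\<lambda>_. 1) I" by (rule L2_set_mult_ineq)
  finally have "\<bar>\<Sum>i\<in>I. g i\<bar>\<^sup>2 \<le> (L2_set g I * L2_set (\<lambda>_. 1) I)\<^sup>2"
    by (intro power_mono) auto
  then show ?thesis by (simp add: power_mult_distrib L2_set_def sum_nonneg mult.commute)
qed

lemma young:
  fixes x y c :: real
  assumes "c > 0"
  shows "x * y \<le> c * x\<^sup>2 + y\<^sup>2 / (4 * c)"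
proof -
  have "0 \<le> (2 * c * x - y)\<^sup>2 / (4 * c)" using assms by simp
  also have "\<dots> = c * x\<^sup>2 + y\<^sup>2 / (4 * c) - x * y"
    using assms by (simp add: power2_eq_square field_simps)
  finally show ?thesis by simp
qed

text \<open>The derivative of \<open>(z\<^sup>2 + l\<^sup>2 + v\<^sup>2) / 2 - \<delta> * z * l + \<delta> * l * v\<close>. The cross terms produce
  the dissipation in the mean of \<open>l\<close> and in \<open>v\<close> that the sum of squares lacks.\<close>

definition slow_rate :: "real \<Rightarrow> real \<Rightarrow> real \<Rightarrow> real \<Rightarrow> real \<Rightarrow> real \<Rightarrow> real \<Rightarrow> real" where
  "slow_rate \<delta> z l v dz dl dv =
     z * dz + l * dl + v * dv - \<delta> * (dz * l + z * dl) + \<delta> * (dl * v + l * dv)"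

locale weighted_graph =
  fixes N :: nat and a :: "nat \<Rightarrow> nat \<Rightarrow> real"
  assumes sym: "\<And>i j. i \<in> {1..N} \<Longrightarrow> j \<in> {1..N} \<Longrightarrow> a i j = a j i"
    and nonneg: "\<And>i j. i \<in> {1..N} \<Longrightarrow> j \<in> {1..N} \<Longrightarrow> a i j \<ge> 0"
    and conn: "connected_graph N a"
begin

abbreviation nd where "nd \<equiv> neighbor_diff N a"

text \<open>\<open>nd\<close> is the graph Laplacian, and this is its quadratic form, the Dirichlet
  energy of the weighted graph.\<close>

definition dirichlet :: "(nat \<Rightarrow> real) \<Rightarrow> real" where
  "dirichlet p = (\<Sum>i=1..N. p i * nd p i)"

text \<open>Summation by parts: exchanging the two indices and using the symmetry of
  \<open>a\<close> gives a second expression for the same sum; the right-hand side is the average of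
  both.\<close>

lemma sum_mult_nd: "(\<Sum>i=1..N. q i * nd p i) = (\<Sum>i=1..N. \<Sum>j=1..N. a i j * ((q i - q j) * (p i - p j))) / 2"
proof -
  let ?s = "\<Sum>i=1..N. \<Sum>j=1..N. a i j * (q i * (p i - p j))"
  have "(\<Sum>i=1..N. q i * nd p i) = ?s"
    by (simp add: neighbor_diff_def sum_distrib_left algebra_simps)
  moreover have "?s = (\<Sum>i=1..N. \<Sum>j=1..N. a i j * (q j * (p j - p i)))"
    by (subst sum.swap) (intro sum.cong refl, simp add: sym)
  moreover have "(\<Sum>i=1..N. \<Sum>j=1..N. a i j * ((q i - q j) * (p i - p j)))
     = ?s + (\<Sum>i=1..N. \<Sum>j=1..N. a i j * (q j * (p j - p i)))"
    unfolding sum.distrib[symmetric] by (intro sum.cong refl) (simp add: algebra_simps)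
  ultimately show ?thesis by simp
qed

text \<open>Self-adjointness of the Laplacian. Because of it the coupling terms between
  \<open>l\<close> and \<open>v\<close> cancel in the energy balance.\<close>

lemma sum_mult_nd_commute: "(\<Sum>i=1..N. q i * nd p i) = (\<Sum>i=1..N. p i * nd q i)"
  unfolding sum_mult_nd by (simp add: mult.commute)

text \<open>Constants lie in the kernel of the self-adjoint Laplacian. This is the source of the
  conserved sum of \<open>v\<close>.\<close>

lemma sum_nd: "(\<Sum>i=1..N. nd p i) = 0"
  using sum_mult_nd[of "\<lambda>_. 1" p] by simp

lemma dirichlet_eq: "dirichlet p = (\<Sum>i=1..N. \<Sum>j=1..N. a i j * (p i - p j)\<^sup>2) / 2"
  unfolding dirichlet_def sum_mult_nd by (simp only: power2_eq_square)

lemma dirichlet_nonneg: "dirichlet p \<ge> 0"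
  unfolding dirichlet_eq by (intro divide_nonneg_nonneg sum_nonneg mult_nonneg_nonneg nonneg) auto

lemma edge_le_dirichlet:
  assumes "i \<in> {1..N}" "j \<in> {1..N}"
  shows "a i j * (p i - p j)\<^sup>2 \<le> 2 * dirichlet p"
proof -
  have "a i j * (p i - p j)\<^sup>2 \<le> (\<Sum>j=1..N. a i j * (p i - p j)\<^sup>2)"
    using assms by (intro member_le_sum[where f = "\<lambda>j. a i j * (p i - p j)\<^sup>2"]) (auto intro!: nonneg mult_nonneg_nonneg)
  also have "\<dots> \<le> (\<Sum>i=1..N. \<Sum>j=1..N. a i j * (p i - p j)\<^sup>2)"
    using assms by (intro member_le_sum[where f = "\<lambda>i. \<Sum>j=1..N. a i j * (p i - p j)\<^sup>2"])
      (auto intro!: sum_nonneg nonneg mult_nonneg_nonneg)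
  finally show ?thesis by (simp add: dirichlet_eq)
qed

text \<open>An upper spectral bound: the square of the Laplacian is at most a multiple of the
  Laplacian. Apply Cauchy-Schwarz to the neighbours of each node and bound one of the two factors
  \<open>a i j\<close> by the largest weight.\<close>

lemma nd_square_bound: "\<exists>K>0. \<forall>p. (\<Sum>i=1..N. (nd p i)\<^sup>2) \<le> K * dirichlet p"
proof -
  obtain m where m: "m > 0" "\<And>i j. i \<in> {1..N} \<Longrightarrow> j \<in> {1..N} \<Longrightarrow> a i j \<le> m"
    using finite_uniform_upper[of "{1..N} \<times> {1..N}" "\<lambda>(i, j). a i j"] by auto
  have "(\<Sum>i=1..N. (nd p i)\<^sup>2) \<le> (2 * real N * m + 1) * dirichlet p" for p
  proof -
    have "(\<Sum>i=1..N. (nd p i)\<^sup>2) \<le> (\<Sum>i=1..N. real N * (\<Sum>j=1..N. m * (a i j * (p i - p j)\<^sup>2)))"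
    proof (rule sum_mono)
      fix i assume i: "i \<in> {1..N}"
      have "(nd p i)\<^sup>2 \<le> real N * (\<Sum>j=1..N. (a i j * (p i - p j))\<^sup>2)"
        using sum_square_le_card[of "\<lambda>j. a i j * (p i - p j)" "{1..N}"] by (simp add: neighbor_diff_def)
      also have "\<dots> \<le> real N * (\<Sum>j=1..N. m * (a i j * (p i - p j)\<^sup>2))"
      proof (intro mult_left_mono sum_mono)
        fix j assume j: "j \<in> {1..N}"
        have "a i j * (a i j * (p i - p j)\<^sup>2) \<le> m * (a i j * (p i - p j)\<^sup>2)"
          using m(2)[OF i j] nonneg[OF i j] by (intro mult_right_mono) auto
        then show "(a i j * (p i - p j))\<^sup>2 \<le> m * (a i j * (p i - p j)\<^sup>2)"
          by (simp add: power2_eq_square mult_ac)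
      qed simp
      finally show "(nd p i)\<^sup>2 \<le> real N * (\<Sum>j=1..N. m * (a i j * (p i - p j)\<^sup>2))" .
    qed
    also have "\<dots> = 2 * real N * m * dirichlet p"
      by (simp add: dirichlet_eq sum_distrib_left[symmetric])
    also have "\<dots> \<le> (2 * real N * m + 1) * dirichlet p"
      using dirichlet_nonneg[of p] by (intro mult_right_mono) auto
    finally show ?thesis .
  qed
  moreover have "2 * real N * m + 1 > 0" using m(1) by (simp add: add_nonneg_pos)
  ultimately show ?thesis by blast
qed

text \<open>Each edge of positive weight controls the difference across it; along a path these
  differences are chained by \<open>(s + t)^2 \<le> 2 * s^2 + 2 * t^2\<close>. The constant depends
  on the path but not on \<open>p\<close>.\<close>

lemma path_le_dirichlet:
  assumes "(i, j) \<in> {(k, l). k \<in> {1..N} \<and> l \<in> {1..N} \<and> a k l > 0}\<^sup>*"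
  shows "\<exists>K. \<forall>p. (p i - p j)\<^sup>2 \<le> K * dirichlet p"
  using assms
proof (induction rule: rtrancl_induct)
  case base
  show ?case by (intro exI[of _ 0]) simp
next
  case (step j k)
  then obtain K where K: "\<And>p. (p i - p j)\<^sup>2 \<le> K * dirichlet p" by blast
  have jk: "j \<in> {1..N}" "k \<in> {1..N}" "a j k > 0" using step by auto
  have "(p i - p k)\<^sup>2 \<le> (2 * K + 4 / a j k) * dirichlet p" for p
  proof -
    have "(p j - p k)\<^sup>2 \<le> 2 / a j k * dirichlet p"
      using edge_le_dirichlet[OF jk(1,2), of p] jk(3) by (simp add: field_simps)
    moreover have "(p i - p k)\<^sup>2 \<le> 2 * (p i - p j)\<^sup>2 + 2 * (p j - p k)\<^sup>2"
      using zero_le_power2[of "(p i - p j) - (p j - p k)"] by (simp add: power2_eq_square algebra_simps)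
    ultimately show ?thesis using K[of p] by (simp add: distrib_right)
  qed
  then show ?case by blast
qed

text \<open>The spectral gap of a connected graph. All pairwise differences are controlled along
  paths, and for \<open>p\<close> with zero sum the sum of \<open>(p i - p j)^2\<close> over all
  pairs is \<open>2 * N\<close> times the squared norm of \<open>p\<close>.\<close>

lemma poincare: "\<exists>\<gamma>>0. \<forall>p. (\<Sum>i=1..N. p i) = 0 \<longrightarrow> \<gamma> * (\<Sum>i=1..N. (p i)\<^sup>2) \<le> dirichlet p"
proof -
  have "\<forall>ij\<in>{1..N} \<times> {1..N}. \<exists>K. \<forall>p. (p (fst ij) - p (snd ij))\<^sup>2 \<le> K * dirichlet p"
    using conn path_le_dirichlet unfolding connected_graph_def by auto
  then obtain k where k: "\<And>i j p. i \<in> {1..N} \<Longrightarrow> j \<in> {1..N} \<Longrightarrow> (p i - p j)\<^sup>2 \<le> k (i, j) * dirichlet p"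
    by (metis (no_types, lifting) SigmaI fst_conv snd_conv)
  obtain m where m: "m > 0" "\<And>i j. i \<in> {1..N} \<Longrightarrow> j \<in> {1..N} \<Longrightarrow> k (i, j) \<le> m"
    using finite_uniform_upper[of "{1..N} \<times> {1..N}" k] by auto
  have "(\<Sum>i=1..N. (p i)\<^sup>2) \<le> (real N * m + 1) * dirichlet p" if zero: "(\<Sum>i=1..N. p i) = 0" for p
  proof (cases "N = 0")
    case False
    have "(\<Sum>i=1..N. \<Sum>j=1..N. (p i - p j)\<^sup>2) \<le> (\<Sum>i=1..N. \<Sum>j=1..N. m * dirichlet p)"
    proof (intro sum_mono)
      fix i j assume ij: "i \<in> {1..N}" "j \<in> {1..N}"
      show "(p i - p j)\<^sup>2 \<le> m * dirichlet p"
        using k[OF ij, of p] mult_right_mono[OF m(2)[OF ij] dirichlet_nonneg[of p]] by linarith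
    qed
    also have "\<dots> = real N * (real N * m * dirichlet p)" by simp
    finally have le: "(\<Sum>i=1..N. \<Sum>j=1..N. (p i - p j)\<^sup>2) \<le> real N * (real N * m * dirichlet p)" .
    have "(\<Sum>i=1..N. \<Sum>j=1..N. (p i - p j)\<^sup>2)
        = (\<Sum>i=1..N. \<Sum>j=1..N. (p i)\<^sup>2) + (\<Sum>i=1..N. \<Sum>j=1..N. (p j)\<^sup>2) - (\<Sum>i=1..N. 2 * p i * (\<Sum>j=1..N. p j))"
      unfolding sum_distrib_left sum.distrib[symmetric] sum_subtractf[symmetric]
      by (intro sum.cong refl) (simp add: power2_diff)
    also have "\<dots> = real N * (2 * (\<Sum>i=1..N. (p i)\<^sup>2))"
      unfolding zero by (simp add: sum_distrib_left[symmetric])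
    finally have "real N * (2 * (\<Sum>i=1..N. (p i)\<^sup>2)) \<le> real N * (real N * m * dirichlet p)"
      using le by simp
    then have "2 * (\<Sum>i=1..N. (p i)\<^sup>2) \<le> real N * m * dirichlet p"
      using False by simp
    moreover have "0 \<le> (\<Sum>i=1..N. (p i)\<^sup>2)" by (simp add: sum_nonneg)
    ultimately show ?thesis using dirichlet_nonneg[of p] by (simp add: distrib_right)
  qed (use dirichlet_nonneg in simp)
  moreover have "real N * m + 1 > 0" using m(1) by (simp add: add_nonneg_pos)
  ultimately show ?thesis
    by (intro exI[of _ "1 / (real N * m + 1)"]) (auto simp: field_simps)
qed

text \<open>Adding the all-ones matrix to the Laplacian makes it invertible: the quadratic form
  becomes \<open>dirichlet p\<close> plus the square of the sum of \<open>p\<close>, and by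
  \<open>poincare\<close> both vanish only for \<open>p = 0\<close>. A solution for the enlarged
  matrix satisfies the original equation up to a constant \<open>t\<close>, and summing over the
  nodes shows \<open>t = 0\<close>. This provides the steady state of \<open>v\<close>.\<close>

lemma nd_surjective:
  assumes b: "(\<Sum>i=1..N. b i) = 0"
  shows "\<exists>w. \<forall>i\<in>{1..N}. nd w i = b i"
proof -
  \<comment> \<open>Matrix indices start at 0 and nodes at 1, so row \<open>i\<close> belongs to
    node \<open>Suc i\<close>; \<open>ext\<close> translates vectors accordingly.\<close>
  define M where "M = mat N N (\<lambda>(i, j). (if i = j then (\<Sum>k=1..N. a (Suc i) k) else 0) - a (Suc i) (Suc j) + 1)"
  have M: "M \<in> carrier_mat N N" by (simp add: M_def)
  define ext where "ext u i = (u $ (i - 1) :: real)" for u i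
  have shift: "(\<Sum>j<N. g j) = (\<Sum>j=1..N. g (j - 1))" for g :: "nat \<Rightarrow> real"
    by (rule sum.reindex_bij_witness[of _ "\<lambda>j. j - 1" Suc]) auto
  have Mv: "(M *\<^sub>v u) $ i = nd (ext u) (Suc i) + (\<Sum>j=1..N. ext u j)"
    if u: "u \<in> carrier_vec N" and i: "i < N" for u i
  proof -
    have "(M *\<^sub>v u) $ i = (\<Sum>j<N. M $$ (i, j) * u $ j)"
      using M u i by (auto simp: scalar_prod_def atLeast0LessThan intro!: sum.cong)
    also have "\<dots> = (\<Sum>j<N. (if i = j then (\<Sum>k=1..N. a (Suc i) k) * u $ j else 0) + (u $ j - a (Suc i) (Suc j) * u $ j))"
      using i by (intro sum.cong) (auto simp: M_def algebra_simps)
    also have "\<dots> = (\<Sum>k=1..N. a (Suc i) k) * u $ i + (\<Sum>j<N. u $ j - a (Suc i) (Suc j) * u $ j)"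
      using i by (simp add: sum.distrib)
    also have "(\<Sum>j<N. u $ j - a (Suc i) (Suc j) * u $ j) = (\<Sum>j=1..N. ext u j - a (Suc i) j * ext u j)"
      unfolding shift by (intro sum.cong) (auto simp: ext_def)
    finally show ?thesis
      by (simp add: neighbor_diff_def ext_def sum_distrib_left sum_distrib_right sum_subtractf algebra_simps)
  qed
  have "det M \<noteq> 0"
  proof
    assume "det M = 0"
    then obtain u where u: "u \<in> carrier_vec N" "u \<noteq> 0\<^sub>v N" "M *\<^sub>v u = 0\<^sub>v N"
      using det_0_iff_vec_prod_zero_field[OF M] by blast
    let ?p = "ext u"
    have eq: "nd ?p i + (\<Sum>j=1..N. ?p j) = 0" if "i \<in> {1..N}" for i
      using Mv[OF u(1), of "i - 1"] u(3) that by auto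
    have "dirichlet ?p + (\<Sum>j=1..N. ?p j)\<^sup>2 = (\<Sum>i=1..N. ?p i * (nd ?p i + (\<Sum>j=1..N. ?p j)))"
      by (simp add: dirichlet_def distrib_left sum.distrib sum_distrib_right[symmetric] power2_eq_square)
    also have "\<dots> = 0" using eq by (intro sum.neutral) auto
    finally have "dirichlet ?p = 0 \<and> (\<Sum>j=1..N. ?p j)\<^sup>2 = 0"
      using dirichlet_nonneg[of ?p] zero_le_power2[of "\<Sum>j=1..N. ?p j"] by linarith
    then have "dirichlet ?p = 0" "(\<Sum>j=1..N. ?p j) = 0" by auto
    moreover obtain \<gamma> where "\<gamma> > 0" "\<And>p. (\<Sum>i=1..N. p i) = 0 \<Longrightarrow> \<gamma> * (\<Sum>i=1..N. (p i)\<^sup>2) \<le> dirichlet p"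
      using poincare by blast
    ultimately have "\<gamma> > 0" "\<gamma> * (\<Sum>i=1..N. (?p i)\<^sup>2) \<le> 0" by fastforce+
    then have "(\<Sum>i=1..N. (?p i)\<^sup>2) \<le> 0" by (simp add: mult_le_0_iff)
    moreover have "0 \<le> (\<Sum>i=1..N. (?p i)\<^sup>2)" by (simp add: sum_nonneg)
    ultimately have "(\<Sum>i=1..N. (?p i)\<^sup>2) = 0" by linarith
    then have z: "?p i = 0" if "i \<in> {1..N}" for i
      using that by (subst (asm) sum_nonneg_eq_0_iff) auto
    have "u = 0\<^sub>v N"
    proof (intro eq_vecI)
      fix i assume "i < dim_vec (0\<^sub>v N)"
      then show "u $ i = 0\<^sub>v N $ i" using z[of "Suc i"] by (simp add: ext_def)
    qed (use u(1) in simp)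
    with u(2) show False ..
  qed
  from det_non_zero_imp_unit[OF M this]
  obtain R where R: "R \<in> carrier_mat N N" "M * R = 1\<^sub>m N"
    by (auto simp: Units_def ring_mat_def)
  define u where "u = R *\<^sub>v vec N (\<lambda>i. b (Suc i))"
  have u: "u \<in> carrier_vec N" using R(1) by (simp add: u_def)
  have "M *\<^sub>v u = (M * R) *\<^sub>v vec N (\<lambda>i. b (Suc i))"
    unfolding u_def by (rule assoc_mult_mat_vec[symmetric, OF M R(1)]) simp
  then have Mu: "M *\<^sub>v u = vec N (\<lambda>i. b (Suc i))" using R(2) by simp
  define t where "t = (\<Sum>j=1..N. ext u j)"
  have eq: "nd (ext u) i + t = b i" if "i \<in> {1..N}" for i
    using Mv[OF u, of "i - 1"] that Mu unfolding t_def by auto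
  have "(\<Sum>i=1..N. nd (ext u) i + t) = 0" using eq b by simp
  then have "real N * t = 0" using sum_nd[of "ext u"] by (simp add: sum.distrib)
  with eq show ?thesis by (intro exI[of _ "ext u"]) auto
qed

text \<open>The states are deviations from equilibrium, \<open>h i\<close> is a secant slope of the
  gradient, and \<open>s\<close> stands for the tracking error \<open>y - z\<close>. The constants
  depend on the bounds of \<open>h\<close> and on the graph only. The derivative of
  \<open>- \<delta> * z * l\<close> contributes \<open>- \<delta> * l^2\<close>, and that of
  \<open>\<delta> * l * v\<close> contributes \<open>- \<delta> * v * nd v\<close>, whose sum is
  coercive by \<open>poincare\<close> because \<open>v\<close> has zero sum. All other new terms are
  absorbed by Young's inequality.\<close>

lemma slow_dissipation:
  assumes m: "0 < m" and H: "0 < H"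
  shows "\<exists>\<delta> \<alpha> C. 0 < \<delta> \<and> \<delta> \<le> 1 / 4 \<and> 0 < \<alpha> \<and> 0 < C \<and>
    (\<forall>z l v s h. (\<forall>i\<in>{1..N}. m \<le> h i \<and> h i \<le> H) \<longrightarrow> (\<Sum>i=1..N. v i) = 0 \<longrightarrow>
      (\<Sum>i=1..N. slow_rate \<delta> (z i) (l i) (v i)
          (- h i * (z i + s i) + l i) (- nd l i - nd v i - z i) (nd l i))
      \<le> - \<alpha> * (\<Sum>i=1..N. (z i)\<^sup>2 + (l i)\<^sup>2 + (v i)\<^sup>2) + C * (\<Sum>i=1..N. (s i)\<^sup>2))"
proof -
  obtain K where K: "K > 0" "\<And>p. (\<Sum>i=1..N. (nd p i)\<^sup>2) \<le> K * dirichlet p"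
    using nd_square_bound by blast
  obtain \<gamma> where \<gamma>: "\<gamma> > 0"
    "\<And>p. (\<Sum>i=1..N. p i) = 0 \<Longrightarrow> \<gamma> * (\<Sum>i=1..N. (p i)\<^sup>2) \<le> dirichlet p"
    using poincare by blast
  \<comment> \<open>\<open>\<kappa>\<close> collects the coefficients of
    \<open>\<delta> * z^2\<close> created by the cross terms, and \<open>\<beta>\<close> those of
    \<open>\<delta> * (nd l)^2\<close>. The bounds on \<open>\<delta>\<close> make the former at
    most \<open>m / 4\<close> and let the dissipation \<open>(1 - \<delta>) * dirichlet l\<close>
    absorb the latter.\<close>
  define \<kappa> where "\<kappa> = H\<^sup>2 + 1 / 2 + K + 1 + 2 / \<gamma>"
  define \<beta> where "\<beta> = 1 / 2 + 1 / \<gamma>"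
  have \<kappa>: "\<kappa> > 0" and \<beta>: "\<beta> > 0" using K \<gamma> by (auto simp: \<kappa>_def \<beta>_def add_pos_pos add_nonneg_pos)
  define \<delta> where "\<delta> = min (1 / 4) (min (m / (4 * \<kappa>)) (1 / (1 + K * \<beta>)))"
  have \<delta>: "0 < \<delta>" "\<delta> \<le> 1 / 4" using m \<kappa> K \<beta> by (auto simp: \<delta>_def add_pos_pos)
  have "\<delta> \<le> m / (4 * \<kappa>)" "\<delta> \<le> 1 / (1 + K * \<beta>)" by (auto simp: \<delta>_def)
  then have \<delta>\<kappa>: "\<delta> * \<kappa> \<le> m / 4" and \<delta>\<beta>: "\<delta> * (1 + K * \<beta>) \<le> 1"
    using \<kappa> K \<beta> by (simp_all add: pos_le_divide_eq add_pos_pos mult.commute)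
  \<comment> \<open>The three numbers are what remains for \<open>z\<close>, \<open>l\<close> and
    \<open>v\<close>. For \<open>v\<close>, one quarter of \<open>\<delta> * dirichlet v\<close>
    pays for \<open>(nd v)^2\<close>, and half of the remaining three quarters pays for the terms in
    \<open>v^2\<close>.\<close>
  define \<alpha> where "\<alpha> = min (m / 2) (min (\<delta> / 2) (3 / 8 * \<delta> * \<gamma>))"
  have \<alpha>: "0 < \<alpha>" "\<alpha> \<le> m / 2" "\<alpha> \<le> \<delta> / 2" "\<alpha> \<le> 3 / 8 * \<delta> * \<gamma>"
    using m \<delta> \<gamma> by (auto simp: \<alpha>_def)
  define C where "C = H\<^sup>2 / m + \<delta> * H\<^sup>2"
  have C: "C > 0" using m H \<delta> by (auto simp: C_def add_pos_pos)
  have main: "(\<Sum>i=1..N. slow_rate \<delta> (z i) (l i) (v i)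
          (- h i * (z i + s i) + l i) (- nd l i - nd v i - z i) (nd l i))
      \<le> - \<alpha> * (\<Sum>i=1..N. (z i)\<^sup>2 + (l i)\<^sup>2 + (v i)\<^sup>2) + C * (\<Sum>i=1..N. (s i)\<^sup>2)"
    if h: "\<And>i. i \<in> {1..N} \<Longrightarrow> m \<le> h i \<and> h i \<le> H" and v: "(\<Sum>i=1..N. v i) = 0" for z l v s h
  proof -
    \<comment> \<open>The pointwise bound keeps all terms in \<open>nd\<close>: they can be
      estimated only after summation over the graph.\<close>
    define R where "R i = - (m / 2) * (z i)\<^sup>2 + C * (s i)\<^sup>2 - \<delta> / 2 * (l i)\<^sup>2 + \<delta> * \<beta> * (nd l i)\<^sup>2
        + \<delta> / (4 * K) * (nd v i)\<^sup>2 + 3 / 8 * \<delta> * \<gamma> * (v i)\<^sup>2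
        - (1 - \<delta>) * (l i * nd l i) - l i * nd v i + v i * nd l i - \<delta> * (v i * nd v i)" for i
    have pt: "slow_rate \<delta> (z i) (l i) (v i)
          (- h i * (z i + s i) + l i) (- nd l i - nd v i - z i) (nd l i) \<le> R i"
      if i: "i \<in> {1..N}" for i
    proof -
      note hi = h[OF i]
      have h2: "(h i * u)\<^sup>2 \<le> H\<^sup>2 * u\<^sup>2" for u
        using hi m by (auto simp: power_mult_distrib intro!: mult_right_mono power_mono)
      have y0: "- (h i * (z i)\<^sup>2) \<le> - m * (z i)\<^sup>2"
        using hi by (simp add: mult_right_mono)
      have y1: "- (h i * z i * s i) \<le> m / 4 * (z i)\<^sup>2 + H\<^sup>2 / m * (s i)\<^sup>2"
      proof -
        have "z i * (- (h i * s i)) \<le> m / 4 * (z i)\<^sup>2 + (h i * s i)\<^sup>2 / m"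
          using young[of "m / 4" "z i" "- (h i * s i)"] m by simp
        also have "\<dots> \<le> m / 4 * (z i)\<^sup>2 + H\<^sup>2 * (s i)\<^sup>2 / m"
          using h2 m by (intro add_left_mono divide_right_mono) auto
        finally show ?thesis by (simp add: mult_ac)
      qed
      have y2: "\<delta> * (h i * z i * l i) \<le> \<delta> * ((l i)\<^sup>2 / 4 + H\<^sup>2 * (z i)\<^sup>2)"
        using young[of "1 / 4" "l i" "h i * z i"] h2[of "z i"] \<delta>
        by (intro mult_left_mono) (auto simp: mult_ac)
      have y3: "\<delta> * (h i * s i * l i) \<le> \<delta> * ((l i)\<^sup>2 / 4 + H\<^sup>2 * (s i)\<^sup>2)"
        using young[of "1 / 4" "l i" "h i * s i"] h2[of "s i"] \<delta>
        by (intro mult_left_mono) (auto simp: mult_ac)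
      have y4: "\<delta> * (z i * nd l i) \<le> \<delta> * ((z i)\<^sup>2 / 2 + (nd l i)\<^sup>2 / 2)"
        using young[of "1 / 2" "z i" "nd l i"] \<delta> by (intro mult_left_mono) auto
      have y5: "\<delta> * (z i * nd v i) \<le> \<delta> * (K * (z i)\<^sup>2 + (nd v i)\<^sup>2 / (4 * K))"
        using young[of K "z i" "nd v i"] \<delta> K by (intro mult_left_mono) auto
      have y6: "\<delta> * (- (nd l i * v i)) \<le> \<delta> * (\<gamma> / 4 * (v i)\<^sup>2 + (nd l i)\<^sup>2 / \<gamma>)"
        using young[of "\<gamma> / 4" "v i" "- nd l i"] \<delta> \<gamma> by (intro mult_left_mono) (auto simp: mult.commute)
      have y7: "\<delta> * (- (z i * v i)) \<le> \<delta> * (\<gamma> / 8 * (v i)\<^sup>2 + 2 / \<gamma> * (z i)\<^sup>2)"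
        using young[of "\<gamma> / 8" "v i" "- z i"] \<delta> \<gamma> by (intro mult_left_mono) (auto simp: mult.commute)
      have y8: "\<delta> * \<kappa> * (z i)\<^sup>2 \<le> m / 4 * (z i)\<^sup>2"
        using \<delta>\<kappa> by (intro mult_right_mono) auto
      have "slow_rate \<delta> (z i) (l i) (v i)
          (- h i * (z i + s i) + l i) (- nd l i - nd v i - z i) (nd l i)
        = - (h i * (z i)\<^sup>2) - h i * z i * s i + \<delta> * (h i * z i * l i) + \<delta> * (h i * s i * l i)
          - \<delta> * (l i)\<^sup>2 + \<delta> * (z i * nd l i) + \<delta> * (z i * nd v i) + \<delta> * (z i)\<^sup>2
          + \<delta> * (- (nd l i * v i)) + \<delta> * (- (z i * v i))
          - (1 - \<delta>) * (l i * nd l i) - l i * nd v i + v i * nd l i - \<delta> * (v i * nd v i)"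
        by (simp add: slow_rate_def power2_eq_square algebra_simps)
      also have "\<dots> \<le> - m * (z i)\<^sup>2 + (m / 4 * (z i)\<^sup>2 + H\<^sup>2 / m * (s i)\<^sup>2)
          + \<delta> * ((l i)\<^sup>2 / 4 + H\<^sup>2 * (z i)\<^sup>2) + \<delta> * ((l i)\<^sup>2 / 4 + H\<^sup>2 * (s i)\<^sup>2)
          - \<delta> * (l i)\<^sup>2 + \<delta> * ((z i)\<^sup>2 / 2 + (nd l i)\<^sup>2 / 2)
          + \<delta> * (K * (z i)\<^sup>2 + (nd v i)\<^sup>2 / (4 * K)) + \<delta> * (z i)\<^sup>2
          + \<delta> * (\<gamma> / 4 * (v i)\<^sup>2 + (nd l i)\<^sup>2 / \<gamma>) + \<delta> * (\<gamma> / 8 * (v i)\<^sup>2 + 2 / \<gamma> * (z i)\<^sup>2)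
          - (1 - \<delta>) * (l i * nd l i) - l i * nd v i + v i * nd l i - \<delta> * (v i * nd v i)"
        using y0 y1 y2 y3 y4 y5 y6 y7 by linarith
      also have "\<dots> = R i + (\<delta> * \<kappa> * (z i)\<^sup>2 - m / 4 * (z i)\<^sup>2)"
        unfolding R_def \<kappa>_def \<beta>_def C_def by (simp add: algebra_simps)
      also have "\<dots> \<le> R i" using y8 by simp
      finally show ?thesis .
    qed
    have "(\<Sum>i=1..N. slow_rate \<delta> (z i) (l i) (v i)
          (- h i * (z i + s i) + l i) (- nd l i - nd v i - z i) (nd l i)) \<le> (\<Sum>i=1..N. R i)"
      using pt by (intro sum_mono) auto
    also have "\<dots> = - (m / 2) * (\<Sum>i=1..N. (z i)\<^sup>2) + C * (\<Sum>i=1..N. (s i)\<^sup>2) - \<delta> / 2 * (\<Sum>i=1..N. (l i)\<^sup>2)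
        + \<delta> * \<beta> * (\<Sum>i=1..N. (nd l i)\<^sup>2) + \<delta> / (4 * K) * (\<Sum>i=1..N. (nd v i)\<^sup>2)
        + 3 / 8 * \<delta> * \<gamma> * (\<Sum>i=1..N. (v i)\<^sup>2) - (1 - \<delta>) * dirichlet l - \<delta> * dirichlet v"
      using sum_mult_nd_commute[of l v]
      by (simp only: R_def sum.distrib sum_subtractf sum_distrib_left[symmetric] dirichlet_def)
    also have "\<dots> \<le> - (m / 2) * (\<Sum>i=1..N. (z i)\<^sup>2) + C * (\<Sum>i=1..N. (s i)\<^sup>2) - \<delta> / 2 * (\<Sum>i=1..N. (l i)\<^sup>2)
        - 3 / 8 * \<delta> * \<gamma> * (\<Sum>i=1..N. (v i)\<^sup>2)"
    proof -
      have "\<delta> * \<beta> * (\<Sum>i=1..N. (nd l i)\<^sup>2) \<le> \<delta> * \<beta> * (K * dirichlet l)"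
        using \<delta> \<beta> K(2)[of l] by (intro mult_left_mono) auto
      moreover have "\<delta> * (1 + K * \<beta>) * dirichlet l \<le> 1 * dirichlet l"
        using \<delta>\<beta> dirichlet_nonneg by (intro mult_right_mono)
      moreover have "\<delta> / (4 * K) * (\<Sum>i=1..N. (nd v i)\<^sup>2) \<le> \<delta> / (4 * K) * (K * dirichlet v)"
        using \<delta> K(1) K(2)[of v] by (intro mult_left_mono) auto
      moreover have "\<delta> / (4 * K) * (K * dirichlet v) = \<delta> / 4 * dirichlet v"
        using K(1) by simp
      moreover have "\<delta> * (3 / 4) * (\<gamma> * (\<Sum>i=1..N. (v i)\<^sup>2)) \<le> \<delta> * (3 / 4) * dirichlet v"
        using \<gamma>(2)[OF v] \<delta> by (intro mult_left_mono) auto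
      ultimately show ?thesis by (simp add: algebra_simps)
    qed
    also have "\<dots> \<le> - \<alpha> * (\<Sum>i=1..N. (z i)\<^sup>2) + C * (\<Sum>i=1..N. (s i)\<^sup>2) - \<alpha> * (\<Sum>i=1..N. (l i)\<^sup>2)
        - \<alpha> * (\<Sum>i=1..N. (v i)\<^sup>2)"
      using \<alpha> by (intro add_mono diff_mono mult_right_mono sum_nonneg order_refl) auto
    finally show ?thesis by (simp only: sum.distrib) (simp add: algebra_simps)
  qed
  then show ?thesis
    using \<delta> \<alpha>(1) C by (intro exI[of _ \<delta>] exI[of _ \<alpha>] exI[of _ C]) blast
qed

end

subsection \<open>Output dynamics of a single agent\<close>

lemma mult_mat_vec_entry:
  assumes "M \<in> carrier_mat m n" "v \<in> carrier_vec n" "i < m"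
  shows "(M *\<^sub>v v) $ i = (\<Sum>j<n. M $$ (i, j) * v $ j)"
  using assms by (auto simp: scalar_prod_def atLeast0LessThan intro!: sum.cong)

lemma smult_mult_mat_vec_entry:
  fixes M :: "real mat"
  assumes "M \<in> carrier_mat m n" "v \<in> carrier_vec n" "i < m"
  shows "(s \<cdot>\<^sub>m M *\<^sub>v v) $ i = s * (M *\<^sub>v v) $ i"
  using assms mult_mat_vec_entry[of "s \<cdot>\<^sub>m M" m n v i]
  by (simp add: mult_mat_vec_entry sum_distrib_left mult.assoc del: index_mult_mat_vec)

lemma vec_ode_mult_mat_entry:
  assumes ode: "vec_ode n x dx" and M: "M \<in> carrier_mat m n" and i: "i < m" and t: "t \<ge> 0"
  shows "((\<lambda>\<tau>. (M *\<^sub>v x \<tau>) $ i) has_real_derivative (M *\<^sub>v dx t) $ i) (at t within {0..})"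
proof -
  have x: "x \<tau> \<in> carrier_vec n" "dx \<tau> \<in> carrier_vec n" if "\<tau> \<ge> 0" for \<tau>
    using ode that by (auto simp: vec_ode_def)
  have "((\<lambda>\<tau>. \<Sum>j<n. M $$ (i, j) * x \<tau> $ j) has_real_derivative (\<Sum>j<n. M $$ (i, j) * dx t $ j)) (at t within {0..})"
    using ode t by (intro DERIV_sum DERIV_cmult) (auto simp: vec_ode_def)
  then have "((\<lambda>\<tau>. (M *\<^sub>v x \<tau>) $ i) has_real_derivative (\<Sum>j<n. M $$ (i, j) * dx t $ j)) (at t within {0..})"
    by (rule has_field_derivative_transform_within[of _ _ _ _ 1])
      (use t x M i in \<open>auto simp: mult_mat_vec_entry simp del: index_mult_mat_vec\<close>)
  then show ?thesis using mult_mat_vec_entry[OF M x(2)[OF t] i] by simp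
qed

lemma add_vec_entry: "w \<in> carrier_vec m \<Longrightarrow> i < m \<Longrightarrow> (v + w) $ i = v $ i + w $ i"
  by (rule index_add_vec) simp

lemma smult_vec_entry: "v \<in> carrier_vec m \<Longrightarrow> i < m \<Longrightarrow> (s \<cdot>\<^sub>v v) $ i = s * v $ i"
  by (rule index_smult_vec) simp

lemma minus_vec_entry: "w \<in> carrier_vec m \<Longrightarrow> i < m \<Longrightarrow> (v - w) $ i = v $ i - w $ i"
  by (rule index_minus_vec) simp

text \<open>The scaled deviation of the output derivatives from their steady-state values.\<close>

definition scaled_error :: "real mat \<Rightarrow> real mat \<Rightarrow> real mat \<Rightarrow> real mat \<Rightarrow> real \<Rightarrow>
    real vec \<Rightarrow> real vec \<Rightarrow> real \<Rightarrow> nat \<Rightarrow> real" where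
  "scaled_error A C E S \<epsilon> x \<omega> z k =
     \<epsilon> ^ k * ((C * A ^\<^sub>m k *\<^sub>v x) $ 0 - (X1_row A C E S k *\<^sub>v \<omega>) $ 0 - (if k = 0 then z else 0))"

locale agent =
  fixes n q r :: nat and A B C E S L :: "real mat" and c :: "nat \<Rightarrow> real" and \<epsilon> :: real
  assumes A: "A \<in> carrier_mat n n" and B: "B \<in> carrier_mat n 1" and C: "C \<in> carrier_mat 1 n"
    and E: "E \<in> carrier_mat n q" and S: "S \<in> carrier_mat q q" and L: "L \<in> carrier_mat q n"
    and r: "r > 0" and rel: "relative_degree A B C r" and \<epsilon>: "\<epsilon> > 0"
begin

abbreviation "g \<equiv> hf_gain A B C r"

lemma CA [simp]: "C * A ^\<^sub>m k \<in> carrier_mat 1 n"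
  using C A by auto

lemma row [simp]: "X1_row A C E S k \<in> carrier_mat 1 q"
  using S C A E by (induction k) (auto intro!: minus_carrier_mat)

lemma g_nonzero: "g \<noteq> 0"
proof
  assume "g = 0"
  then have "C * A ^\<^sub>m (r - 1) * B = 0\<^sub>m 1 1"
    using C A B by (intro eq_matI) (auto simp: hf_gain_def)
  with rel show False by (simp add: relative_degree_def)
qed

text \<open>The output derivatives form a chain of integrators: by the relative degree,
  \<open>C * A^k * B\<close> vanishes before the last link, and there it is
  \<open>g\<close>.\<close>

lemma CA_dynamics:
  assumes "x \<in> carrier_vec n" "u \<in> carrier_vec 1" "\<omega> \<in> carrier_vec q" "k < r"
  shows "(C * A ^\<^sub>m k *\<^sub>v (A *\<^sub>v x + B *\<^sub>v u + E *\<^sub>v \<omega>)) $ 0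
    = (C * A ^\<^sub>m Suc k *\<^sub>v x) $ 0 + (if Suc k = r then g * u $ 0 else 0) + (C * A ^\<^sub>m k * E *\<^sub>v \<omega>) $ 0"
proof -
  have Su: "C * A ^\<^sub>m k * A = C * A ^\<^sub>m Suc k"
    using A C by (simp add: assoc_mult_mat[of C 1 n "A ^\<^sub>m k" n A n])
  have carr: "A *\<^sub>v x \<in> carrier_vec n" "B *\<^sub>v u \<in> carrier_vec n" "E *\<^sub>v \<omega> \<in> carrier_vec n"
    using assms A B E by auto
  have "C * A ^\<^sub>m k *\<^sub>v (A *\<^sub>v x + B *\<^sub>v u + E *\<^sub>v \<omega>)
     = C * A ^\<^sub>m k *\<^sub>v (A *\<^sub>v x) + C * A ^\<^sub>m k *\<^sub>v (B *\<^sub>v u) + C * A ^\<^sub>m k *\<^sub>v (E *\<^sub>v \<omega>)"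
    using carr mult_add_distrib_mat_vec[OF CA, of "A *\<^sub>v x + B *\<^sub>v u" "E *\<^sub>v \<omega>" k]
      mult_add_distrib_mat_vec[OF CA, of "A *\<^sub>v x" "B *\<^sub>v u" k] by simp
  also have "C * A ^\<^sub>m k *\<^sub>v (A *\<^sub>v x) = C * A ^\<^sub>m Suc k *\<^sub>v x"
    unfolding Su[symmetric] by (rule assoc_mult_mat_vec[symmetric, OF CA A assms(1)])
  also have "C * A ^\<^sub>m k *\<^sub>v (B *\<^sub>v u) = (C * A ^\<^sub>m k * B) *\<^sub>v u"
    by (rule assoc_mult_mat_vec[symmetric, OF CA B assms(2)])
  also have "C * A ^\<^sub>m k *\<^sub>v (E *\<^sub>v \<omega>) = (C * A ^\<^sub>m k * E) *\<^sub>v \<omega>"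
    by (rule assoc_mult_mat_vec[symmetric, OF CA E assms(3)])
  finally have eq: "C * A ^\<^sub>m k *\<^sub>v (A *\<^sub>v x + B *\<^sub>v u + E *\<^sub>v \<omega>)
     = C * A ^\<^sub>m Suc k *\<^sub>v x + C * A ^\<^sub>m k * B *\<^sub>v u + C * A ^\<^sub>m k * E *\<^sub>v \<omega>" .
  have "(C * A ^\<^sub>m k * B *\<^sub>v u) $ 0 = (C * A ^\<^sub>m k * B) $$ (0, 0) * u $ 0"
    using mult_mat_vec_entry[OF mult_carrier_mat[OF CA B] assms(2), of 0] by simp
  moreover have "(C * A ^\<^sub>m k * B) $$ (0, 0) = (if Suc k = r then g else 0)"
    using rel assms(4) unfolding relative_degree_def hf_gain_def by auto
  moreover have "C * A ^\<^sub>m Suc k *\<^sub>v x \<in> carrier_vec 1" "C * A ^\<^sub>m k * B *\<^sub>v u \<in> carrier_vec 1"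
    "C * A ^\<^sub>m k * E *\<^sub>v \<omega> \<in> carrier_vec 1"
    using CA assms B E by (meson mult_carrier_mat mult_mat_vec_carrier)+
  ultimately show ?thesis
    unfolding eq
    by (simp add: add_vec_entry[of _ 1] del: index_mult_mat_vec pow_mat.simps)
qed

text \<open>The recursion read along \<open>\<omega>' = S \<omega>\<close>. It absorbs the term
  \<open>C * A^k * E * \<omega>\<close> of \<open>CA_dynamics\<close>, so the deviation of one
  output derivative from its steady-state value differentiates to the deviation of the next.\<close>

lemma row_Suc:
  assumes "\<omega> \<in> carrier_vec q"
  shows "(X1_row A C E S (Suc k) *\<^sub>v \<omega>) $ 0
    = (X1_row A C E S k *\<^sub>v (S *\<^sub>v \<omega>)) $ 0 - (C * A ^\<^sub>m k * E *\<^sub>v \<omega>) $ 0"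
proof -
  have c1: "X1_row A C E S k * S \<in> carrier_mat 1 q" "C * A ^\<^sub>m k * E \<in> carrier_mat 1 q"
    using S E row[of k] CA[of k] by (meson mult_carrier_mat)+
  have "X1_row A C E S (Suc k) *\<^sub>v \<omega> = X1_row A C E S k * S *\<^sub>v \<omega> - C * A ^\<^sub>m k * E *\<^sub>v \<omega>"
    using minus_mult_distrib_mat_vec[OF c1 assms] by simp
  also have "X1_row A C E S k * S *\<^sub>v \<omega> = X1_row A C E S k *\<^sub>v (S *\<^sub>v \<omega>)"
    by (rule assoc_mult_mat_vec[OF row S assms])
  finally show ?thesis
    using mult_mat_vec_carrier[OF c1(2) assms]
    by (simp add: minus_vec_entry[of _ 1] del: index_mult_mat_vec X1_row.simps)
qed

lemma K1_mult_vec: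
  assumes "w \<in> carrier_vec r"
  shows "g * (K1 A B C r c \<epsilon> *\<^sub>v w) $ 0 = - (\<Sum>k<r. \<epsilon> ^ k * c k * w $ k) / \<epsilon> ^ r"
proof -
  have "(K1 A B C r c \<epsilon> *\<^sub>v w) $ 0 = - (1 / (g * \<epsilon> ^ r)) * (\<Sum>k<r. \<epsilon> ^ k * c k * w $ k)"
    using assms unfolding K1_def
    by (subst smult_mult_mat_vec_entry[of _ 1 r])
      (auto simp: mult_mat_vec_entry[of _ 1 r] simp del: index_mult_mat_vec)
  then show ?thesis using g_nonzero by (simp add: field_simps)
qed

lemma K2_carrier: "K2 A B C E S r c \<epsilon> \<in> carrier_mat 1 q"
  using S by (intro carrier_matI) (simp_all add: K2_def K1_def X1_def)

text \<open>The estimate of the disturbance is \<open>\<omega> + e\<close>. The \<open>K1\<close>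
  parts of all gains combine into feedback of the deviations, the \<open>U1\<close> part is the
  feedforward that cancels the disturbance in the last link of the chain, and \<open>e\<close> is
  left only through \<open>K2\<close>.\<close>

lemma control_input_entry:
  assumes x: "x \<in> carrier_vec n" and \<omega>: "\<omega> \<in> carrier_vec q" and e: "e \<in> carrier_vec q"
  shows "g * control_input A B C E S r c \<epsilon> x (\<omega> + e) z $ 0
    = - (C * A ^\<^sub>m r *\<^sub>v x) $ 0
      - (\<Sum>k<r. c k * scaled_error A C E S \<epsilon> x \<omega> z k) / \<epsilon> ^ r
      + (X1_row A C E S (r - 1) *\<^sub>v (S *\<^sub>v \<omega>)) $ 0 - (C * A ^\<^sub>m (r - 1) * E *\<^sub>v \<omega>) $ 0
      + g * (K2 A B C E S r c \<epsilon> *\<^sub>v e) $ 0"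
proof -
  let ?K1 = "K1 A B C r c \<epsilon>" and ?K2 = "K2 A B C E S r c \<epsilon>" and ?K3 = "K3 A B C r c \<epsilon>"
  let ?z = "vec 1 (\<lambda>_. z)"
  have K1: "?K1 \<in> carrier_mat 1 r" by (simp add: K1_def)
  have Xh: "Xhat A C r \<in> carrier_mat r n" using A by (simp add: Xhat_def)
  have X1: "X1 A C E S r \<in> carrier_mat r q" using S by (simp add: X1_def)
  have X2: "X2 r \<in> carrier_mat r 1" by (simp add: X2_def)
  have c1: "X1_row A C E S (r - 1) * S \<in> carrier_mat 1 q" "C * A ^\<^sub>m (r - 1) * E \<in> carrier_mat 1 q"
    using S E row[of "r - 1"] CA[of "r - 1"] by (meson mult_carrier_mat)+
  have U1: "U1 A B C E S r \<in> carrier_mat 1 q"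
    unfolding U1_def by (intro smult_carrier_mat minus_carrier_mat c1)
  note K2 = K2_carrier
  have U2: "U2 \<in> carrier_mat 1 1" by (simp add: U2_def)
  have z: "?z \<in> carrier_vec 1" by simp
  have t1: "(?K1 * Xhat A C r *\<^sub>v x) $ 0 = (?K1 *\<^sub>v (Xhat A C r *\<^sub>v x)) $ 0"
    using assoc_mult_mat_vec[OF K1 Xh x] by simp
  have xh: "(Xhat A C r *\<^sub>v x) $ k = (C * A ^\<^sub>m k *\<^sub>v x) $ 0" if "k < r" for k
    using mult_mat_vec_entry[OF Xh x that] mult_mat_vec_entry[OF CA x, of 0 k] that A
    by (simp add: Xhat_def del: index_mult_mat_vec)
  have x1: "(X1 A C E S r *\<^sub>v \<omega>) $ k = (X1_row A C E S k *\<^sub>v \<omega>) $ 0" if "k < r" for k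
    using mult_mat_vec_entry[OF X1 \<omega> that] mult_mat_vec_entry[OF row \<omega>, of 0 k] that S
    by (simp add: X1_def del: index_mult_mat_vec)
  have x2: "(X2 r *\<^sub>v ?z) $ k = (if k = 0 then z else 0)" if "k < r" for k
    using mult_mat_vec_entry[OF X2 z that] that by (simp add: X2_def del: index_mult_mat_vec)
  have t2: "(?K2 *\<^sub>v (\<omega> + e)) $ 0 = (U1 A B C E S r *\<^sub>v \<omega>) $ 0 - (?K1 *\<^sub>v (X1 A C E S r *\<^sub>v \<omega>)) $ 0 + (?K2 *\<^sub>v e) $ 0"
  proof -
    have "?K2 *\<^sub>v (\<omega> + e) = ?K2 *\<^sub>v \<omega> + ?K2 *\<^sub>v e"
      by (rule mult_add_distrib_mat_vec[OF K2 \<omega> e])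
    moreover have "?K2 *\<^sub>v \<omega> = U1 A B C E S r *\<^sub>v \<omega> - ?K1 * X1 A C E S r *\<^sub>v \<omega>"
      unfolding K2_def by (rule minus_mult_distrib_mat_vec[OF U1 mult_carrier_mat[OF K1 X1] \<omega>])
    moreover have "?K1 * X1 A C E S r *\<^sub>v \<omega> = ?K1 *\<^sub>v (X1 A C E S r *\<^sub>v \<omega>)"
      by (rule assoc_mult_mat_vec[OF K1 X1 \<omega>])
    ultimately show ?thesis
      using mult_mat_vec_carrier[OF K2 e] mult_mat_vec_carrier[OF K1 mult_mat_vec_carrier[OF X1 \<omega>]]
      by (simp add: add_vec_entry[of _ 1] minus_vec_entry[of _ 1] del: index_mult_mat_vec)
  qed
  have t3: "(?K3 *\<^sub>v ?z) $ 0 = - (?K1 *\<^sub>v (X2 r *\<^sub>v ?z)) $ 0"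
  proof -
    have "?K3 *\<^sub>v ?z = U2 *\<^sub>v ?z - ?K1 * X2 r *\<^sub>v ?z"
      unfolding K3_def by (rule minus_mult_distrib_mat_vec[OF U2 mult_carrier_mat[OF K1 X2] z])
    moreover have "?K1 * X2 r *\<^sub>v ?z = ?K1 *\<^sub>v (X2 r *\<^sub>v ?z)"
      by (rule assoc_mult_mat_vec[OF K1 X2 z])
    moreover have "(U2 *\<^sub>v ?z) $ 0 = 0"
      using mult_mat_vec_entry[OF U2 z, of 0] by (simp add: U2_def del: index_mult_mat_vec)
    ultimately show ?thesis
      using mult_mat_vec_carrier[OF K1 mult_mat_vec_carrier[OF X2 z]]
      by (simp add: minus_vec_entry[of _ 1] del: index_mult_mat_vec)
  qed
  have t4: "g * (U1 A B C E S r *\<^sub>v \<omega>) $ 0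
      = (X1_row A C E S (r - 1) *\<^sub>v (S *\<^sub>v \<omega>)) $ 0 - (C * A ^\<^sub>m (r - 1) * E *\<^sub>v \<omega>) $ 0"
  proof -
    have "(U1 A B C E S r *\<^sub>v \<omega>) $ 0
        = 1 / g * ((X1_row A C E S (r - 1) * S - C * A ^\<^sub>m (r - 1) * E) *\<^sub>v \<omega>) $ 0"
      unfolding U1_def by (rule smult_mult_mat_vec_entry[OF minus_carrier_mat[OF c1(2)] \<omega>]) simp
    moreover have "(X1_row A C E S (r - 1) * S - C * A ^\<^sub>m (r - 1) * E) *\<^sub>v \<omega>
        = X1_row A C E S (r - 1) *\<^sub>v (S *\<^sub>v \<omega>) - C * A ^\<^sub>m (r - 1) * E *\<^sub>v \<omega>"
      using minus_mult_distrib_mat_vec[OF c1 \<omega>] assoc_mult_mat_vec[OF row S \<omega>] by simp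
    ultimately show ?thesis
      using g_nonzero mult_mat_vec_carrier[OF c1(2) \<omega>]
      by (simp add: minus_vec_entry[of _ 1] del: index_mult_mat_vec)
  qed
  have Cr: "C * A ^\<^sub>m r *\<^sub>v x \<in> carrier_vec 1" by (rule mult_mat_vec_carrier[OF CA x])
  have "\<omega> + e \<in> carrier_vec q" using \<omega> e by simp
  then have eq: "control_input A B C E S r c \<epsilon> x (\<omega> + e) z $ 0
    = - (1 / g) * (C * A ^\<^sub>m r *\<^sub>v x) $ 0 + (?K1 * Xhat A C r *\<^sub>v x) $ 0
      + (?K2 *\<^sub>v (\<omega> + e)) $ 0 + (?K3 *\<^sub>v ?z) $ 0"
    unfolding control_input_def
    using Cr K1 K2 X2 by (simp add: K3_def U2_def smult_vec_entry[of _ 1] del: index_mult_mat_vec)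
  have "g * control_input A B C E S r c \<epsilon> x (\<omega> + e) z $ 0
    = - (C * A ^\<^sub>m r *\<^sub>v x) $ 0 + g * (?K1 *\<^sub>v (Xhat A C r *\<^sub>v x)) $ 0
      + (g * (U1 A B C E S r *\<^sub>v \<omega>) $ 0 - g * (?K1 *\<^sub>v (X1 A C E S r *\<^sub>v \<omega>)) $ 0 + g * (?K2 *\<^sub>v e) $ 0)
      - g * (?K1 *\<^sub>v (X2 r *\<^sub>v ?z)) $ 0"
  proof -
    have "g * (- (1 / g) * a1 + b1 + b2 + b3) = - a1 + g * b1 + g * b2 + g * b3" for a1 b1 b2 b3
      using g_nonzero by (simp add: distrib_left right_diff_distrib)
    then show ?thesis
      unfolding eq t1 t2 t3 by (simp only: distrib_left right_diff_distrib mult_minus_right) simp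
  qed
  also have "\<dots> = - (C * A ^\<^sub>m r *\<^sub>v x) $ 0
      - ((\<Sum>k<r. \<epsilon> ^ k * c k * (C * A ^\<^sub>m k *\<^sub>v x) $ 0) - (\<Sum>k<r. \<epsilon> ^ k * c k * (X1_row A C E S k *\<^sub>v \<omega>) $ 0)
         - (\<Sum>k<r. \<epsilon> ^ k * c k * (if k = 0 then z else 0))) / \<epsilon> ^ r
      + (X1_row A C E S (r - 1) *\<^sub>v (S *\<^sub>v \<omega>)) $ 0 - (C * A ^\<^sub>m (r - 1) * E *\<^sub>v \<omega>) $ 0
      + g * (?K2 *\<^sub>v e) $ 0"
    unfolding t4 using Xh x X1 \<omega> X2 z
    by (simp add: K1_mult_vec xh x1 x2 diff_divide_distrib add_divide_distrib del: index_mult_mat_vec One_nat_def)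
  also have "(\<Sum>k<r. \<epsilon> ^ k * c k * (C * A ^\<^sub>m k *\<^sub>v x) $ 0) - (\<Sum>k<r. \<epsilon> ^ k * c k * (X1_row A C E S k *\<^sub>v \<omega>) $ 0)
         - (\<Sum>k<r. \<epsilon> ^ k * c k * (if k = 0 then z else 0))
      = (\<Sum>k<r. c k * scaled_error A C E S \<epsilon> x \<omega> z k)"
    unfolding sum_subtractf[symmetric] scaled_error_def
    by (intro sum.cong refl) (simp add: algebra_simps del: index_mult_mat_vec)
  finally show ?thesis .
qed

lemma control_input_carrier: "control_input A B C E S r c \<epsilon> x \<eta> z \<in> carrier_vec 1"
  by (rule carrier_vecI) (simp add: control_input_def K3_def X2_def K1_def)

text \<open>Feedback linearization cancels the zero dynamics from the output, so these equations are
  autonomous up to \<open>e\<close> and \<open>dz\<close>.\<close>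

lemma scaled_error_deriv:
  assumes x_ode: "vec_ode n x (\<lambda>t. A *\<^sub>v x t + B *\<^sub>v control_input A B C E S r c \<epsilon> (x t) (\<omega> t + e t) (z t)
        + E *\<^sub>v \<omega> t)"
    and \<omega>_ode: "vec_ode q \<omega> (\<lambda>t. S *\<^sub>v \<omega> t)"
    and e: "e t \<in> carrier_vec q"
    and z_ode: "scalar_ode z dz"
    and k: "k < r" and t: "t \<ge> 0"
  shows "((\<lambda>\<tau>. scaled_error A C E S \<epsilon> (x \<tau>) (\<omega> \<tau>) (z \<tau>) k) has_real_derivative
     companion r c (scaled_error A C E S \<epsilon> (x t) (\<omega> t) (z t)) k / \<epsilon>
     + ((if Suc k = r then \<epsilon> ^ k * (g * (K2 A B C E S r c \<epsilon> *\<^sub>v e t) $ 0) else 0)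
        - (if k = 0 then dz t else 0))) (at t within {0..})"
proof -
  have xt: "x t \<in> carrier_vec n" and \<omega>t: "\<omega> t \<in> carrier_vec q"
    using x_ode \<omega>_ode t by (auto simp: vec_ode_def)
  let ?u = "control_input A B C E S r c \<epsilon> (x t) (\<omega> t + e t) (z t)"
  let ?s = "scaled_error A C E S \<epsilon> (x t) (\<omega> t) (z t)"
  have dz: "((\<lambda>\<tau>. if k = 0 then z \<tau> else 0) has_real_derivative (if k = 0 then dz t else 0)) (at t within {0..})"
    using z_ode t by (simp add: scalar_ode_def)
  have "((\<lambda>\<tau>. scaled_error A C E S \<epsilon> (x \<tau>) (\<omega> \<tau>) (z \<tau>) k) has_real_derivative
     \<epsilon> ^ k * ((C * A ^\<^sub>m k *\<^sub>v (A *\<^sub>v x t + B *\<^sub>v ?u + E *\<^sub>v \<omega> t)) $ 0 - (X1_row A C E S k *\<^sub>v (S *\<^sub>v \<omega> t)) $ 0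
       - (if k = 0 then dz t else 0))) (at t within {0..})"
    unfolding scaled_error_def
    by (intro DERIV_cmult DERIV_diff dz vec_ode_mult_mat_entry[OF x_ode CA _ t]
        vec_ode_mult_mat_entry[OF \<omega>_ode row _ t]) auto
  moreover have "\<epsilon> ^ k * ((C * A ^\<^sub>m k *\<^sub>v (A *\<^sub>v x t + B *\<^sub>v ?u + E *\<^sub>v \<omega> t)) $ 0 - (X1_row A C E S k *\<^sub>v (S *\<^sub>v \<omega> t)) $ 0
       - (if k = 0 then dz t else 0))
     = companion r c ?s k / \<epsilon> + ((if Suc k = r then \<epsilon> ^ k * (g * (K2 A B C E S r c \<epsilon> *\<^sub>v e t) $ 0) else 0)
        - (if k = 0 then dz t else 0))"
  proof (cases "Suc k = r")
    case True
    \<comment> \<open>In the last component the scaling leaves exactly one factor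
      \<open>1 / \<epsilon>\<close>, the same as in the shift components, where it comes from
      \<open>\<epsilon>^k\<close> against \<open>\<epsilon>^(k+1)\<close>.\<close>
    have pe: "\<epsilon> ^ k / \<epsilon> ^ r = 1 / \<epsilon>" using True \<epsilon> by auto
    have kr: "r - 1 = k" using True by simp
    have "(C * A ^\<^sub>m k *\<^sub>v (A *\<^sub>v x t + B *\<^sub>v ?u + E *\<^sub>v \<omega> t)) $ 0 - (X1_row A C E S k *\<^sub>v (S *\<^sub>v \<omega> t)) $ 0
       = - (\<Sum>k<r. c k * ?s k) / \<epsilon> ^ r + g * (K2 A B C E S r c \<epsilon> *\<^sub>v e t) $ 0"
      using CA_dynamics[OF xt control_input_carrier \<omega>t k, of "x t" "\<omega> t + e t" "z t"]
        control_input_entry[OF xt \<omega>t e, of "z t"] True kr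
      by (simp del: index_mult_mat_vec pow_mat.simps)
    then have "\<epsilon> ^ k * ((C * A ^\<^sub>m k *\<^sub>v (A *\<^sub>v x t + B *\<^sub>v ?u + E *\<^sub>v \<omega> t)) $ 0 - (X1_row A C E S k *\<^sub>v (S *\<^sub>v \<omega> t)) $ 0
       - (if k = 0 then dz t else 0))
      = \<epsilon> ^ k * (- (\<Sum>k<r. c k * ?s k) / \<epsilon> ^ r + g * (K2 A B C E S r c \<epsilon> *\<^sub>v e t) $ 0
       - (if k = 0 then dz t else 0))"
      by (simp only:)
    also have "\<dots> = - (\<Sum>k<r. c k * ?s k) * (\<epsilon> ^ k / \<epsilon> ^ r) + \<epsilon> ^ k * (g * (K2 A B C E S r c \<epsilon> *\<^sub>v e t) $ 0)
        - \<epsilon> ^ k * (if k = 0 then dz t else 0)"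
      by (simp add: algebra_simps del: index_mult_mat_vec)
    finally show ?thesis unfolding pe using True by (simp add: companion_def del: index_mult_mat_vec)
  next
    case False
    have "(C * A ^\<^sub>m k *\<^sub>v (A *\<^sub>v x t + B *\<^sub>v ?u + E *\<^sub>v \<omega> t)) $ 0 - (X1_row A C E S k *\<^sub>v (S *\<^sub>v \<omega> t)) $ 0
       = (C * A ^\<^sub>m Suc k *\<^sub>v x t) $ 0 - (X1_row A C E S (Suc k) *\<^sub>v \<omega> t) $ 0"
      using CA_dynamics[OF xt control_input_carrier \<omega>t k, of "x t" "\<omega> t + e t" "z t"]
        row_Suc[OF \<omega>t, of k] False
      by (simp del: index_mult_mat_vec pow_mat.simps X1_row.simps)
    then show ?thesis
      using False \<epsilon> by (simp add: companion_def scaled_error_def right_diff_distrib diff_divide_distrib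
          del: index_mult_mat_vec pow_mat.simps X1_row.simps)
  qed
  ultimately show ?thesis by simp
qed

lemma agent_output_eq:
  assumes "x \<in> carrier_vec n" "\<omega> \<in> carrier_vec q"
  shows "agent_output C x = scaled_error A C E S \<epsilon> x \<omega> z 0 + z"
proof -
  have "(0\<^sub>m 1 (dim_row S) *\<^sub>v \<omega>) $ 0 = 0"
    using mult_mat_vec_entry[of "0\<^sub>m 1 (dim_row S)" 1 q \<omega> 0] assms(2) S by (simp del: index_mult_mat_vec)
  moreover have "C * 1\<^sub>m (dim_row A) = C" using C A by simp
  ultimately show ?thesis by (simp add: agent_output_def scaled_error_def del: index_mult_mat_vec)
qed

text \<open>The observer is a Luenberger observer for \<open>\<omega>\<close> in a form that avoids
  differentiating \<open>x\<close>: adding \<open>L x\<close> brings in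
  \<open>L A x + L B u + L E \<omega>\<close>, the terms in \<open>A\<close> and \<open>B\<close>
  cancel against those of the observer equation, and the rest combines into \<open>S - L E\<close>
  applied to the error. The input may be arbitrary.\<close>

lemma observer_error_deriv:
  assumes x_ode: "vec_ode n x (\<lambda>t. A *\<^sub>v x t + B *\<^sub>v u t + E *\<^sub>v \<omega> t)"
    and u: "\<And>t. u t \<in> carrier_vec 1"
    and \<omega>_ode: "vec_ode q \<omega> (\<lambda>t. S *\<^sub>v \<omega> t)"
    and \<eta>_ode: "vec_ode q \<eta>b (\<lambda>t. (S - L * E) *\<^sub>v \<eta>b t + (S * L - L * E * L - L * A) *\<^sub>v x t - L * B *\<^sub>v u t)"
    and i: "i < q" and t: "t \<ge> 0"
  shows "((\<lambda>\<tau>. (\<eta>b \<tau> + L *\<^sub>v x \<tau> - \<omega> \<tau>) $ i) has_real_derivative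
     (\<Sum>j<q. (S - L * E) $$ (i, j) * (\<eta>b t + L *\<^sub>v x t - \<omega> t) $ j)) (at t within {0..})"
proof -
  have carr: "x \<tau> \<in> carrier_vec n" "\<omega> \<tau> \<in> carrier_vec q" "\<eta>b \<tau> \<in> carrier_vec q" if "\<tau> \<ge> 0" for \<tau>
    using x_ode \<omega>_ode \<eta>_ode that by (auto simp: vec_ode_def)
  note ct = carr[OF t] u[of t]
  let ?d\<eta> = "(S - L * E) *\<^sub>v \<eta>b t + (S * L - L * E * L - L * A) *\<^sub>v x t - L * B *\<^sub>v u t"
  let ?dx = "A *\<^sub>v x t + B *\<^sub>v u t + E *\<^sub>v \<omega> t"
  let ?e = "\<eta>b t + L *\<^sub>v x t - \<omega> t"
  have "((\<lambda>\<tau>. \<eta>b \<tau> $ i + (L *\<^sub>v x \<tau>) $ i - \<omega> \<tau> $ i) has_real_derivative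
      ?d\<eta> $ i + (L *\<^sub>v ?dx) $ i - (S *\<^sub>v \<omega> t) $ i) (at t within {0..})"
    using \<eta>_ode \<omega>_ode i t
    by (intro DERIV_diff DERIV_add vec_ode_mult_mat_entry[OF x_ode L i t]) (auto simp: vec_ode_def)
  moreover have "?d\<eta> $ i + (L *\<^sub>v ?dx) $ i - (S *\<^sub>v \<omega> t) $ i = ((S - L * E) *\<^sub>v ?e) $ i"
  proof -
    have LE: "L * E \<in> carrier_mat q q" and SL: "S * L \<in> carrier_mat q n"
      and LA: "L * A \<in> carrier_mat q n" and LEL: "L * E * L \<in> carrier_mat q n"
      using L E S A by auto
    have Lx: "L *\<^sub>v x t \<in> carrier_vec q" using L ct by simp
    have d1: "((S - L * E) *\<^sub>v w) $ i = (S *\<^sub>v w) $ i - (L *\<^sub>v (E *\<^sub>v w)) $ i" if w: "w \<in> carrier_vec q" for w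
      using minus_mult_distrib_mat_vec[OF S LE w] assoc_mult_mat_vec[OF L E w] L i
      by (simp del: index_mult_mat_vec)
    have d2: "((S * L - L * E * L - L * A) *\<^sub>v x t) $ i
        = (S *\<^sub>v (L *\<^sub>v x t)) $ i - (L *\<^sub>v (E *\<^sub>v (L *\<^sub>v x t))) $ i - (L *\<^sub>v (A *\<^sub>v x t)) $ i"
      using minus_mult_distrib_mat_vec[OF minus_carrier_mat[OF LEL] LA ct(1), of "S * L"]
        minus_mult_distrib_mat_vec[OF SL LEL ct(1)]
        assoc_mult_mat_vec[OF S L ct(1)] assoc_mult_mat_vec[OF LE L ct(1)] assoc_mult_mat_vec[OF L E Lx]
        assoc_mult_mat_vec[OF L A ct(1)] L i
      by (simp del: index_mult_mat_vec assoc_mult_mat_vec)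
    have d3: "L * B *\<^sub>v u t = L *\<^sub>v (B *\<^sub>v u t)"
      by (rule assoc_mult_mat_vec[OF L B ct(4)])
    have cx: "A *\<^sub>v x t \<in> carrier_vec n" "B *\<^sub>v u t \<in> carrier_vec n" "E *\<^sub>v w \<in> carrier_vec n"
      if "w \<in> carrier_vec q" for w using A B E ct that by auto
    have d4: "(L *\<^sub>v ?dx) $ i = (L *\<^sub>v (A *\<^sub>v x t)) $ i + (L *\<^sub>v (B *\<^sub>v u t)) $ i + (L *\<^sub>v (E *\<^sub>v \<omega> t)) $ i"
      using mult_add_distrib_mat_vec[OF L, of "A *\<^sub>v x t + B *\<^sub>v u t" "E *\<^sub>v \<omega> t"]
        mult_add_distrib_mat_vec[OF L, of "A *\<^sub>v x t" "B *\<^sub>v u t"] cx[OF ct(2)] L i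
      by (simp del: index_mult_mat_vec)
    have d5: "M *\<^sub>v ?e = M *\<^sub>v \<eta>b t + M *\<^sub>v (L *\<^sub>v x t) - M *\<^sub>v \<omega> t" if M: "M \<in> carrier_mat m q" for M :: "real mat" and m
      using mult_minus_distrib_mat_vec[OF M, of "\<eta>b t + L *\<^sub>v x t" "\<omega> t"]
        mult_add_distrib_mat_vec[OF M, of "\<eta>b t" "L *\<^sub>v x t"] ct Lx by simp
    have e: "?e \<in> carrier_vec q" using ct Lx by simp
    have d6: "(M *\<^sub>v ?e) $ i = (M *\<^sub>v \<eta>b t) $ i + (M *\<^sub>v (L *\<^sub>v x t)) $ i - (M *\<^sub>v \<omega> t) $ i" if M: "M \<in> carrier_mat q q" for M
      unfolding d5[OF M] using M i by (simp del: index_mult_mat_vec)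
    have d7: "(L *\<^sub>v (E *\<^sub>v ?e)) $ i = (L *\<^sub>v (E *\<^sub>v \<eta>b t)) $ i + (L *\<^sub>v (E *\<^sub>v (L *\<^sub>v x t))) $ i - (L *\<^sub>v (E *\<^sub>v \<omega> t)) $ i"
      using d6[OF LE] assoc_mult_mat_vec[OF L E e] assoc_mult_mat_vec[OF L E ct(3)]
        assoc_mult_mat_vec[OF L E Lx] assoc_mult_mat_vec[OF L E ct(2)] by simp
    have d8: "?d\<eta> $ i = ((S - L * E) *\<^sub>v \<eta>b t) $ i + ((S * L - L * E * L - L * A) *\<^sub>v x t) $ i - (L *\<^sub>v (B *\<^sub>v u t)) $ i"
      unfolding d3 using L A i by (simp del: index_mult_mat_vec)
    show ?thesis
      unfolding d8 d1[OF e] d1[OF ct(3)] d2 d4 d6[OF S] d7 by simp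
  qed
  ultimately have der: "((\<lambda>\<tau>. \<eta>b \<tau> $ i + (L *\<^sub>v x \<tau>) $ i - \<omega> \<tau> $ i) has_real_derivative
      ((S - L * E) *\<^sub>v ?e) $ i) (at t within {0..})" by simp
  have "S - L * E \<in> carrier_mat q q" using L E by (intro minus_carrier_mat) simp
  moreover have "?e \<in> carrier_vec q" using ct L by simp
  ultimately have "((S - L * E) *\<^sub>v ?e) $ i = (\<Sum>j<q. (S - L * E) $$ (i, j) * ?e $ j)"
    using i by (rule mult_mat_vec_entry)
  with der have "((\<lambda>\<tau>. \<eta>b \<tau> $ i + (L *\<^sub>v x \<tau>) $ i - \<omega> \<tau> $ i) has_real_derivative
      (\<Sum>j<q. (S - L * E) $$ (i, j) * ?e $ j)) (at t within {0..})" by simp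
  then show ?thesis
    by (rule has_field_derivative_transform_within[of _ _ _ _ 1])
      (use t i in \<open>auto simp: minus_vec_entry[OF carr(2)] add_vec_entry[OF mult_mat_vec_carrier[OF L carr(1)]]
        simp del: index_mult_mat_vec\<close>)
qed

end

subsection \<open>Lyapunov function of the closed loop\<close>

lemma qform_divide_add: "qform n P x (\<lambda>k. y k / s + w k) = qform n P x y / s + qform n P x w"
  by (simp add: qform_def sum.distrib sum_divide_distrib distrib_left)

text \<open>Only the companion part carries \<open>1 / \<epsilon>\<close>; the perturbations
  \<open>b\<close> (observer error, last component) and \<open>w\<close> (the derivative of
  \<open>z\<close>, first component) do not. For \<open>r = 1\<close> both hit the same component,
  hence the factor 2 in front of their squares.\<close>

lemma fast_rate:
  assumes r: "r > 0" and \<epsilon>: "\<epsilon> > 0" and \<theta>: "\<theta> > 0" and K: "K > 0"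
    and dec: "\<And>x. 2 * qform r P x (companion r c x) \<le> - sqn r x"
    and young: "\<And>x y. 2 * qform r P x y \<le> \<theta> * sqn r x + K / \<theta> * sqn r y"
  shows "2 * qform r P \<zeta> (\<lambda>k. companion r c \<zeta> k / \<epsilon> + ((if Suc k = r then b else 0) - (if k = 0 then w else 0)))
    \<le> (\<theta> - 1 / \<epsilon>) * sqn r \<zeta> + 2 * (K / \<theta>) * (b\<^sup>2 + w\<^sup>2)"
proof -
  let ?y = "\<lambda>k. (if Suc k = r then b else 0) - (if k = 0 then w else 0)"
  have "sqn r ?y \<le> (\<Sum>k<r. (if k = r - 1 then 2 * b\<^sup>2 else 0) + (if k = 0 then 2 * w\<^sup>2 else 0))"
    unfolding sqn_def
  proof (rule sum_mono)
    fix k assume "k \<in> {..<r}"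
    have "(b - w)\<^sup>2 \<le> 2 * b\<^sup>2 + 2 * w\<^sup>2"
      using zero_le_power2[of "b + w"] by (simp add: power2_eq_square algebra_simps)
    then show "(?y k)\<^sup>2 \<le> (if k = r - 1 then 2 * b\<^sup>2 else 0) + (if k = 0 then 2 * w\<^sup>2 else 0)"
      using r by auto
  qed
  also have "\<dots> = 2 * b\<^sup>2 + 2 * w\<^sup>2" using r by (simp add: sum.distrib)
  finally have "K / \<theta> * sqn r ?y \<le> K / \<theta> * (2 * b\<^sup>2 + 2 * w\<^sup>2)"
    using K \<theta> by (intro mult_left_mono) auto
  moreover have "2 * qform r P \<zeta> (companion r c \<zeta>) / \<epsilon> \<le> - sqn r \<zeta> / \<epsilon>"
    using dec \<epsilon> by (intro divide_right_mono) auto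
  ultimately show ?thesis
    using young[of \<zeta> ?y] unfolding qform_divide_add by (simp add: algebra_simps)
qed

definition energy where
  "energy (N::nat) r q \<delta> \<Gamma> P R z l v \<zeta> e =
     (\<Sum>i=1..N. ((z i)\<^sup>2 + (l i)\<^sup>2 + (v i)\<^sup>2) / 2 - \<delta> * (z i * l i) + \<delta> * (l i * v i)
        + qform (r i) (P i) (\<zeta> i) (\<zeta> i) + \<Gamma> * qform (q i) (R i) (e i) (e i) :: real)"

lemma energy_cong:
  assumes "\<And>i. i \<in> {1..N} \<Longrightarrow> z i = z' i \<and> l i = l' i \<and> v i = v' i \<and> \<zeta> i = \<zeta>' i \<and> e i = e' i"
  shows "energy N r q \<delta> \<Gamma> P R z l v \<zeta> e = energy N r q \<delta> \<Gamma> P R z' l' v' \<zeta>' e'"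
  unfolding energy_def using assms by (intro sum.cong) auto

text \<open>For \<open>\<delta> \<le> 1 / 4\<close> the two cross terms together are at most a
  quarter of the sum of squares, so the modified energy stays equivalent to it.\<close>

lemma cross_term_bounds:
  fixes z l v \<delta> :: real
  assumes "0 < \<delta>" "\<delta> \<le> 1 / 4"
  shows "(z\<^sup>2 + l\<^sup>2 + v\<^sup>2) / 4 \<le> (z\<^sup>2 + l\<^sup>2 + v\<^sup>2) / 2 - \<delta> * (z * l) + \<delta> * (l * v)"
    and "(z\<^sup>2 + l\<^sup>2 + v\<^sup>2) / 2 - \<delta> * (z * l) + \<delta> * (l * v) \<le> z\<^sup>2 + l\<^sup>2 + v\<^sup>2"
proof -
  have "\<bar>z * l\<bar> \<le> (z\<^sup>2 + l\<^sup>2) / 2" "\<bar>l * v\<bar> \<le> (l\<^sup>2 + v\<^sup>2) / 2"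
    using sum_squares_bound[of "\<bar>z\<bar>" "\<bar>l\<bar>"] sum_squares_bound[of "\<bar>l\<bar>" "\<bar>v\<bar>"] by (simp_all add: abs_mult)
  then have "\<delta> * \<bar>z * l\<bar> \<le> 1 / 4 * ((z\<^sup>2 + l\<^sup>2) / 2)" "\<delta> * \<bar>l * v\<bar> \<le> 1 / 4 * ((l\<^sup>2 + v\<^sup>2) / 2)"
    using assms by (intro mult_mono; simp)+
  moreover have "\<bar>\<delta> * (z * l)\<bar> = \<delta> * \<bar>z * l\<bar>" "\<bar>\<delta> * (l * v)\<bar> = \<delta> * \<bar>l * v\<bar>"
    using assms by (simp_all add: abs_mult)
  ultimately have "\<bar>\<delta> * (z * l)\<bar> + \<bar>\<delta> * (l * v)\<bar> \<le> (z\<^sup>2 + l\<^sup>2) / 8 + (l\<^sup>2 + v\<^sup>2) / 8"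
    by linarith
  moreover have "0 \<le> z\<^sup>2" "0 \<le> l\<^sup>2" "0 \<le> v\<^sup>2" by auto
  ultimately show "(z\<^sup>2 + l\<^sup>2 + v\<^sup>2) / 4 \<le> (z\<^sup>2 + l\<^sup>2 + v\<^sup>2) / 2 - \<delta> * (z * l) + \<delta> * (l * v)"
    and "(z\<^sup>2 + l\<^sup>2 + v\<^sup>2) / 2 - \<delta> * (z * l) + \<delta> * (l * v) \<le> z\<^sup>2 + l\<^sup>2 + v\<^sup>2"
    by argo+
qed

lemma qform_ge_square:
  assumes "\<And>x. sqn n x \<le> qform n P x x" "k < n"
  shows "(x k)\<^sup>2 \<le> qform n P x x"
proof -
  have "(x k)\<^sup>2 \<le> sqn n x"
    unfolding sqn_def using assms(2) by (intro member_le_sum) auto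
  with assms(1)[of x] show ?thesis by simp
qed

context weighted_graph
begin

text \<open>The parameters are chosen in the order \<open>\<delta>\<close>, \<open>\<epsilon>star\<close>, \<open>\<epsilon>\<close>, \<open>\<Gamma>\<close>: the bound \<open>G\<close> on the gain from the
  observer error to the fast subsystem may depend on \<open>\<epsilon>\<close>, and the weight \<open>\<Gamma>\<close> then compensates it.\<close>

lemma energy_dissipation:
  assumes m: "0 < m" and H: "0 < H" and r: "\<And>i. i \<in> {1..N} \<Longrightarrow> r i > 0"
    and P: "\<And>i x. i \<in> {1..N} \<Longrightarrow> 2 * qform (r i) (P i) x (companion (r i) (c i) x) \<le> - sqn (r i) x"
    and R: "\<And>i x. i \<in> {1..N} \<Longrightarrow> 2 * qform (q i) (R i) x (F i x) \<le> - sqn (q i) x"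
  shows "\<exists>\<delta> \<epsilon>star. 0 < \<delta> \<and> \<delta> \<le> 1 / 4 \<and> 0 < \<epsilon>star \<and>
    (\<forall>\<epsilon> G. 0 < \<epsilon> \<longrightarrow> \<epsilon> < \<epsilon>star \<longrightarrow> 0 < G \<longrightarrow>
      (\<exists>\<Gamma> \<mu>. 0 < \<Gamma> \<and> 0 < \<mu> \<and> (\<forall>z l v \<zeta> e h b.
        (\<forall>i\<in>{1..N}. m \<le> h i \<and> h i \<le> H) \<and> (\<Sum>i=1..N. v i) = 0 \<and>
        (\<forall>i\<in>{1..N}. (b i)\<^sup>2 \<le> G * sqn (q i) (e i)) \<longrightarrow>
        (\<Sum>i=1..N. slow_rate \<delta> (z i) (l i) (v i)
            (- h i * (z i + \<zeta> i 0) + l i) (- nd l i - nd v i - z i) (nd l i)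
          + 2 * qform (r i) (P i) (\<zeta> i) (\<lambda>k. companion (r i) (c i) (\<zeta> i) k / \<epsilon>
              + ((if Suc k = r i then b i else 0) - (if k = 0 then - h i * (z i + \<zeta> i 0) + l i else 0)))
          + \<Gamma> * (2 * qform (q i) (R i) (e i) (F i (e i))))
        \<le> - (2 * \<mu>) * energy N r q \<delta> \<Gamma> P R z l v \<zeta> e)))"
proof -
  obtain \<delta> \<alpha> C where \<delta>: "0 < \<delta>" "\<delta> \<le> 1 / 4" and \<alpha>: "0 < \<alpha>" and C: "0 < C"
    and slow: "\<And>z l v s h. (\<forall>i\<in>{1..N}. m \<le> h i \<and> h i \<le> H) \<Longrightarrow> (\<Sum>i=1..N. v i) = 0 \<Longrightarrow>
      (\<Sum>i=1..N. slow_rate \<delta> (z i) (l i) (v i)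
          (- h i * (z i + s i) + l i) (- nd l i - nd v i - z i) (nd l i))
      \<le> - \<alpha> * (\<Sum>i=1..N. (z i)\<^sup>2 + (l i)\<^sup>2 + (v i)\<^sup>2) + C * (\<Sum>i=1..N. (s i)\<^sup>2)"
    using slow_dissipation[OF m H] by blast
  have "\<forall>i. \<exists>K>0. \<forall>\<theta>>0. \<forall>x y. 2 * qform (r i) (P i) x y \<le> \<theta> * sqn (r i) x + K / \<theta> * sqn (r i) y"
    using qform_young by blast
  from choice[OF this] obtain K' where K': "\<And>i. K' i > 0"
    "\<And>i \<theta> x y. \<theta> > 0 \<Longrightarrow> 2 * qform (r i) (P i) x y \<le> \<theta> * sqn (r i) x + K' i / \<theta> * sqn (r i) y"
    by blast
  obtain K where K: "K > 0" "\<And>i. i \<in> {1..N} \<Longrightarrow> K' i \<le> K"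
    using finite_uniform_upper[of "{1..N}" K'] by auto
  have young: "2 * qform (r i) (P i) x y \<le> \<theta> * sqn (r i) x + K / \<theta> * sqn (r i) y"
    if "i \<in> {1..N}" "\<theta> > 0" for i \<theta> x y
  proof -
    have "K' i / \<theta> * sqn (r i) y \<le> K / \<theta> * sqn (r i) y"
      using K(2)[OF that(1)] that(2) by (intro mult_right_mono divide_right_mono) auto
    then show ?thesis using K'(2)[OF that(2), of i x y] by linarith
  qed
  \<comment> \<open>The derivative of \<open>z\<close> is a sum of three terms, so its square is at
    most \<open>3 * (H^2 + 1)\<close> times the sum of the squared slow and fast states. With this
    \<open>\<theta>\<close> the perturbation of the fast subsystem costs the slow one only
    \<open>\<alpha> / 2\<close>, half of its decay.\<close>
  define \<theta> where "\<theta> = 12 * K * (H\<^sup>2 + 1) / \<alpha>"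
  have "2 * (K / (12 * K * J / \<alpha>)) * (3 * J) = \<alpha> / 2" "12 * K * J / \<alpha> > 0" if "J > 0" for J
    using that K(1) \<alpha> by (auto simp: field_simps)
  moreover have "H\<^sup>2 + 1 > 0" by (simp add: add_nonneg_pos)
  ultimately have \<theta>: "\<theta> > 0" "2 * (K / \<theta>) * (3 * (H\<^sup>2 + 1)) = \<alpha> / 2"
    unfolding \<theta>_def by blast+
  \<comment> \<open>The fast decay \<open>1 / \<epsilon>\<close> has to cover the Young term
    \<open>\<theta>\<close>, the part \<open>\<alpha> / 2\<close> of the derivative of
    \<open>z\<close> that comes from the fast state itself, and the disturbance \<open>C\<close> of
    the slow subsystem; the summand 1 is the margin that is left.\<close>
  define \<epsilon>star where "\<epsilon>star = 1 / (\<theta> + \<alpha> / 2 + C + 1)"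
  have den: "\<theta> + \<alpha> / 2 + C + 1 > 0" using \<theta> \<alpha> C by simp
  have \<epsilon>star: "\<epsilon>star > 0" using den by (simp add: \<epsilon>star_def)
  have main: "\<exists>\<Gamma> \<mu>. 0 < \<Gamma> \<and> 0 < \<mu> \<and> (\<forall>z l v \<zeta> e h b.
        (\<forall>i\<in>{1..N}. m \<le> h i \<and> h i \<le> H) \<and> (\<Sum>i=1..N. v i) = 0 \<and>
        (\<forall>i\<in>{1..N}. (b i)\<^sup>2 \<le> G * sqn (q i) (e i)) \<longrightarrow>
        (\<Sum>i=1..N. slow_rate \<delta> (z i) (l i) (v i)
            (- h i * (z i + \<zeta> i 0) + l i) (- nd l i - nd v i - z i) (nd l i)
          + 2 * qform (r i) (P i) (\<zeta> i) (\<lambda>k. companion (r i) (c i) (\<zeta> i) k / \<epsilon>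
              + ((if Suc k = r i then b i else 0) - (if k = 0 then - h i * (z i + \<zeta> i 0) + l i else 0)))
          + \<Gamma> * (2 * qform (q i) (R i) (e i) (F i (e i))))
        \<le> - (2 * \<mu>) * energy N r q \<delta> \<Gamma> P R z l v \<zeta> e)"
    if \<epsilon>: "0 < \<epsilon>" "\<epsilon> < \<epsilon>star" and G: "0 < G" for \<epsilon> G
  proof -
    have "1 / \<epsilon> \<ge> 1 / \<epsilon>star" using \<epsilon> by (intro divide_left_mono) auto
    then have inv\<epsilon>: "\<theta> + \<alpha> / 2 + C + 1 \<le> 1 / \<epsilon>" by (simp add: \<epsilon>star_def)
    \<comment> \<open>The first summand pays for the effect of the observer error on the fast
      subsystem, and the summand 1 remains as its decay.\<close>
    define \<Gamma> where "\<Gamma> = 2 * (K / \<theta>) * G + 1"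
    have \<Gamma>: "\<Gamma> > 0" using K \<theta> G by (simp add: \<Gamma>_def add_pos_pos)
    have "\<forall>i. \<exists>M>0. \<forall>x. qform (q i) (R i) x x \<le> M * sqn (q i) x" using qform_upper by blast
    from choice[OF this] obtain M1 where M1: "\<And>i x. qform (q i) (R i) x x \<le> M1 i * sqn (q i) x" by blast
    obtain MR where MR: "MR > 0" "\<And>i. i \<in> {1..N} \<Longrightarrow> M1 i \<le> MR"
      using finite_uniform_upper[of "{1..N}" M1] by auto
    have "\<forall>i. \<exists>M>0. \<forall>x. qform (r i) (P i) x x \<le> M * sqn (r i) x" using qform_upper by blast
    from choice[OF this] obtain M2 where M2: "\<And>i x. qform (r i) (P i) x x \<le> M2 i * sqn (r i) x" by blast
    obtain MP where MP: "MP > 0" "\<And>i. i \<in> {1..N} \<Longrightarrow> M2 i \<le> MP"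
      using finite_uniform_upper[of "{1..N}" M2] by auto
    define M where "M = 1 + MP + \<Gamma> * MR"
    have M: "M > 0" "1 \<le> M" "MP \<le> M" "\<Gamma> * MR \<le> M" using MP MR \<Gamma> by (auto simp: M_def add_pos_pos)
    define \<beta> where "\<beta> = min (\<alpha> / 2) 1"
    have \<beta>: "\<beta> > 0" "\<beta> \<le> \<alpha> / 2" "\<beta> \<le> 1" using \<alpha> by (auto simp: \<beta>_def)
    \<comment> \<open>\<open>\<beta>\<close> is the decay relative to the sum of squares, and
      \<open>M\<close> times that sum bounds the energy. The energy decays at rate
      \<open>2 * \<mu>\<close>, so that its square root, which controls the output, decays at rate
      \<open>\<mu>\<close>.\<close>
    define \<mu> where "\<mu> = \<beta> / (2 * M)"
    have \<mu>: "\<mu> > 0" "2 * \<mu> * M = \<beta>" using \<beta> M by (auto simp: \<mu>_def)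
    have rate: "(\<Sum>i=1..N. slow_rate \<delta> (z i) (l i) (v i)
            (- h i * (z i + \<zeta> i 0) + l i) (- nd l i - nd v i - z i) (nd l i)
          + 2 * qform (r i) (P i) (\<zeta> i) (\<lambda>k. companion (r i) (c i) (\<zeta> i) k / \<epsilon>
              + ((if Suc k = r i then b i else 0) - (if k = 0 then - h i * (z i + \<zeta> i 0) + l i else 0)))
          + \<Gamma> * (2 * qform (q i) (R i) (e i) (F i (e i))))
        \<le> - (2 * \<mu>) * energy N r q \<delta> \<Gamma> P R z l v \<zeta> e"
      if h: "\<forall>i\<in>{1..N}. m \<le> h i \<and> h i \<le> H" and v: "(\<Sum>i=1..N. v i) = 0"
        and b: "\<forall>i\<in>{1..N}. (b i)\<^sup>2 \<le> G * sqn (q i) (e i)" for z l v \<zeta> e h b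
    proof -
      let ?X = "\<lambda>i. (z i)\<^sup>2 + (l i)\<^sup>2 + (v i)\<^sup>2"
      let ?Z = "\<lambda>i. sqn (r i) (\<zeta> i)" and ?E = "\<lambda>i. sqn (q i) (e i)"
      let ?slow = "\<lambda>i. slow_rate \<delta> (z i) (l i) (v i)
            (- h i * (z i + \<zeta> i 0) + l i) (- nd l i - nd v i - z i) (nd l i)"
      let ?fast = "\<lambda>i. 2 * qform (r i) (P i) (\<zeta> i) (\<lambda>k. companion (r i) (c i) (\<zeta> i) k / \<epsilon>
              + ((if Suc k = r i then b i else 0) - (if k = 0 then - h i * (z i + \<zeta> i 0) + l i else 0)))"
      let ?obs = "\<lambda>i. \<Gamma> * (2 * qform (q i) (R i) (e i) (F i (e i)))"
      have distrib4: "u * (w1 * w2 + w3 * w4) = u * w1 * w2 + u * w3 * w4" for u w1 w2 w3 w4 :: real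
        by (simp add: distrib_left)
      have s: "(\<zeta> i 0)\<^sup>2 \<le> ?Z i" if "i \<in> {1..N}" for i
        unfolding sqn_def using r[OF that] by (intro member_le_sum) auto
      have fast: "?fast i \<le> (\<theta> + \<alpha> / 2 - 1 / \<epsilon>) * ?Z i + \<alpha> / 2 * ?X i + 2 * (K / \<theta>) * G * ?E i"
        if i: "i \<in> {1..N}" for i
      proof -
        let ?w = "- h i * (z i + \<zeta> i 0) + l i"
        have "?fast i \<le> (\<theta> - 1 / \<epsilon>) * ?Z i + 2 * (K / \<theta>) * ((b i)\<^sup>2 + ?w\<^sup>2)"
          using fast_rate[OF r[OF i] \<epsilon>(1) \<theta>(1) K(1) P[OF i] young[OF i \<theta>(1)]] .
        moreover have "2 * (K / \<theta>) * ((b i)\<^sup>2 + ?w\<^sup>2)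
            \<le> 2 * (K / \<theta>) * (G * ?E i + 3 * (H\<^sup>2 + 1) * (?X i + ?Z i))"
        proof (intro mult_left_mono add_mono)
          have "?w\<^sup>2 \<le> 3 * (h i * z i)\<^sup>2 + 3 * (h i * \<zeta> i 0)\<^sup>2 + 3 * (l i)\<^sup>2"
            using zero_le_power2[of "h i * z i - h i * \<zeta> i 0"] zero_le_power2[of "h i * z i + l i"]
              zero_le_power2[of "h i * \<zeta> i 0 + l i"]
            by (simp add: power2_eq_square algebra_simps)
          also have "\<dots> \<le> 3 * (H\<^sup>2 * (z i)\<^sup>2) + 3 * (H\<^sup>2 * (\<zeta> i 0)\<^sup>2) + 3 * (l i)\<^sup>2"
            using h[rule_format, OF i] m unfolding power_mult_distrib
            by (intro add_mono mult_left_mono mult_right_mono power_mono) auto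
          also have "\<dots> \<le> 3 * (H\<^sup>2 + 1) * (?X i + (\<zeta> i 0)\<^sup>2)"
            by (simp add: algebra_simps add_nonneg_nonneg)
          also have "\<dots> \<le> 3 * (H\<^sup>2 + 1) * (?X i + ?Z i)"
            using s[OF i] by (intro mult_left_mono add_left_mono) (auto simp: add_nonneg_nonneg)
          finally show "?w\<^sup>2 \<le> 3 * (H\<^sup>2 + 1) * (?X i + ?Z i)" .
        qed (use b i K \<theta> in auto)
        moreover have "2 * (K / \<theta>) * (G * ?E i + 3 * (H\<^sup>2 + 1) * (?X i + ?Z i))
            = 2 * (K / \<theta>) * G * ?E i + 2 * (K / \<theta>) * (3 * (H\<^sup>2 + 1)) * (?X i + ?Z i)"
          by (rule distrib4)
        ultimately show ?thesis unfolding \<theta>(2) by (simp add: algebra_simps)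
      qed
      have obs: "?obs i \<le> - \<Gamma> * ?E i" if "i \<in> {1..N}" for i
        using mult_left_mono[OF R[OF that, of "e i"], of \<Gamma>] \<Gamma> by simp
      have "(\<Sum>i=1..N. ?slow i + ?fast i + ?obs i) = (\<Sum>i=1..N. ?slow i) + (\<Sum>i=1..N. ?fast i + ?obs i)"
        by (simp add: sum.distrib)
      also have "\<dots> \<le> (- \<alpha> * (\<Sum>i=1..N. ?X i) + C * (\<Sum>i=1..N. (\<zeta> i 0)\<^sup>2))
          + (\<Sum>i=1..N. (\<theta> + \<alpha> / 2 - 1 / \<epsilon>) * ?Z i + \<alpha> / 2 * ?X i + 2 * (K / \<theta>) * G * ?E i + - \<Gamma> * ?E i)"
        using fast obs by (intro add_mono slow[OF h v] sum_mono) auto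
      also have "\<dots> \<le> (- \<alpha> * (\<Sum>i=1..N. ?X i) + C * (\<Sum>i=1..N. ?Z i))
          + (\<Sum>i=1..N. (\<theta> + \<alpha> / 2 - 1 / \<epsilon>) * ?Z i + \<alpha> / 2 * ?X i + 2 * (K / \<theta>) * G * ?E i + - \<Gamma> * ?E i)"
        using C s by (intro add_right_mono add_left_mono mult_left_mono sum_mono) auto
      also have "\<dots> = (\<Sum>i=1..N. - (\<alpha> / 2) * ?X i + (\<theta> + \<alpha> / 2 + C - 1 / \<epsilon>) * ?Z i - ?E i)"
        unfolding sum_distrib_left sum.distrib[symmetric]
        by (intro sum.cong refl) (simp add: \<Gamma>_def algebra_simps)
      also have "\<dots> \<le> (\<Sum>i=1..N. - (2 * \<mu>) * (M * (?X i + ?Z i + ?E i)))"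
      proof (rule sum_mono)
        fix i assume "i \<in> {1..N}"
        have "\<beta> * ?X i \<le> \<alpha> / 2 * ?X i"
          using \<beta> by (intro mult_right_mono) auto
        moreover have "\<beta> * ?E i \<le> 1 * ?E i"
          using \<beta> by (intro mult_right_mono) auto
        moreover have "(\<theta> + \<alpha> / 2 + C - 1 / \<epsilon>) * ?Z i \<le> - \<beta> * ?Z i"
          using \<beta> inv\<epsilon> by (intro mult_right_mono) auto
        ultimately have "- (\<alpha> / 2) * ?X i + (\<theta> + \<alpha> / 2 + C - 1 / \<epsilon>) * ?Z i - ?E i
            \<le> - (\<beta> * ?X i) + - \<beta> * ?Z i - \<beta> * ?E i"
          by linarith
        also have "\<dots> = - (2 * \<mu> * M) * (?X i + ?Z i + ?E i)"
          unfolding \<mu>(2) by (simp add: algebra_simps)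
        finally show "- (\<alpha> / 2) * ?X i + (\<theta> + \<alpha> / 2 + C - 1 / \<epsilon>) * ?Z i - ?E i
            \<le> - (2 * \<mu>) * (M * (?X i + ?Z i + ?E i))"
          by (simp only: mult.assoc mult_minus_left)
      qed
      also have "\<dots> = - (2 * \<mu>) * (\<Sum>i=1..N. M * (?X i + ?Z i + ?E i))"
        by (simp only: sum_distrib_left)
      also have "\<dots> \<le> - (2 * \<mu>) * energy N r q \<delta> \<Gamma> P R z l v \<zeta> e"
      proof -
        have "energy N r q \<delta> \<Gamma> P R z l v \<zeta> e \<le> (\<Sum>i=1..N. M * (?X i + ?Z i + ?E i))"
          unfolding energy_def
        proof (rule sum_mono)
          fix i assume i: "i \<in> {1..N}"
          have "1 * ?X i \<le> M * ?X i" using M by (intro mult_right_mono) auto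
          moreover have "M2 i * ?Z i \<le> M * ?Z i" using M MP(2)[OF i] by (intro mult_right_mono) auto
          moreover have "\<Gamma> * (M1 i * ?E i) \<le> M * ?E i"
          proof -
            have "\<Gamma> * (M1 i * ?E i) \<le> \<Gamma> * (MR * ?E i)"
              using MR(2)[OF i] \<Gamma> by (intro mult_left_mono mult_right_mono) auto
            also have "\<dots> \<le> M * ?E i"
              unfolding mult.assoc[symmetric] using M by (intro mult_right_mono) auto
            finally show ?thesis .
          qed
          moreover have "\<Gamma> * qform (q i) (R i) (e i) (e i) \<le> \<Gamma> * (M1 i * ?E i)"
            using M1 \<Gamma> by (intro mult_left_mono) auto
          ultimately show "?X i / 2 - \<delta> * (z i * l i) + \<delta> * (l i * v i)
              + qform (r i) (P i) (\<zeta> i) (\<zeta> i) + \<Gamma> * qform (q i) (R i) (e i) (e i)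
              \<le> M * (?X i + ?Z i + ?E i)"
            using cross_term_bounds(2)[OF \<delta>, of "z i" "l i" "v i"] M2[of i "\<zeta> i"]
            by (simp add: distrib_left) 
        qed
        then show ?thesis using \<mu> by simp
      qed
      finally show ?thesis .
    qed
    show ?thesis
      using rate \<Gamma> \<mu>(1) by (intro exI[of _ \<Gamma>] exI[of _ \<mu>]) blast
  qed
  show ?thesis
    by (intro exI[of _ \<delta>] exI[of _ \<epsilon>star] conjI allI impI \<delta> \<epsilon>star main)
qed

end

lemma energy_deriv:
  assumes "\<And>i. i \<in> {1..N::nat} \<Longrightarrow> ((\<lambda>t. z i t) has_real_derivative dz i) (at t within T)"
    and "\<And>i. i \<in> {1..N} \<Longrightarrow> ((\<lambda>t. l i t) has_real_derivative dl i) (at t within T)"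
    and "\<And>i. i \<in> {1..N} \<Longrightarrow> ((\<lambda>t. v i t) has_real_derivative dv i) (at t within T)"
    and "\<And>i k. i \<in> {1..N} \<Longrightarrow> k < r i \<Longrightarrow> ((\<lambda>t. \<zeta> i t k) has_real_derivative d\<zeta> i k) (at t within T)"
    and "\<And>i k. i \<in> {1..N} \<Longrightarrow> k < q i \<Longrightarrow> ((\<lambda>t. e i t k) has_real_derivative de i k) (at t within T)"
    and "\<And>i j k. i \<in> {1..N} \<Longrightarrow> P i j k = P i k j" "\<And>i j k. i \<in> {1..N} \<Longrightarrow> R i j k = R i k j"
  shows "((\<lambda>t. energy N r q \<delta> \<Gamma> P R (\<lambda>i. z i t) (\<lambda>i. l i t) (\<lambda>i. v i t) (\<lambda>i. \<zeta> i t) (\<lambda>i. e i t))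
     has_real_derivative (\<Sum>i=1..N. slow_rate \<delta> (z i t) (l i t) (v i t) (dz i) (dl i) (dv i)
        + 2 * qform (r i) (P i) (\<zeta> i t) (d\<zeta> i) + \<Gamma> * (2 * qform (q i) (R i) (e i t) (de i)))) (at t within T)"
  unfolding energy_def
proof (rule DERIV_sum, rule DERIV_add, rule DERIV_add)
  fix i assume i: "i \<in> {1..N}"
  note Z = assms(1)[OF i] and L = assms(2)[OF i] and V = assms(3)[OF i]
  have sq: "((\<lambda>t. (w t)\<^sup>2) has_real_derivative 2 * w t * dw) (at t within T)"
    if "(w has_real_derivative dw) (at t within T)" for w :: "real \<Rightarrow> real" and dw
    using DERIV_power[OF that, of 2] by (simp add: mult_ac)
  show "((\<lambda>t. ((z i t)\<^sup>2 + (l i t)\<^sup>2 + (v i t)\<^sup>2) / 2 - \<delta> * (z i t * l i t) + \<delta> * (l i t * v i t))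
      has_real_derivative slow_rate \<delta> (z i t) (l i t) (v i t) (dz i) (dl i) (dv i)) (at t within T)"
    unfolding slow_rate_def
    by (rule DERIV_cong[OF DERIV_add[OF DERIV_diff[OF
            DERIV_cdivide[OF DERIV_add[OF DERIV_add[OF sq[OF Z] sq[OF L]] sq[OF V]], of 2]
            DERIV_cmult[OF DERIV_mult'[OF Z L], of \<delta>]] DERIV_cmult[OF DERIV_mult'[OF L V], of \<delta>]]])
      (simp add: field_simps)
  show "((\<lambda>t. qform (r i) (P i) (\<zeta> i t) (\<zeta> i t)) has_real_derivative 2 * qform (r i) (P i) (\<zeta> i t) (d\<zeta> i)) (at t within T)"
    using i assms by (intro qform_self_deriv) auto
  show "((\<lambda>t. \<Gamma> * qform (q i) (R i) (e i t) (e i t)) has_real_derivative \<Gamma> * (2 * qform (q i) (R i) (e i t) (de i))) (at t within T)"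
    using i assms by (intro DERIV_cmult qform_self_deriv) auto
qed

text \<open>Applied to \<open>z - y*\<close>, the left-hand side is the squared output error. The
  factor 8 is 2, from the square of a sum, times 4, since the energy contains at least a quarter of
  the square of \<open>z\<close>.\<close>

lemma energy_lower:
  assumes \<delta>: "0 < \<delta>" "\<delta> \<le> 1 / 4" and \<Gamma>: "0 < \<Gamma>" and i: "i \<in> {1..N}" and r: "r i > 0"
    and P: "\<And>i x. i \<in> {1..N} \<Longrightarrow> sqn (r i) x \<le> qform (r i) (P i) x x"
    and R: "\<And>i x. i \<in> {1..N} \<Longrightarrow> sqn (q i) x \<le> qform (q i) (R i) x x"
  shows "(\<zeta> (i::nat) 0 + z i)\<^sup>2 \<le> 8 * energy N r q \<delta> \<Gamma> P R z l v \<zeta> e"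
proof -
  let ?g = "\<lambda>i. ((z i)\<^sup>2 + (l i)\<^sup>2 + (v i)\<^sup>2) / 2 - \<delta> * (z i * l i) + \<delta> * (l i * v i)
        + qform (r i) (P i) (\<zeta> i) (\<zeta> i) + \<Gamma> * qform (q i) (R i) (e i) (e i)"
  have g: "((z i)\<^sup>2 + (l i)\<^sup>2 + (v i)\<^sup>2) / 4 + qform (r i) (P i) (\<zeta> i) (\<zeta> i) \<le> ?g i"
    "0 \<le> qform (r i) (P i) (\<zeta> i) (\<zeta> i)" if "i \<in> {1..N}" for i
  proof -
    have "0 \<le> qform (q i) (R i) (e i) (e i)"
      using R[OF that, of "e i"] sqn_nonneg[of "q i" "e i"] by linarith
    then have "0 \<le> \<Gamma> * qform (q i) (R i) (e i) (e i)" using \<Gamma> by simp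
    then show "((z i)\<^sup>2 + (l i)\<^sup>2 + (v i)\<^sup>2) / 4 + qform (r i) (P i) (\<zeta> i) (\<zeta> i) \<le> ?g i"
      using cross_term_bounds(1)[OF \<delta>, of "z i" "l i" "v i"] by linarith
    show "0 \<le> qform (r i) (P i) (\<zeta> i) (\<zeta> i)"
      using P[OF that, of "\<zeta> i"] sqn_nonneg[of "r i" "\<zeta> i"] by linarith
  qed
  have "0 \<le> ?g j" if "j \<in> {1..N}" for j
  proof -
    have "0 \<le> ((z j)\<^sup>2 + (l j)\<^sup>2 + (v j)\<^sup>2) / 4" by simp
    then show ?thesis using g[OF that] by linarith
  qed
  then have "?g i \<le> energy N r q \<delta> \<Gamma> P R z l v \<zeta> e"
    unfolding energy_def using i by (intro member_le_sum) auto
  moreover have "(\<zeta> i 0)\<^sup>2 \<le> qform (r i) (P i) (\<zeta> i) (\<zeta> i)"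
    using P[OF i] r by (rule qform_ge_square)
  moreover have "(\<zeta> i 0 + z i)\<^sup>2 \<le> 2 * (\<zeta> i 0)\<^sup>2 + 2 * (z i)\<^sup>2"
    using zero_le_power2[of "\<zeta> i 0 - z i"] by (simp add: power2_eq_square algebra_simps)
  moreover have "0 \<le> (\<zeta> i 0)\<^sup>2" "0 \<le> (l i)\<^sup>2" "0 \<le> (v i)\<^sup>2" by auto
  ultimately show ?thesis using g(1)[OF i] by argo
qed

section \<open>Optimality condition and auxiliary estimates for the closed loop\<close>

lemma optimal_gradients_equal:
  assumes opt: "optimal_solution N f d y"
    and der: "\<And>i s. i \<in> {1..N} \<Longrightarrow> (f i has_real_derivative f' i s) (at s)"
    and ij: "i \<in> {1..N}" "j \<in> {1..N}"
  shows "f' i (y i) = f' j (y j)"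
proof -
  \<comment> \<open>Shifting production from agent \<open>j\<close> to agent \<open>i\<close>
    preserves feasibility, so the total cost along this line has a minimum at 0; its derivative
    there is the difference of the two gradients.\<close>
  define s :: "nat \<Rightarrow> real" where "s k = (if k = i then 1 else 0) - (if k = j then 1 else 0)" for k
  have sum_s: "(\<Sum>k=1..N. g k * s k) = g i - g j" for g
    unfolding s_def right_diff_distrib sum_subtractf using ij by (simp add: if_distrib cong: if_cong)
  define \<phi> where "\<phi> t = (\<Sum>k=1..N. f k (y k + s k * t))" for t
  have "(\<phi> has_real_derivative (\<Sum>k=1..N. f' k (y k) * s k)) (at 0)"
    unfolding \<phi>_def
  proof (rule DERIV_sum)
    fix k assume "k \<in> {1..N}"
    then have "(f k has_real_derivative f' k (y k)) (at (y k + s k * 0))" using der by simp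
    moreover have "((\<lambda>t. y k + s k * t) has_real_derivative s k) (at 0)"
      by (auto intro!: derivative_eq_intros)
    ultimately show "((\<lambda>t. f k (y k + s k * t)) has_real_derivative f' k (y k) * s k) (at 0)"
      by (rule DERIV_chain2)
  qed
  moreover have "\<phi> 0 \<le> \<phi> t" for t
  proof -
    have "(\<Sum>k=1..N. s k * t) = 0"
      using sum_s[of "\<lambda>_. t"] by (simp add: mult.commute)
    then have "feasible N d (\<lambda>k. y k + s k * t)"
      using opt by (simp add: optimal_solution_def feasible_def sum.distrib)
    then show ?thesis using opt by (simp add: optimal_solution_def \<phi>_def)
  qed
  ultimately have "(\<Sum>k=1..N. f' k (y k) * s k) = 0"
    by (intro DERIV_local_min[of \<phi> _ 0 1]) auto
  then show ?thesis using sum_s[of "\<lambda>k. f' k (y k)"] by simp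
qed

text \<open>The mean value theorem, with an arbitrary admissible slope when the two points coincide.
  It turns the gradient into a linear term with a bounded coefficient.\<close>

lemma slope_between:
  fixes g g' :: "real \<Rightarrow> real"
  assumes der: "\<And>s. (g has_real_derivative g' s) (at s)" and b: "\<And>s. lo \<le> g' s \<and> g' s \<le> hi"
  shows "\<exists>h. lo \<le> h \<and> h \<le> hi \<and> g x - g y = h * (x - y)"
proof -
  consider "x = y" | "x < y" | "y < x" by linarith
  then show ?thesis
  proof cases
    case 1
    then show ?thesis using b[of 0] by (intro exI[of _ "g' 0"]) auto
  next
    case 2
    obtain s where "g y - g x = (y - x) * g' s"
      using MVT2[OF 2, of g g'] der by blast
    then show ?thesis using b by (intro exI[of _ "g' s"]) (simp add: algebra_simps)
  next
    case 3
    obtain s where "g x - g y = (x - y) * g' s"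
      using MVT2[OF 3, of g g'] der by blast
    then show ?thesis using b by (intro exI[of _ "g' s"]) (simp add: algebra_simps)
  qed
qed

lemma mult_mat_vec_entry_bound:
  fixes K :: "real mat"
  assumes K: "K \<in> carrier_mat m q" and i: "i < m"
  shows "\<exists>B>0. \<forall>e\<in>carrier_vec q. ((K *\<^sub>v e) $ i)\<^sup>2 \<le> B * sqn q (($) e)"
proof -
  obtain M where M: "M > 0" "\<And>j. j < q \<Longrightarrow> (K $$ (i, j))\<^sup>2 \<le> M"
    using finite_uniform_upper[of "{..<q}" "\<lambda>j. (K $$ (i, j))\<^sup>2"] by auto
  have "((K *\<^sub>v e) $ i)\<^sup>2 \<le> (real q * M + 1) * sqn q (($) e)" if e: "e \<in> carrier_vec q" for e
  proof -
    have "((K *\<^sub>v e) $ i)\<^sup>2 \<le> real q * (\<Sum>j<q. (K $$ (i, j) * e $ j)\<^sup>2)"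
      using sum_square_le_card[of "\<lambda>j. K $$ (i, j) * e $ j" "{..<q}"]
      unfolding mult_mat_vec_entry[OF K e i] by simp
    also have "\<dots> \<le> real q * (\<Sum>j<q. M * (e $ j)\<^sup>2)"
      using M(2) unfolding power_mult_distrib by (intro mult_left_mono sum_mono mult_right_mono) auto
    also have "\<dots> = real q * M * sqn q (($) e)"
      by (simp add: sqn_def sum_distrib_left mult.assoc)
    also have "\<dots> \<le> (real q * M + 1) * sqn q (($) e)"
      by (intro mult_right_mono) auto
    finally show ?thesis .
  qed
  moreover have "real q * M + 1 > 0" using M by (simp add: add_nonneg_pos)
  ultimately show ?thesis by blast
qed

text \<open>\<open>exp_decay\<close> with rate 0, applied to \<open>U\<close> and to
  \<open>- U\<close>.\<close>

lemma const_of_deriv_zero: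
  fixes U :: "real \<Rightarrow> real"
  assumes der: "\<And>t. t \<ge> 0 \<Longrightarrow> (U has_real_derivative 0) (at t within {0..})" and t: "t \<ge> 0"
  shows "U t = U 0"
proof -
  have "((\<lambda>t. - U t) has_real_derivative 0) (at s within {0..})" if "s \<ge> 0" for s
    using DERIV_minus[OF der[OF that]] by simp
  from exp_decay[of "\<lambda>t. - U t" "\<lambda>_. 0" 0, OF this _ t] exp_decay[of U "\<lambda>_. 0" 0, OF der _ t]
  show ?thesis by simp
qed

lemma vec_ode_cong:
  assumes "vec_ode n x dx" "\<And>t. t \<ge> 0 \<Longrightarrow> dx t = dx' t"
  shows "vec_ode n x dx'"
  using assms by (simp add: vec_ode_def)

section \<open>Exponential convergence of the outputs to the optimum\<close>

theorem theorem3: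
  fixes N :: nat
    and n q r :: "nat \<Rightarrow> nat"
    and A B C E S L :: "nat \<Rightarrow> real mat"
    and c :: "nat \<Rightarrow> nat \<Rightarrow> real"
    and a :: "nat \<Rightarrow> nat \<Rightarrow> real"
    and d hl hu ystar :: "nat \<Rightarrow> real"
    and f f' f'' :: "nat \<Rightarrow> real \<Rightarrow> real"
  assumes dims: "\<And>i. i \<in> {1..N} \<Longrightarrow>
        A i \<in> carrier_mat (n i) (n i) \<and> B i \<in> carrier_mat (n i) 1 \<and>
        C i \<in> carrier_mat 1 (n i) \<and> E i \<in> carrier_mat (n i) (q i) \<and>
        S i \<in> carrier_mat (q i) (q i) \<and> L i \<in> carrier_mat (q i) (n i)"
    and "\<And>i. i \<in> {1..N} \<Longrightarrow> minimal (C i) (A i) (B i)"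
    and "\<And>i. i \<in> {1..N} \<Longrightarrow> observable (E i) (S i)"
    and "\<And>i. i \<in> {1..N} \<Longrightarrow> minimum_phase (A i) (B i) (C i)"
    and "\<And>i. i \<in> {1..N} \<Longrightarrow> r i > 0 \<and> relative_degree (A i) (B i) (C i) (r i)"
    and "\<And>i s. i \<in> {1..N} \<Longrightarrow> (f i has_real_derivative f' i s) (at s)"
    and "\<And>i s. i \<in> {1..N} \<Longrightarrow> (f' i has_real_derivative f'' i s) (at s)"
    and "\<And>i. i \<in> {1..N} \<Longrightarrow> continuous_on UNIV (f'' i)"
    and "\<And>i. i \<in> {1..N} \<Longrightarrow> 0 < hl i \<and> hl i \<le> hu i"
    and "\<And>i s. i \<in> {1..N} \<Longrightarrow> hl i \<le> f'' i s \<and> f'' i s \<le> hu i"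
    and "\<And>i j. i \<in> {1..N} \<Longrightarrow> j \<in> {1..N} \<Longrightarrow> a i j = a j i \<and> a i j \<ge> 0"
    and "\<And>i. i \<in> {1..N} \<Longrightarrow> a i i = 0"
    and "connected_graph N a"
    and "\<And>i. i \<in> {1..N} \<Longrightarrow> hurwitz_mat (S i - L i * E i)"
    and "\<And>i. i \<in> {1..N} \<Longrightarrow> hurwitz_poly (monom 1 (r i) + (\<Sum>k<r i. monom (c i k) k))"
    and "optimal_solution N f d ystar"
  shows "\<exists>\<epsilon>star>0. \<forall>\<epsilon>. 0 < \<epsilon> \<and> \<epsilon> < \<epsilon>star \<longrightarrow>
     (\<forall>i\<in>{1..N}. \<exists>\<mu>2>0. \<forall>x0 \<omega>0 \<eta>b0 z0 lam0 v0. \<exists>\<mu>1>0. \<forall>x \<omega> \<eta>b z lam v.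
        closed_loop N n q r A B C E S L c a d f' \<epsilon> x \<omega> \<eta>b z lam v \<and>
        (\<forall>j\<in>{1..N}. x j 0 = x0 j \<and> \<omega> j 0 = \<omega>0 j \<and> \<eta>b j 0 = \<eta>b0 j \<and>
            z j 0 = z0 j \<and> lam j 0 = lam0 j \<and> v j 0 = v0 j) \<longrightarrow>
        (\<forall>t\<ge>0. \<bar>agent_output (C i) (x i t) - ystar i\<bar> \<le> \<mu>1 * exp (- \<mu>2 * t)))"
proof -
  note dims = assms(1) and rel = assms(5) and f_der = assms(6) and f'_der = assms(7)
    and hl = assms(9) and f''_bounds = assms(10) and a_sym = assms(11) and conn = assms(13)
    and hurwitz_obs = assms(14) and hurwitz_c = assms(15) and opt = assms(16)
  interpret weighted_graph N a
    using a_sym conn by unfold_locales auto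
  obtain m where m: "0 < m" "\<And>i. i \<in> {1..N} \<Longrightarrow> m \<le> hl i"
    using finite_uniform_lower[of "{1..N}" hl] hl by auto
  obtain H where H: "0 < H" "\<And>i. i \<in> {1..N} \<Longrightarrow> hu i \<le> H"
    using finite_uniform_upper[of "{1..N}" hu] by auto
  have rpos: "r i > 0" if "i \<in> {1..N}" for i using rel[OF that] by simp
  have "\<forall>i\<in>{1..N}. \<exists>P. (\<forall>j k. P j k = P k j) \<and> (\<forall>x. sqn (r i) x \<le> qform (r i) P x x) \<and>
      (\<forall>x. 2 * qform (r i) P x (companion (r i) (c i) x) \<le> - sqn (r i) x)"
    using hurwitz_companion_lyapunov rpos hurwitz_c by blast
  from bchoice[OF this] obtain P where P: "\<And>i j k. i \<in> {1..N} \<Longrightarrow> P i j k = P i k j"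
    "\<And>i x. i \<in> {1..N} \<Longrightarrow> sqn (r i) x \<le> qform (r i) (P i) x x"
    "\<And>i x. i \<in> {1..N} \<Longrightarrow> 2 * qform (r i) (P i) x (companion (r i) (c i) x) \<le> - sqn (r i) x"
    by blast
  let ?M = "\<lambda>i. S i - L i * E i"
  define F where "F i x j = (\<Sum>k<q i. ?M i $$ (j, k) * x k)" for i and x :: "nat \<Rightarrow> real" and j
  have "\<exists>R. (\<forall>j k. R j k = R k j) \<and> (\<forall>x. sqn (q i) x \<le> qform (q i) R x x) \<and>
      (\<forall>x. 2 * qform (q i) R x (F i x) \<le> - sqn (q i) x)" if i: "i \<in> {1..N}" for i
  proof -
    have "?M i \<in> carrier_mat (q i) (q i)"
      using dims[OF i] by (intro minus_carrier_mat) auto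
    from hurwitz_lyapunov[OF this hurwitz_obs[OF i]] show ?thesis unfolding F_def .
  qed
  then have "\<forall>i\<in>{1..N}. \<exists>R. (\<forall>j k. R j k = R k j) \<and> (\<forall>x. sqn (q i) x \<le> qform (q i) R x x) \<and>
      (\<forall>x. 2 * qform (q i) R x (F i x) \<le> - sqn (q i) x)" by blast
  from bchoice[OF this] obtain R where R: "\<And>i j k. i \<in> {1..N} \<Longrightarrow> R i j k = R i k j"
    "\<And>i x. i \<in> {1..N} \<Longrightarrow> sqn (q i) x \<le> qform (q i) (R i) x x"
    "\<And>i x. i \<in> {1..N} \<Longrightarrow> 2 * qform (q i) (R i) x (F i x) \<le> - sqn (q i) x"
    by blast
  obtain \<delta> \<epsilon>star where \<delta>: "0 < \<delta>" "\<delta> \<le> 1 / 4" and \<epsilon>star: "0 < \<epsilon>star"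
    and dissipation: "\<forall>\<epsilon> G. 0 < \<epsilon> \<longrightarrow> \<epsilon> < \<epsilon>star \<longrightarrow> 0 < G \<longrightarrow>
      (\<exists>\<Gamma> \<mu>. 0 < \<Gamma> \<and> 0 < \<mu> \<and> (\<forall>z l v \<zeta> e h b.
        (\<forall>i\<in>{1..N}. m \<le> h i \<and> h i \<le> H) \<and> (\<Sum>i=1..N. v i) = 0 \<and>
        (\<forall>i\<in>{1..N}. (b i)\<^sup>2 \<le> G * sqn (q i) (e i)) \<longrightarrow>
        (\<Sum>i=1..N. slow_rate \<delta> (z i) (l i) (v i)
            (- h i * (z i + \<zeta> i 0) + l i) (- nd l i - nd v i - z i) (nd l i)
          + 2 * qform (r i) (P i) (\<zeta> i) (\<lambda>k. companion (r i) (c i) (\<zeta> i) k / \<epsilon>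
              + ((if Suc k = r i then b i else 0) - (if k = 0 then - h i * (z i + \<zeta> i 0) + l i else 0)))
          + \<Gamma> * (2 * qform (q i) (R i) (e i) (F i (e i))))
        \<le> - (2 * \<mu>) * energy N r q \<delta> \<Gamma> P R z l v \<zeta> e))"
    by (rule exE[OF energy_dissipation[where r = r and P = P and c = c and q = q and R = R and F = F,
          OF m(1) H(1)]], (erule rpos P(3) R(3))+, elim exE conjE, rule that)
  have feas: "(\<Sum>i=1..N. d i - ystar i) = 0"
    using opt by (simp add: optimal_solution_def feasible_def sum_subtractf)
  \<comment> \<open>At an equilibrium with \<open>z = ystar\<close> and all multipliers equal, the
    equation for \<open>\<lambda>\<close> reads \<open>nd v = d - ystar\<close>. It is solvable
    because \<open>ystar\<close> is feasible.\<close>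
  obtain w where w: "\<And>i. i \<in> {1..N} \<Longrightarrow> nd w i = d i - ystar i"
    using nd_surjective[OF feas] by blast
  have goal: "\<exists>\<mu>2>0. \<forall>x0 \<omega>0 \<eta>b0 z0 lam0 v0. \<exists>\<mu>1>0. \<forall>x \<omega> \<eta>b z lam v.
        closed_loop N n q r A B C E S L c a d f' \<epsilon> x \<omega> \<eta>b z lam v \<and>
        (\<forall>j\<in>{1..N}. x j 0 = x0 j \<and> \<omega> j 0 = \<omega>0 j \<and> \<eta>b j 0 = \<eta>b0 j \<and>
            z j 0 = z0 j \<and> lam j 0 = lam0 j \<and> v j 0 = v0 j) \<longrightarrow>
        (\<forall>t\<ge>0. \<bar>agent_output (C i) (x i t) - ystar i\<bar> \<le> \<mu>1 * exp (- \<mu>2 * t))"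
    if \<epsilon>: "0 < \<epsilon>" "\<epsilon> < \<epsilon>star" and i: "i \<in> {1..N}" for \<epsilon> i
  proof -
    have ag: "agent (n j) (q j) (r j) (A j) (B j) (C j) (E j) (S j) (L j) \<epsilon>" if "j \<in> {1..N}" for j
      using dims[OF that] rel[OF that] \<epsilon> by unfold_locales auto
    let ?K2 = "\<lambda>j. K2 (A j) (B j) (C j) (E j) (S j) (r j) (c j) \<epsilon>"
    \<comment> \<open>The factor with which the entry of \<open>K2 * e\<close> enters the last
      scaled error equation. It may depend on \<open>\<epsilon>\<close>, as may the bound
      \<open>G\<close> obtained from it.\<close>
    define gain where "gain j = \<epsilon> ^ (r j - 1) * hf_gain (A j) (B j) (C j) (r j)" for j
    have "\<forall>j\<in>{1..N}. \<exists>B>0. \<forall>e\<in>carrier_vec (q j). ((?K2 j *\<^sub>v e) $ 0)\<^sup>2 \<le> B * sqn (q j) (($) e)"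
      using mult_mat_vec_entry_bound[OF agent.K2_carrier[OF ag]] by simp
    from bchoice[OF this] obtain kb where kb:
      "\<And>j e. j \<in> {1..N} \<Longrightarrow> e \<in> carrier_vec (q j) \<Longrightarrow> ((?K2 j *\<^sub>v e) $ 0)\<^sup>2 \<le> kb j * sqn (q j) (($) e)"
      by blast
    obtain G where G: "G > 0" "\<And>j. j \<in> {1..N} \<Longrightarrow> (gain j)\<^sup>2 * kb j \<le> G"
      using finite_uniform_upper[of "{1..N}" "\<lambda>j. (gain j)\<^sup>2 * kb j"] by auto
    have b_bound: "(gain j * (?K2 j *\<^sub>v e) $ 0)\<^sup>2 \<le> G * sqn (q j) (($) e)"
      if j: "j \<in> {1..N}" and e: "e \<in> carrier_vec (q j)" for j e
    proof -
      have "(gain j * (?K2 j *\<^sub>v e) $ 0)\<^sup>2 \<le> (gain j)\<^sup>2 * (kb j * sqn (q j) (($) e))"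
        unfolding power_mult_distrib using kb[OF j e] by (intro mult_left_mono) auto
      also have "\<dots> \<le> G * sqn (q j) (($) e)"
        unfolding mult.assoc[symmetric] using G(2)[OF j] by (intro mult_right_mono) auto
      finally show ?thesis .
    qed
    obtain \<Gamma> \<mu> where \<Gamma>: "0 < \<Gamma>" and \<mu>: "0 < \<mu>" and rate: "\<And>z l v \<zeta> e h b.
        (\<forall>i\<in>{1..N}. m \<le> h i \<and> h i \<le> H) \<Longrightarrow> (\<Sum>i=1..N. v i) = 0 \<Longrightarrow>
        (\<forall>i\<in>{1..N}. (b i)\<^sup>2 \<le> G * sqn (q i) (e i)) \<Longrightarrow>
        (\<Sum>i=1..N. slow_rate \<delta> (z i) (l i) (v i)
            (- h i * (z i + \<zeta> i 0) + l i) (- nd l i - nd v i - z i) (nd l i)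
          + 2 * qform (r i) (P i) (\<zeta> i) (\<lambda>k. companion (r i) (c i) (\<zeta> i) k / \<epsilon>
              + ((if Suc k = r i then b i else 0) - (if k = 0 then - h i * (z i + \<zeta> i 0) + l i else 0)))
          + \<Gamma> * (2 * qform (q i) (R i) (e i) (F i (e i))))
        \<le> - (2 * \<mu>) * energy N r q \<delta> \<Gamma> P R z l v \<zeta> e"
      using dissipation[rule_format, OF \<epsilon> G(1)] by blast
    have bound: "\<exists>\<mu>1>0. \<forall>x \<omega> \<eta>b z lam v.
        closed_loop N n q r A B C E S L c a d f' \<epsilon> x \<omega> \<eta>b z lam v \<and>
        (\<forall>j\<in>{1..N}. x j 0 = x0 j \<and> \<omega> j 0 = \<omega>0 j \<and> \<eta>b j 0 = \<eta>b0 j \<and>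
            z j 0 = z0 j \<and> lam j 0 = lam0 j \<and> v j 0 = v0 j) \<longrightarrow>
        (\<forall>t\<ge>0. \<bar>agent_output (C i) (x i t) - ystar i\<bar> \<le> \<mu>1 * exp (- \<mu> * t))"
      for x0 \<omega>0 \<eta>b0 z0 lam0 v0
    proof -
      \<comment> \<open>The Lagrange multiplier: at the optimum all gradients agree, so agent
        \<open>i\<close> can serve as reference.\<close>
      define ls where "ls = f' i (ystar i)"
      have ls: "f' j (ystar j) = ls" if "j \<in> {1..N}" for j
        unfolding ls_def using optimal_gradients_equal[OF opt f_der that i] by simp
      \<comment> \<open>\<open>w\<close> is determined up to a constant. The constant is chosen such
        that the sum of \<open>vs\<close> is the conserved sum of \<open>v\<close>, which makes the
        deviation \<open>v - vs\<close> a vector of zero sum at all times.\<close>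
      define vs where "vs j = w j + ((\<Sum>k=1..N. v0 k) - (\<Sum>k=1..N. w k)) / N" for j
      have "N > 0" using i by simp
      then have sum_vs: "(\<Sum>j=1..N. vs j) = (\<Sum>k=1..N. v0 k)"
        by (simp add: vs_def sum.distrib)
      have nd_vs: "nd vs j = d j - ystar j" if "j \<in> {1..N}" for j
        using w[OF that] by (simp add: vs_def neighbor_diff_def)
      let ?err = "\<lambda>j. scaled_error (A j) (C j) (E j) (S j) \<epsilon>"
      \<comment> \<open>The energy as a function of the state alone, so that its initial value, and
        with it \<open>\<mu>1\<close>, is fixed before any trajectory is considered.\<close>
      define V where "V X W Y Z La Ve = energy N r q \<delta> \<Gamma> P R (\<lambda>j. Z j - ystar j) (\<lambda>j. La j - ls)
          (\<lambda>j. Ve j - vs j) (\<lambda>j. ?err j (X j) (W j) (Z j)) (\<lambda>j. ($) (Y j + L j *\<^sub>v X j - W j))"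
        for X W Y :: "nat \<Rightarrow> real vec" and Z La Ve
      define V0 where "V0 = V x0 \<omega>0 \<eta>b0 z0 lam0 v0"
      \<comment> \<open>The square root comes from passing from the energy to the output error, and
        the summand 1 makes the constant positive also when \<open>V0 = 0\<close>.\<close>
      have "\<bar>agent_output (C i) (x i t) - ystar i\<bar> \<le> (sqrt (8 * \<bar>V0\<bar>) + 1) * exp (- \<mu> * t)"
        if cl: "closed_loop N n q r A B C E S L c a d f' \<epsilon> x \<omega> \<eta>b z lam v"
          and init: "\<forall>j\<in>{1..N}. x j 0 = x0 j \<and> \<omega> j 0 = \<omega>0 j \<and> \<eta>b j 0 = \<eta>b0 j \<and>
            z j 0 = z0 j \<and> lam j 0 = lam0 j \<and> v j 0 = v0 j"
          and t: "t \<ge> 0" for x \<omega> \<eta>b z lam v t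
      proof -
        define e where "e j \<tau> = \<eta>b j \<tau> + L j *\<^sub>v x j \<tau> - \<omega> j \<tau>" for j \<tau>
        define u where "u j \<tau> = control_input (A j) (B j) (C j) (E j) (S j) (r j) (c j) \<epsilon> (x j \<tau>)
            (\<eta>b j \<tau> + L j *\<^sub>v x j \<tau>) (z j \<tau>)" for j \<tau>
        let ?y = "\<lambda>j \<tau>. agent_output (C j) (x j \<tau>)"
        let ?\<zeta> = "\<lambda>j \<tau>. ?err j (x j \<tau>) (\<omega> j \<tau>) (z j \<tau>)"
        define dz where "dz j \<tau> = - f' j (?y j \<tau>) + lam j \<tau>" for j \<tau>
        have x_ode: "vec_ode (n j) (x j) (\<lambda>\<tau>. A j *\<^sub>v x j \<tau> + B j *\<^sub>v u j \<tau> + E j *\<^sub>v \<omega> j \<tau>)"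
          and \<omega>_ode: "vec_ode (q j) (\<omega> j) (\<lambda>\<tau>. S j *\<^sub>v \<omega> j \<tau>)"
          and \<eta>_ode: "vec_ode (q j) (\<eta>b j) (\<lambda>\<tau>. (S j - L j * E j) *\<^sub>v \<eta>b j \<tau>
            + (S j * L j - L j * E j * L j - L j * A j) *\<^sub>v x j \<tau> - L j * B j *\<^sub>v u j \<tau>)"
          and z_ode: "scalar_ode (z j) (dz j)"
          and l_ode: "scalar_ode (lam j) (\<lambda>\<tau>. - nd (\<lambda>k. lam k \<tau>) j - nd (\<lambda>k. v k \<tau>) j + d j - z j \<tau>)"
          and v_ode: "scalar_ode (v j) (\<lambda>\<tau>. nd (\<lambda>k. lam k \<tau>) j)"
          if "j \<in> {1..N}" for j
          using cl that unfolding closed_loop_def Let_def u_def dz_def by auto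
        have carr: "x j \<tau> \<in> carrier_vec (n j)" "\<omega> j \<tau> \<in> carrier_vec (q j)"
          "\<eta>b j \<tau> \<in> carrier_vec (q j)" "L j *\<^sub>v x j \<tau> \<in> carrier_vec (q j)" "e j \<tau> \<in> carrier_vec (q j)"
          "\<omega> j \<tau> + e j \<tau> = \<eta>b j \<tau> + L j *\<^sub>v x j \<tau>"
          if "j \<in> {1..N}" "\<tau> \<ge> 0" for j \<tau>
        proof -
          show c: "x j \<tau> \<in> carrier_vec (n j)" "\<omega> j \<tau> \<in> carrier_vec (q j)" "\<eta>b j \<tau> \<in> carrier_vec (q j)"
            using x_ode[OF that(1)] \<omega>_ode[OF that(1)] \<eta>_ode[OF that(1)] that(2)
            by (auto simp: vec_ode_def)
          show Lx: "L j *\<^sub>v x j \<tau> \<in> carrier_vec (q j)"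
            using c(1) dims[OF that(1)] by (meson mult_mat_vec_carrier)
          show "e j \<tau> \<in> carrier_vec (q j)" using c Lx by (simp add: e_def)
          show "\<omega> j \<tau> + e j \<tau> = \<eta>b j \<tau> + L j *\<^sub>v x j \<tau>"
          proof -
            have "p + (p' - p) = p'" if "p \<in> carrier_vec (q j)" "p' \<in> carrier_vec (q j)" for p p' :: "real vec"
              using that by (intro eq_vecI) auto
            then show ?thesis unfolding e_def using c Lx by simp
          qed
        qed
        have y_eq: "?y j \<tau> = ?\<zeta> j \<tau> 0 + z j \<tau>" if "j \<in> {1..N}" "\<tau> \<ge> 0" for j \<tau>
          using agent.agent_output_eq[OF ag[OF that(1)] carr(1,2)[OF that]] by simp
        have \<zeta>_der: "((\<lambda>\<tau>. ?\<zeta> j \<tau> k) has_real_derivative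
            companion (r j) (c j) (?\<zeta> j s) k / \<epsilon>
            + ((if Suc k = r j then gain j * (?K2 j *\<^sub>v e j s) $ 0 else 0) - (if k = 0 then dz j s else 0)))
            (at s within {0..})"
          if j: "j \<in> {1..N}" and k: "k < r j" and s: "s \<ge> 0" for j k s
        proof -
          have "vec_ode (n j) (x j) (\<lambda>\<tau>. A j *\<^sub>v x j \<tau> + B j *\<^sub>v control_input (A j) (B j) (C j) (E j) (S j)
              (r j) (c j) \<epsilon> (x j \<tau>) (\<omega> j \<tau> + e j \<tau>) (z j \<tau>) + E j *\<^sub>v \<omega> j \<tau>)"
            using x_ode[OF j] by (rule vec_ode_cong) (simp add: u_def carr(6)[OF j])
          note der = agent.scaled_error_deriv[OF ag[OF j] this \<omega>_ode[OF j] carr(5)[OF j s] z_ode[OF j] k s]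
          have "\<epsilon> ^ k * (hf_gain (A j) (B j) (C j) (r j) * X) = gain j * X" if "Suc k = r j" for X
          proof -
            have "r j - 1 = k" using that by simp
            then show ?thesis by (simp add: gain_def)
          qed
          with der show ?thesis by (simp cong: if_cong)
        qed
        have e_der: "((\<lambda>\<tau>. e j \<tau> $ k) has_real_derivative F j (($) (e j s)) k) (at s within {0..})"
          if j: "j \<in> {1..N}" and k: "k < q j" and s: "s \<ge> 0" for j k s
        proof -
          have "u j \<tau> \<in> carrier_vec 1" for \<tau>
            unfolding u_def by (rule agent.control_input_carrier[OF ag[OF j]])
          from agent.observer_error_deriv[OF ag[OF j] x_ode[OF j] this \<omega>_ode[OF j] \<eta>_ode[OF j] k s]
          show ?thesis by (simp only: F_def e_def)
        qed
        have sum_v: "(\<Sum>j=1..N. v j s - vs j) = 0" if s: "s \<ge> 0" for s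
        proof -
          have "(\<Sum>j=1..N. v j s) = (\<Sum>j=1..N. v j 0)"
          proof (rule const_of_deriv_zero[OF _ s])
            fix \<tau> :: real assume \<tau>: "\<tau> \<ge> 0"
            have "((\<lambda>\<tau>. \<Sum>j=1..N. v j \<tau>) has_real_derivative (\<Sum>j=1..N. nd (\<lambda>k. lam k \<tau>) j)) (at \<tau> within {0..})"
              using v_ode \<tau> by (intro DERIV_sum) (auto simp: scalar_ode_def)
            then show "((\<lambda>\<tau>. \<Sum>j=1..N. v j \<tau>) has_real_derivative 0) (at \<tau> within {0..})"
              by (simp only: sum_nd)
          qed
          also have "\<dots> = (\<Sum>j=1..N. vs j)" unfolding sum_vs using init by (intro sum.cong) auto
          finally show ?thesis by (simp add: sum_subtractf)
        qed
        define U where "U s = energy N r q \<delta> \<Gamma> P R (\<lambda>j. z j s - ystar j) (\<lambda>j. lam j s - ls)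
          (\<lambda>j. v j s - vs j) (\<lambda>j. ?\<zeta> j s) (\<lambda>j. ($) (e j s))" for s
        define dU where "dU s = (\<Sum>j=1..N. slow_rate \<delta> (z j s - ystar j) (lam j s - ls) (v j s - vs j)
            (dz j s) (- nd (\<lambda>k. lam k s) j - nd (\<lambda>k. v k s) j + d j - z j s) (nd (\<lambda>k. lam k s) j)
          + 2 * qform (r j) (P j) (?\<zeta> j s) (\<lambda>k. companion (r j) (c j) (?\<zeta> j s) k / \<epsilon>
            + ((if Suc k = r j then gain j * (?K2 j *\<^sub>v e j s) $ 0 else 0) - (if k = 0 then dz j s else 0)))
          + \<Gamma> * (2 * qform (q j) (R j) (($) (e j s)) (F j (($) (e j s)))))" for s
        have shift: "((\<lambda>\<tau>. p \<tau> - p0) has_real_derivative dp s) (at s within {0..})"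
          if "scalar_ode p dp" "s \<ge> 0" for p dp p0 s
          using DERIV_diff[of p "dp s" s "{0..}" "\<lambda>_. p0" 0] that by (simp add: scalar_ode_def)
        have U_der: "(U has_real_derivative dU s) (at s within {0..})" if s: "s \<ge> 0" for s
          unfolding U_def dU_def
          by (intro energy_deriv shift[OF z_ode _] shift[OF l_ode _] shift[OF v_ode _] \<zeta>_der e_der P(1) R(1) s)
        have dU_le: "dU s \<le> - (2 * \<mu>) * U s" if s: "s \<ge> 0" for s
        proof -
          \<comment> \<open>The slopes are chosen separately at each time \<open>s\<close>; the
            dissipation estimate is uniform in all admissible \<open>h\<close>.\<close>
          have "\<forall>j\<in>{1..N}. \<exists>h. hl j \<le> h \<and> h \<le> hu j \<and> f' j (?y j s) - f' j (ystar j) = h * (?y j s - ystar j)"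
            using slope_between[OF f'_der f''_bounds] by blast
          from bchoice[OF this] obtain h where h: "\<And>j. j \<in> {1..N} \<Longrightarrow> hl j \<le> h j \<and> h j \<le> hu j"
            "\<And>j. j \<in> {1..N} \<Longrightarrow> f' j (?y j s) - f' j (ystar j) = h j * (?y j s - ystar j)"
            by blast
          have dz: "dz j s = - h j * ((z j s - ystar j) + ?\<zeta> j s 0) + (lam j s - ls)" if j: "j \<in> {1..N}" for j
            using h(2)[OF j] y_eq[OF j s] ls[OF j] by (simp add: dz_def algebra_simps)
          have nd_l: "nd (\<lambda>k. lam k s - ls) j = nd (\<lambda>k. lam k s) j" for j
            by (simp add: neighbor_diff_def)
          have dl: "- nd (\<lambda>k. lam k s) j - nd (\<lambda>k. v k s) j + d j - z j s
              = - nd (\<lambda>k. lam k s - ls) j - nd (\<lambda>k. v k s - vs k) j - (z j s - ystar j)"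
            if j: "j \<in> {1..N}" for j
            using nd_vs[OF j] unfolding neighbor_diff_diff neighbor_diff_const by simp
          have hm: "\<forall>j\<in>{1..N}. m \<le> h j \<and> h j \<le> H"
            using h(1) m(2) H(2) by (meson order_trans)
          have bb: "\<forall>j\<in>{1..N}. (gain j * (?K2 j *\<^sub>v e j s) $ 0)\<^sup>2 \<le> G * sqn (q j) (($) (e j s))"
            using b_bound carr(5)[OF _ s] by blast
          have "dU s = (\<Sum>j=1..N. slow_rate \<delta> (z j s - ystar j) (lam j s - ls) (v j s - vs j)
              (- h j * ((z j s - ystar j) + ?\<zeta> j s 0) + (lam j s - ls))
              (- nd (\<lambda>k. lam k s - ls) j - nd (\<lambda>k. v k s - vs k) j - (z j s - ystar j)) (nd (\<lambda>k. lam k s - ls) j)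
            + 2 * qform (r j) (P j) (?\<zeta> j s) (\<lambda>k. companion (r j) (c j) (?\<zeta> j s) k / \<epsilon>
              + ((if Suc k = r j then gain j * (?K2 j *\<^sub>v e j s) $ 0 else 0)
                - (if k = 0 then - h j * ((z j s - ystar j) + ?\<zeta> j s 0) + (lam j s - ls) else 0)))
            + \<Gamma> * (2 * qform (q j) (R j) (($) (e j s)) (F j (($) (e j s)))))"
            unfolding dU_def by (intro sum.cong refl) (simp only: dz dl nd_l)
          also have "\<dots> \<le> - (2 * \<mu>) * U s"
            unfolding U_def
            by (rule rate[OF hm sum_v[OF s], where b = "\<lambda>j. gain j * (?K2 j *\<^sub>v e j s) $ 0", OF bb])
          finally show ?thesis .
        qed
        have "U 0 = V0"
          unfolding U_def V0_def V_def e_def using init by (intro energy_cong) auto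
        then have "U t \<le> V0 * exp (- (2 * \<mu>) * t)"
          using exp_decay[OF U_der dU_le t] by simp
        also have "\<dots> \<le> \<bar>V0\<bar> * exp (- (2 * \<mu>) * t)"
          by (intro mult_right_mono) auto
        finally have U_le: "8 * U t \<le> 8 * (\<bar>V0\<bar> * exp (- (2 * \<mu>) * t))" by simp
        have "(?y i t - ystar i)\<^sup>2 = (?\<zeta> i t 0 + (z i t - ystar i))\<^sup>2"
          unfolding y_eq[OF i t] by (simp only: add_diff_eq)
        also have "\<dots> \<le> 8 * U t"
          unfolding U_def
          by (rule energy_lower[where i = i and z = "\<lambda>j. z j t - ystar j" and \<zeta> = "\<lambda>j. ?\<zeta> j t"])
            (rule \<delta> \<Gamma> i rpos P(2) R(2) | assumption)+
        also have "\<dots> \<le> 8 * (\<bar>V0\<bar> * exp (- (2 * \<mu>) * t))"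
          by (rule U_le)
        also have "\<dots> = (sqrt (8 * \<bar>V0\<bar>) * exp (- \<mu> * t))\<^sup>2"
          by (simp add: power_mult_distrib exp_double[symmetric] mult.assoc)
        finally have "\<bar>?y i t - ystar i\<bar> \<le> \<bar>sqrt (8 * \<bar>V0\<bar>) * exp (- \<mu> * t)\<bar>"
          by (simp only: abs_le_square_iff)
        also have "\<dots> \<le> (sqrt (8 * \<bar>V0\<bar>) + 1) * exp (- \<mu> * t)"
          by (simp add: distrib_right)
        finally show ?thesis .
      qed
      moreover have "sqrt (8 * \<bar>V0\<bar>) + 1 > 0" by (simp add: add_nonneg_pos)
      ultimately show ?thesis by (intro exI[of _ "sqrt (8 * \<bar>V0\<bar>) + 1"]) blast
    qed
    show ?thesis using \<mu> bound by (intro exI[of _ \<mu>]) blast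
  qed
  show ?thesis
    using \<epsilon>star goal by (intro exI[of _ \<epsilon>star]) blast
qed

end
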